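(* There exist $h_0>0$ and constants $c,\delta>0$ such that, for all $x\in M$, all $\rho\in\,]0,\rho_0]$ and all $h\in\,]0,h_0]$, $$s^n_{h,\rho}(x,dy)=r_h(x,dy)+ch^{-n}\mathbf 1_{\{d_g(x,y)<\delta h\}}\,d_gy,$$ where $r_h(x,dy)$ is a positive Borel measure for all $x\in M$.
   Context: Setting. $(M,g)$ is a connected closed smooth Riemannian manifold of dimension $n$, with Riemannian distance $d_g$ and Riemannian volume measure $d_gy$, given with an atlas $\{(U_\alpha,\varphi_\alpha)\}_\alpha$. $A:C^\infty(M)\to C^\infty(M)$ is a second-order differential operator whose local expressions $A_\alpha f=A(f\circ\varphi_\alpha)\circ\varphi_\alpha^{-1}$ have the form $A_\alpha=-\sum_{i,j}a^{(\alpha)}_{ij}\partial_i\partial_j+\sum_kb^{(\alpha)}_k\partial_k+d^{(\alpha)}$ with smooth coefficients. Standing assumptions: $A$ is subelliptic of order $\varepsilon\in(0,1)$, i.e. for some $c,C>0$, $\|Au\|_0+C\|u\|_0\ge c\|u\|_{2\varepsilon}$ for all $u\in C^\infty(M)$ ($\|\cdot\|_s$ the Sobolev norm of order $s$ on $M$); the coefficients are real and $(a^{(\alpha)}_{ij})_{i,j}$ is symmetric positive semidefinite at each point; $A$ is formally self-adjoint; no $a^{(\alpha)}_{ij}$ vanishes identically on a nonempty open set. A Lipschitz curve $\gamma:[0,1]\to M$ is subunit for $\sigma^2A$ if for a.e. $t$, $|\xi(\dot\gamma(t))|^2\le\sigma^2a_2(\gamma(t),\xi)$ for all $\xi\in T^*_{\gamma(t)}M$,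 where $a_2$ is the principal symbol, locally $\sum a_{ij}\xi_i\xi_j$; $B_A(x,s)$ is the set of $x'$ with $d_A(x,x')<s$, where $d_A(x,x')$ is the infimum of $\sigma>0$ such that a subunit curve for $\sigma^2A$ joins $x$ to $x'$. The same definitions apply to local expressions on open subsets of $\mathbb{R}^n$. Subunit cubes. $M$ is covered by finitely many geodesic balls $V_\ell$, with normal-coordinate charts $\varphi_\ell$ defined near $\overline{V_\ell}$; $A_\ell$ is the local expression of $A$ in $\varphi_\ell$. The number $\rho_0>0$ is fixed so small that for all $\rho\in\,]0,\rho_0]$ and $x\in M$ the following data exist (and are fixed): an index $\ell$ with $x\in V_\ell$; a block $Q_\rho=\prod_{j=1}^n]-c_j\rho^{\kappa_j},c_j\rho^{\kappa_j}[$ with constants $c_1=1$, $c_j>0$, $1=\kappa_1\le\dots\le\kappa_n=1/\varepsilon$; its dilation $Q_\rho^\ast=Q_{c^\ast\rho}$, $c^\ast>1$ fixed; and a diffeomorphism $\Phi_x$ of $Q^\ast_\rho$ onto an open subset of $\varphi_\ell(V_\ell)$, with derivatives bounded uniformly in $x$, $\Phi_x(0)=\varphi_\ell(x)$ and $\Phi_x(Q^\ast_\rho)\subseteq B_{A_\ell}(\varphi_\ell(x),C\rho)$, $C>0$ universal. Put $\Psi_x=\Phi_x^{-1}\circ\varphi_\ell$, $Q_A(x,\rho)=\Psi_x^{-1}(Q_\rho)$, $Q_A^\ast(x,\rho)=\Psi_x^{-1}(Q_\rho^\ast)$. By compactness fix $x_1,\dots,x_N\in M$, $N=N(\rho)$,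 such that the sets $Q_i:=Q_A(x_i,\rho)$ cover $M$; write $Q_i^\ast:=Q^\ast_A(x_i,\rho)$, $\Psi_i:=\Psi_{x_i}$, with coordinates $w^{(i)}$ on $Q_\rho^\ast=\Psi_i(Q_i^\ast)$ and block constants $c^{(i)}_j,\kappa^{(i)}_j$. Measure and vector fields. Let $\{\psi_k\}_{k=1}^N$ be a smooth partition of unity subordinate to $\{Q_k^\ast\}$ and $d\mu=\sum_{k=1}^N\psi_k\,\Psi_k^*|dw^{(k)}|$, multiplied by a constant so that $\mu(M)=1$. On $Q_\rho^\ast=\Psi_i(Q_i^\ast)$, $d\mu$ reads $\tilde\gamma_i|dw^{(i)}|$ with $\tilde\gamma_i>0$ smooth. Set $\tilde X_{i,j}=\frac{c^{(i)}_j\rho^{\kappa^{(i)}_j}}{\tilde\gamma_i}\frac{\partial}{\partial w^{(i)}_j}$ (up to a fixed positive rescaling of the $c_j^{(i)}$) and $X_{i,j}=(\Psi_i^{-1})_*\tilde X_{i,j}$, a vector field on $Q_i^\ast$; $e^{tX_{i,j}}$ is its flow. Markov operator. $h_0$ is always small enough that $e^{tX_{i,j}}x\in Q_i^\ast$ is defined for $x\in Q_i$, $|t|<h_0$. For $h\in\,]0,h_0]$ let $\chi_{i,j,h,\rho}(t,x)=1$ if $|t|<h$, $x\in Q_i$ and $e^{tX_{i,j}}x\in Q_i$, and $=0$ otherwise. Define $$S_{i,j,h,\rho}f(x)=\Bigl(1-\frac1{2h}\int_{-h}^h\chi_{i,j,h,\rho}(t,x)dt\Bigr)f(x)+\frac1{2h}\int_{-h}^h\chi_{i,j,h,\rho}(t,x)f(e^{tX_{i,j}}x)dt,$$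 (the second integrand being $0$ where $\chi_{i,j,h,\rho}=0$) and $S_{h,\rho}=\frac1{nN}\sum_{i=1}^N\sum_{j=1}^nS_{i,j,h,\rho}$. $s^k_{h,\rho}(x,dy)$ is the Markov kernel of the $k$-th iterate: $S^k_{h,\rho}f(x)=\int_Mf(y)s^k_{h,\rho}(x,dy)$; here $k=n=\dim M$.
   Formalization: The constants h_0, c, δ are allowed to depend on ρ (uniform in x and h); constants uniform for all ρ in ]0,ρ_0] cannot exist, since s^n_{h,ρ}(x,·) is carried by a d_g-ball of radius O(ρ) about x. *)

theory Defs
  imports "HOL-Analysis.Analysis"
begin

section \<open>Smooth maps between Euclidean spaces\<close>

definition pd :: "'n::finite \<Rightarrow> (real^'n \<Rightarrow> 'b::real_normed_vector) \<Rightarrow> real^'n \<Rightarrow> 'b" where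
  "pd i f y = frechet_derivative f (at y) (axis i 1)"

primrec pds :: "'n::finite list \<Rightarrow> (real^'n \<Rightarrow> 'b::real_normed_vector) \<Rightarrow> real^'n \<Rightarrow> 'b" where
  "pds [] f = f"
| "pds (i # is) f = pd i (pds is f)"

text \<open>On an open set this is the class of infinitely differentiable maps: all iterated partial
  derivatives exist and are (Frechet) differentiable, hence continuous.\<close>

definition smooth_on :: "(real^'n::finite) set \<Rightarrow> (real^'n \<Rightarrow> 'b::real_normed_vector) \<Rightarrow> bool" where
  "smooth_on S f \<longleftrightarrow> (\<forall>is. \<forall>y\<in>S. pds is f differentiable (at y))"

definition jac :: "(real^'n::finite \<Rightarrow> real^'n) \<Rightarrow> real^'n \<Rightarrow> real^'n^'n" where
  "jac f y = matrix (frechet_derivative f (at y))"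


section \<open>Charts and atlases\<close>

text \<open>The manifold is the whole of a Hausdorff topological type; its dimension is \<open>CARD('n)\<close>.
  A chart is a pair (domain, coordinate map); the values of the map outside the domain are
  irrelevant. Matrix-valued and scalar local data (metric, coefficients) are
  functions of the coordinates of the given chart.\<close>

type_synonym 'n rvec = "(real, 'n) vec"
type_synonym 'n rmat = "((real, 'n) vec, 'n) vec"

type_synonym ('m, 'n) chart = "'m set \<times> ('m \<Rightarrow> 'n rvec)"

definition img :: "('m, 'n::finite) chart \<Rightarrow> (real^'n) set" where
  "img c = snd c ` fst c"

definition par :: "('m, 'n::finite) chart \<Rightarrow> real^'n \<Rightarrow> 'm" where
  "par c = inv_into (fst c) (snd c)"

definition is_chart :: "('m::topological_space, 'n::finite) chart \<Rightarrow> bool" where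
  "is_chart c \<longleftrightarrow> open (fst c) \<and> open (img c) \<and> homeomorphism (fst c) (img c) (snd c) (par c)"

definition trans_map :: "('m, 'n::finite) chart \<Rightarrow> ('m, 'n) chart \<Rightarrow> real^'n \<Rightarrow> real^'n" where
  "trans_map c d = snd d \<circ> par c"

definition compatible :: "('m, 'n::finite) chart \<Rightarrow> ('m, 'n) chart \<Rightarrow> bool" where
  "compatible c d \<longleftrightarrow>
     smooth_on (snd c ` (fst c \<inter> fst d)) (trans_map c d) \<and>
     smooth_on (snd d ` (fst c \<inter> fst d)) (trans_map d c)"

definition smooth_atlas :: "('m::topological_space, 'n::finite) chart set \<Rightarrow> bool" where
  "smooth_atlas atl \<longleftrightarrow> (\<forall>c\<in>atl. is_chart c) \<and> (\<Union>c\<in>atl. fst c) = UNIV \<and>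
     (\<forall>c\<in>atl. \<forall>d\<in>atl. compatible c d)"

definition max_atlas :: "('m::topological_space, 'n::finite) chart set \<Rightarrow> ('m, 'n) chart set" where
  "max_atlas atl = {c. is_chart c \<and> (\<forall>d\<in>atl. compatible c d)}"

definition C_inf :: "('m, 'n::finite) chart set \<Rightarrow> ('m \<Rightarrow> real) set" where
  "C_inf atl = {u. \<forall>c\<in>atl. smooth_on (img c) (u \<circ> par c)}"


section \<open>Riemannian metric, distance and volume\<close>

definition riemannian_metric ::
  "('m::topological_space, 'n::finite) chart set \<Rightarrow> (('m, 'n) chart \<Rightarrow> real^'n \<Rightarrow> real^'n^'n) \<Rightarrow> bool"
where
  "riemannian_metric atl g \<longleftrightarrow>
     (\<forall>c\<in>max_atlas atl. smooth_on (img c) (g c) \<and>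
        (\<forall>y\<in>img c. transpose (g c y) = g c y \<and> (\<forall>v. v \<noteq> 0 \<longrightarrow> v \<bullet> (g c y *v v) > 0))) \<and>
     (\<forall>c\<in>max_atlas atl. \<forall>d\<in>max_atlas atl. \<forall>p\<in>fst c \<inter> fst d.
        g c (snd c p) =
          transpose (jac (trans_map c d) (snd c p)) ** g d (snd d p) ** jac (trans_map c d) (snd c p))"

text \<open>Piecewise continuously differentiable curves; the endpoints may be put into \<open>T\<close>.\<close>

definition pw_C1_curve :: "('m::topological_space, 'n::finite) chart set \<Rightarrow> (real \<Rightarrow> 'm) \<Rightarrow> bool" where
  "pw_C1_curve atl \<gamma> \<longleftrightarrow> continuous_on {0..1} \<gamma> \<and>
     (\<exists>T. finite T \<and> (\<forall>t\<in>{0..1} - T. \<forall>c\<in>atl. \<gamma> t \<in> fst c \<longrightarrow>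
        (\<exists>e>0. (snd c \<circ> \<gamma>) C1_differentiable_on {t - e<..<t + e})))"

definition speed ::
  "('m, 'n::finite) chart set \<Rightarrow> (('m, 'n) chart \<Rightarrow> real^'n \<Rightarrow> real^'n^'n) \<Rightarrow> (real \<Rightarrow> 'm) \<Rightarrow> real \<Rightarrow> real"
where
  "speed atl g \<gamma> t =
     (let c = (SOME c. c \<in> atl \<and> \<gamma> t \<in> fst c); v = vector_derivative (snd c \<circ> \<gamma>) (at t)
      in sqrt (v \<bullet> (g c (snd c (\<gamma> t)) *v v)))"

text \<open>The length is extended-valued, because derivatives may be unbounded near break points.\<close>

definition curve_length ::
  "('m, 'n::finite) chart set \<Rightarrow> (('m, 'n) chart \<Rightarrow> real^'n \<Rightarrow> real^'n^'n) \<Rightarrow> (real \<Rightarrow> 'm) \<Rightarrow> ennreal"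
where
  "curve_length atl g \<gamma> = (\<integral>\<^sup>+t\<in>{0..1}. ennreal (speed atl g \<gamma> t) \<partial>lborel)"

definition riem_dist ::
  "('m::topological_space, 'n::finite) chart set \<Rightarrow> (('m, 'n) chart \<Rightarrow> real^'n \<Rightarrow> real^'n^'n)
    \<Rightarrow> 'm \<Rightarrow> 'm \<Rightarrow> real"
where
  "riem_dist atl g x y =
     enn2real (INF \<gamma>\<in>{\<gamma>. pw_C1_curve atl \<gamma> \<and> \<gamma> 0 = x \<and> \<gamma> 1 = y}. curve_length atl g \<gamma>)"

definition riemannian_volume ::
  "('m::topological_space, 'n::finite) chart set \<Rightarrow> (('m, 'n) chart \<Rightarrow> real^'n \<Rightarrow> real^'n^'n)
    \<Rightarrow> 'm measure \<Rightarrow> bool"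
where
  "riemannian_volume atl g vol \<longleftrightarrow> sets vol = sets borel \<and>
     (\<forall>c\<in>atl. \<forall>B\<in>sets borel. B \<subseteq> fst c \<longrightarrow>
        emeasure vol B = (\<integral>\<^sup>+y\<in>snd c ` B. ennreal (sqrt (det (g c y))) \<partial>lborel))"


section \<open>Geodesics, normal coordinates and geodesic balls\<close>

definition christoffel ::
  "(real^'n::finite \<Rightarrow> real^'n^'n) \<Rightarrow> real^'n \<Rightarrow> 'n \<Rightarrow> 'n \<Rightarrow> 'n \<Rightarrow> real"
where
  "christoffel G y k i j = 1/2 * (\<Sum>l\<in>UNIV. matrix_inv (G y) $ k $ l *
     (pd i (\<lambda>z. G z $ j $ l) y + pd j (\<lambda>z. G z $ i $ l) y - pd l (\<lambda>z. G z $ i $ j) y))"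

definition coord_geodesic ::
  "(real^'n::finite \<Rightarrow> real^'n^'n) \<Rightarrow> real set \<Rightarrow> (real \<Rightarrow> real^'n) \<Rightarrow> bool"
where
  "coord_geodesic G I \<gamma> \<longleftrightarrow> (\<exists>v a. \<forall>t\<in>I.
     (\<gamma> has_vector_derivative v t) (at t) \<and> (v has_vector_derivative a t) (at t) \<and>
     (\<forall>k. a t $ k + (\<Sum>i\<in>UNIV. \<Sum>j\<in>UNIV. christoffel G (\<gamma> t) k i j * v t $ i * v t $ j) = 0))"

text \<open>Normal coordinates, centred at the point with coordinates 0: the metric is the identity at
  the centre and the rays from the origin are geodesics.\<close>

definition normal_chart ::
  "('m::topological_space, 'n::finite) chart set \<Rightarrow> (('m, 'n) chart \<Rightarrow> real^'n \<Rightarrow> real^'n^'n)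
    \<Rightarrow> ('m, 'n) chart \<Rightarrow> bool"
where
  "normal_chart atl g c \<longleftrightarrow> c \<in> max_atlas atl \<and> 0 \<in> img c \<and>
     (\<forall>y\<in>img c. \<forall>t\<in>{0..1}. t *\<^sub>R y \<in> img c) \<and> g c 0 = mat 1 \<and>
     (\<forall>\<xi>. coord_geodesic (g c) {t. t *\<^sub>R \<xi> \<in> img c} (\<lambda>t. t *\<^sub>R \<xi>))"

definition geodesic_ball :: "('m, 'n::finite) chart \<Rightarrow> real \<Rightarrow> 'm set" where
  "geodesic_ball c r = {p \<in> fst c. norm (snd c p) < r}"


section \<open>Sobolev norms\<close>

definition fourier :: "(real^'n::finite \<Rightarrow> real) \<Rightarrow> real^'n \<Rightarrow> complex" where
  "fourier f \<xi> = (\<integral>y. cis (- (y \<bullet> \<xi>)) * complex_of_real (f y) \<partial>lborel)"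

definition Hs_norm :: "real \<Rightarrow> (real^'n::finite \<Rightarrow> real) \<Rightarrow> real" where
  "Hs_norm s f = sqrt (1 / (2 * pi) ^ CARD('n) *
     (\<integral>\<xi>. (1 + (norm \<xi>)\<^sup>2) powr s * (cmod (fourier f \<xi>))\<^sup>2 \<partial>lborel))"

definition partition_of_unity ::
  "('m::topological_space, 'n::finite) chart set \<Rightarrow> (('m, 'n) chart \<times> ('m \<Rightarrow> real)) set \<Rightarrow> bool"
where
  "partition_of_unity atl P \<longleftrightarrow> finite P \<and>
     (\<forall>(c, \<eta>)\<in>P. c \<in> atl \<and> \<eta> \<in> C_inf atl \<and> (\<forall>p. \<eta> p \<ge> 0) \<and> closure {p. \<eta> p \<noteq> 0} \<subseteq> fst c) \<and>
     (\<forall>p. (\<Sum>(c, \<eta>)\<in>P. \<eta> p) = 1)"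

definition sobolev_norm ::
  "(('m, 'n::finite) chart \<times> ('m \<Rightarrow> real)) set \<Rightarrow> real \<Rightarrow> ('m \<Rightarrow> real) \<Rightarrow> real"
where
  "sobolev_norm P s u = sqrt (\<Sum>(c, \<eta>)\<in>P.
     (Hs_norm s (\<lambda>y. if y \<in> img c then \<eta> (par c y) * u (par c y) else 0))\<^sup>2)"


section \<open>The operator\<close>

definition local_expression ::
  "('m::topological_space, 'n::finite) chart set \<Rightarrow> (('m \<Rightarrow> real) \<Rightarrow> 'm \<Rightarrow> real) \<Rightarrow> ('m, 'n) chart \<Rightarrow>
    (real^'n \<Rightarrow> real^'n^'n) \<Rightarrow> (real^'n \<Rightarrow> real^'n) \<Rightarrow> (real^'n \<Rightarrow> real) \<Rightarrow> bool"
where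
  "local_expression atl A c a b d \<longleftrightarrow>
     smooth_on (img c) a \<and> smooth_on (img c) b \<and> smooth_on (img c) d \<and>
     (\<forall>u\<in>C_inf atl. \<forall>y\<in>img c. A u (par c y) =
        - (\<Sum>i\<in>UNIV. \<Sum>j\<in>UNIV. a y $ i $ j * pd i (pd j (u \<circ> par c)) y)
        + (\<Sum>k\<in>UNIV. b y $ k * pd k (u \<circ> par c) y) + d y * (u \<circ> par c) y)"

text \<open>Sobolev norms on a compact manifold depend on the partition of unity only up to equivalence,
  so the choice of \<open>P\<close> is immaterial.\<close>

definition subelliptic ::
  "('m::topological_space, 'n::finite) chart set \<Rightarrow> (('m \<Rightarrow> real) \<Rightarrow> 'm \<Rightarrow> real) \<Rightarrow> real \<Rightarrow> bool"
where
  "subelliptic atl A \<epsilon> \<longleftrightarrow> (\<exists>P. partition_of_unity atl P \<and> (\<exists>c>0. \<exists>C>0. \<forall>u\<in>C_inf atl.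
     sobolev_norm P 0 (A u) + C * sobolev_norm P 0 u \<ge> c * sobolev_norm P (2 * \<epsilon>) u))"

locale subelliptic_manifold =
  fixes atl :: "('m::t2_space, 'n::{finite,linorder}) chart set"
    and g :: "('m, 'n) chart \<Rightarrow> 'n rvec \<Rightarrow> 'n rmat"
    and vol :: "'m measure"
    and A :: "('m \<Rightarrow> real) \<Rightarrow> 'm \<Rightarrow> real"
    and a :: "('m, 'n) chart \<Rightarrow> 'n rvec \<Rightarrow> 'n rmat"
    and b :: "('m, 'n) chart \<Rightarrow> 'n rvec \<Rightarrow> 'n rvec"
    and d :: "('m, 'n) chart \<Rightarrow> 'n rvec \<Rightarrow> real"
    and \<epsilon> :: real
  assumes compact_M: "compact (UNIV :: 'm set)"
    and connected_M: "connected (UNIV :: 'm set)"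
    and atlas: "smooth_atlas atl"
    and metric: "riemannian_metric atl g"
    and volume: "riemannian_volume atl g vol"
    and A_smooth: "u \<in> C_inf atl \<Longrightarrow> A u \<in> C_inf atl"
    and A_local: "c \<in> max_atlas atl \<Longrightarrow> local_expression atl A c (a c) (b c) (d c)"
    and eps: "0 < \<epsilon>" "\<epsilon> < 1"
    and A_subelliptic: "subelliptic atl A \<epsilon>"
    and a_symmetric: "c \<in> atl \<Longrightarrow> y \<in> img c \<Longrightarrow> transpose (a c y) = a c y"
    and a_psd: "c \<in> atl \<Longrightarrow> y \<in> img c \<Longrightarrow> \<xi> \<bullet> (a c y *v \<xi>) \<ge> 0"
    and A_selfadjoint: "u \<in> C_inf atl \<Longrightarrow> v \<in> C_inf atl \<Longrightarrow>
          (\<integral>p. A u p * v p \<partial>vol) = (\<integral>p. u p * A v p \<partial>vol)"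
    and a_nonvanishing: "c \<in> atl \<Longrightarrow> open W \<Longrightarrow> W \<noteq> {} \<Longrightarrow> W \<subseteq> img c \<Longrightarrow> \<exists>y\<in>W. a c y $ i $ j \<noteq> 0"


section \<open>Subunit balls of a local expression\<close>

definition subunit_curve ::
  "(real^'n::finite) set \<Rightarrow> (real^'n \<Rightarrow> real^'n^'n) \<Rightarrow> real \<Rightarrow> (real \<Rightarrow> real^'n) \<Rightarrow> bool"
where
  "subunit_curve \<Omega> a \<sigma> \<gamma> \<longleftrightarrow> (\<exists>L. L-lipschitz_on {0..1} \<gamma>) \<and> \<gamma> ` {0..1} \<subseteq> \<Omega> \<and>
     (AE t in lebesgue_on {0..1}. \<exists>v. (\<gamma> has_vector_derivative v) (at t) \<and>
        (\<forall>\<xi>. \<bar>\<xi> \<bullet> v\<bar>\<^sup>2 \<le> \<sigma>\<^sup>2 * (\<xi> \<bullet> (a (\<gamma> t) *v \<xi>))))"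

definition subunit_dist ::
  "(real^'n::finite) set \<Rightarrow> (real^'n \<Rightarrow> real^'n^'n) \<Rightarrow> real^'n \<Rightarrow> real^'n \<Rightarrow> ereal"
where
  "subunit_dist \<Omega> a y z =
     Inf {ereal \<sigma> | \<sigma>. \<sigma> > 0 \<and> (\<exists>\<gamma>. subunit_curve \<Omega> a \<sigma> \<gamma> \<and> \<gamma> 0 = y \<and> \<gamma> 1 = z)}"

definition subunit_ball ::
  "(real^'n::finite) set \<Rightarrow> (real^'n \<Rightarrow> real^'n^'n) \<Rightarrow> real^'n \<Rightarrow> real \<Rightarrow> (real^'n) set"
where
  "subunit_ball \<Omega> a y s = {z \<in> \<Omega>. subunit_dist \<Omega> a y z < ereal s}"


section \<open>Subunit cubes\<close>

text \<open>The data attached to a pair (\<open>\<rho>\<close>, \<open>x\<close>): the normal chart and radius of the selected geodesic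
  ball, the block constants and the map \<open>\<Phi>\<^sub>x\<close>.\<close>

record ('m, 'n) cube =
  cchart :: "('m, 'n) chart"
  crad :: real
  cconst :: "'n \<Rightarrow> real"
  cexp :: "'n \<Rightarrow> real"
  cPhi :: "'n rvec \<Rightarrow> 'n rvec"

definition block :: "('m, 'n::finite) cube \<Rightarrow> real \<Rightarrow> (real^'n) set" where
  "block K \<rho> = {w. \<forall>j. \<bar>w $ j\<bar> < cconst K j * \<rho> powr cexp K j}"

definition Psi :: "('m, 'n::finite) cube \<Rightarrow> real \<Rightarrow> 'm \<Rightarrow> real^'n" where
  "Psi K \<rho>' p = inv_into (block K \<rho>') (cPhi K) (snd (cchart K) p)"

definition Psi_inv :: "('m, 'n::finite) cube \<Rightarrow> real^'n \<Rightarrow> 'm" where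
  "Psi_inv K w = par (cchart K) (cPhi K w)"

text \<open>\<open>Q_A(x,\<rho>)\<close> is \<open>QA K \<rho>\<close>, and \<open>Q\<^sub>A\<^sup>*(x,\<rho>)\<close> is \<open>QA K (cs * \<rho>)\<close>, with \<open>K\<close> the data of (\<open>\<rho>\<close>, \<open>x\<close>)
  and \<open>cs\<close> the dilation constant. The second argument of \<open>Psi\<close> is likewise \<open>cs * \<rho>\<close>.\<close>

definition QA :: "('m, 'n::finite) cube \<Rightarrow> real \<Rightarrow> 'm set" where
  "QA K \<rho> = Psi_inv K ` block K \<rho>"

locale subunit_cubes = subelliptic_manifold atl g vol A a b d \<epsilon>
  for atl :: "('m::t2_space, 'n::{finite,linorder}) chart set" and g vol A a b d \<epsilon> +
  fixes balls :: "(('m, 'n) chart \<times> real) set"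
    and \<rho>0 cs :: real
    and D :: "real \<Rightarrow> 'm \<Rightarrow> ('m, 'n) cube"
  assumes balls_finite: "finite balls"
    and balls_normal: "(c, r) \<in> balls \<Longrightarrow> normal_chart atl g c \<and> 0 < r \<and> cball 0 r \<subseteq> img c"
    and balls_cover: "(\<Union>(c, r)\<in>balls. geodesic_ball c r) = UNIV"
    and rho0: "0 < \<rho>0"
    and cs: "1 < cs"
    and cube_ball: "0 < \<rho> \<Longrightarrow> \<rho> \<le> \<rho>0 \<Longrightarrow>
          (cchart (D \<rho> x), crad (D \<rho> x)) \<in> balls \<and>
          x \<in> geodesic_ball (cchart (D \<rho> x)) (crad (D \<rho> x))"
    and cube_const: "0 < \<rho> \<Longrightarrow> \<rho> \<le> \<rho>0 \<Longrightarrow>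
          cconst (D \<rho> x) (Min UNIV) = 1 \<and> (\<forall>j. cconst (D \<rho> x) j > 0)"
    and cube_exp: "0 < \<rho> \<Longrightarrow> \<rho> \<le> \<rho>0 \<Longrightarrow>
          cexp (D \<rho> x) (Min UNIV) = 1 \<and> mono (cexp (D \<rho> x)) \<and> cexp (D \<rho> x) (Max UNIV) = 1 / \<epsilon>"
    and Phi_diffeo: "0 < \<rho> \<Longrightarrow> \<rho> \<le> \<rho>0 \<Longrightarrow>
          (let K = D \<rho> x; Q = block K (cs * \<rho>) in
             smooth_on Q (cPhi K) \<and> inj_on (cPhi K) Q \<and> open (cPhi K ` Q) \<and>
             smooth_on (cPhi K ` Q) (inv_into Q (cPhi K)) \<and>
             cPhi K ` Q \<subseteq> snd (cchart K) ` geodesic_ball (cchart K) (crad K) \<and>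
             cPhi K 0 = snd (cchart K) x)"
    and Phi_bounded: "0 < \<rho> \<Longrightarrow> \<rho> \<le> \<rho>0 \<Longrightarrow>
          \<exists>B. \<forall>x. \<forall>w\<in>block (D \<rho> x) (cs * \<rho>). norm (pds is (cPhi (D \<rho> x)) w) \<le> B"
    and Phi_subunit: "\<exists>C>0. \<forall>\<rho> x. 0 < \<rho> \<and> \<rho> \<le> \<rho>0 \<longrightarrow>
          (let K = D \<rho> x in cPhi K ` block K (cs * \<rho>)
             \<subseteq> subunit_ball (img (cchart K)) (a (cchart K)) (snd (cchart K) x) (C * \<rho>))"


section \<open>The reference measure\<close>

definition mu_unnorm ::
  "real \<Rightarrow> nat \<Rightarrow> (nat \<Rightarrow> ('m, 'n::finite) cube) \<Rightarrow> (nat \<Rightarrow> 'm \<Rightarrow> real) \<Rightarrow> 'm set \<Rightarrow> ennreal"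
where
  "mu_unnorm \<rho>' N K \<psi> B = (\<Sum>k<N. \<integral>\<^sup>+w\<in>block (K k) \<rho>'.
     (ennreal (\<psi> k (Psi_inv (K k) w)) * indicator B (Psi_inv (K k) w)) \<partial>lborel)"

definition mu ::
  "real \<Rightarrow> nat \<Rightarrow> (nat \<Rightarrow> ('m, 'n::finite) cube) \<Rightarrow> (nat \<Rightarrow> 'm \<Rightarrow> real) \<Rightarrow> 'm set \<Rightarrow> ennreal"
where
  "mu \<rho>' N K \<psi> B = mu_unnorm \<rho>' N K \<psi> B / mu_unnorm \<rho>' N K \<psi> UNIV"

text \<open>The walk data for each \<open>\<rho>\<close>: the centres \<open>pts \<rho> i\<close> (\<open>i < N \<rho>\<close>), the partition of unity
  \<open>\<psi> \<rho> i\<close>, the densities \<open>\<gamma> \<rho> i\<close> of \<open>\<mu>\<close> in the coordinates of the \<open>i\<close>-th cube, and the fixed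
  rescaling factors \<open>\<theta> \<rho> i j\<close> of the block constants in the vector fields.\<close>

locale subunit_walk = subunit_cubes atl g vol A a b d \<epsilon> balls \<rho>0 cs D
  for atl :: "('m::t2_space, 'n::{finite,linorder}) chart set"
    and g vol A a b d \<epsilon> balls \<rho>0 cs D +
  fixes N :: "real \<Rightarrow> nat"
    and pts :: "real \<Rightarrow> nat \<Rightarrow> 'm"
    and \<psi> :: "real \<Rightarrow> nat \<Rightarrow> 'm \<Rightarrow> real"
    and \<gamma> :: "real \<Rightarrow> nat \<Rightarrow> 'n rvec \<Rightarrow> real"
    and \<theta> :: "real \<Rightarrow> nat \<Rightarrow> 'n \<Rightarrow> real"
  assumes cover: "0 < \<rho> \<Longrightarrow> \<rho> \<le> \<rho>0 \<Longrightarrow> (\<Union>i<N \<rho>. QA (D \<rho> (pts \<rho> i)) \<rho>) = UNIV"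
    and psi_smooth: "0 < \<rho> \<Longrightarrow> \<rho> \<le> \<rho>0 \<Longrightarrow> i < N \<rho> \<Longrightarrow>
          \<psi> \<rho> i \<in> C_inf atl \<and> (\<forall>p. \<psi> \<rho> i p \<ge> 0) \<and>
          closure {p. \<psi> \<rho> i p \<noteq> 0} \<subseteq> QA (D \<rho> (pts \<rho> i)) (cs * \<rho>)"
    and psi_sum: "0 < \<rho> \<Longrightarrow> \<rho> \<le> \<rho>0 \<Longrightarrow> (\<Sum>i<N \<rho>. \<psi> \<rho> i p) = 1"
    and density: "0 < \<rho> \<Longrightarrow> \<rho> \<le> \<rho>0 \<Longrightarrow> i < N \<rho> \<Longrightarrow>
          (let Q = block (D \<rho> (pts \<rho> i)) (cs * \<rho>) in
             smooth_on Q (\<gamma> \<rho> i) \<and> (\<forall>w\<in>Q. \<gamma> \<rho> i w > 0) \<and>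
             (\<forall>B\<in>sets borel. B \<subseteq> Q \<longrightarrow>
                mu (cs * \<rho>) (N \<rho>) (\<lambda>k. D \<rho> (pts \<rho> k)) (\<psi> \<rho>) (Psi_inv (D \<rho> (pts \<rho> i)) ` B)
                  = (\<integral>\<^sup>+w\<in>B. ennreal (\<gamma> \<rho> i w) \<partial>lborel)))"
    and theta: "0 < \<rho> \<Longrightarrow> \<rho> \<le> \<rho>0 \<Longrightarrow> i < N \<rho> \<Longrightarrow> \<theta> \<rho> i j > 0"


section \<open>Vector fields and flows\<close>

definition flow_to ::
  "(real^'n::finite) set \<Rightarrow> (real^'n \<Rightarrow> real^'n) \<Rightarrow> real \<Rightarrow> real^'n \<Rightarrow> real^'n \<Rightarrow> bool"
where
  "flow_to \<Omega> X t w z \<longleftrightarrow> (\<exists>u. u 0 = w \<and> u t = z \<and> (\<forall>s\<in>closed_segment 0 t.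
     u s \<in> \<Omega> \<and> (u has_vector_derivative X (u s)) (at s within closed_segment 0 t)))"

definition flow ::
  "(real^'n::finite) set \<Rightarrow> (real^'n \<Rightarrow> real^'n) \<Rightarrow> real \<Rightarrow> real^'n \<Rightarrow> real^'n"
where
  "flow \<Omega> X t w = (THE z. flow_to \<Omega> X t w z)"

definition Xfield ::
  "real \<Rightarrow> ('m, 'n::finite) cube \<Rightarrow> (real^'n \<Rightarrow> real) \<Rightarrow> ('n \<Rightarrow> real) \<Rightarrow> 'n \<Rightarrow> real^'n \<Rightarrow> real^'n"
where
  "Xfield \<rho> K \<gamma> \<theta> j w = (\<theta> j * cconst K j * \<rho> powr cexp K j / \<gamma> w) *\<^sub>R axis j 1"

text \<open>The flow of the push-forward \<open>X\<^sub>i\<^sub>,\<^sub>j\<close> of \<open>Xfield\<close> is the conjugate under \<open>\<Psi>\<^sub>i\<close> of the flow of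
  \<open>Xfield\<close> on the dilated block.\<close>

definition exp_X ::
  "real \<Rightarrow> real \<Rightarrow> ('m, 'n::finite) cube \<Rightarrow> (real^'n \<Rightarrow> real) \<Rightarrow> ('n \<Rightarrow> real) \<Rightarrow> 'n \<Rightarrow> real \<Rightarrow> 'm \<Rightarrow> 'm"
where
  "exp_X cs \<rho> K \<gamma> \<theta> j t x =
     Psi_inv K (flow (block K (cs * \<rho>)) (Xfield \<rho> K \<gamma> \<theta> j) t (Psi K (cs * \<rho>) x))"

definition exp_X_defined ::
  "real \<Rightarrow> real \<Rightarrow> ('m, 'n::finite) cube \<Rightarrow> (real^'n \<Rightarrow> real) \<Rightarrow> ('n \<Rightarrow> real) \<Rightarrow> 'n \<Rightarrow> real \<Rightarrow> 'm \<Rightarrow> bool"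
where
  "exp_X_defined cs \<rho> K \<gamma> \<theta> j t x \<longleftrightarrow>
     (\<exists>z. flow_to (block K (cs * \<rho>)) (Xfield \<rho> K \<gamma> \<theta> j) t (Psi K (cs * \<rho>) x) z)"


section \<open>The Markov operator and its kernels\<close>

definition chi ::
  "real \<Rightarrow> real \<Rightarrow> ('m, 'n::finite) cube \<Rightarrow> (real^'n \<Rightarrow> real) \<Rightarrow> ('n \<Rightarrow> real) \<Rightarrow> 'n \<Rightarrow> real \<Rightarrow> real \<Rightarrow> 'm \<Rightarrow> real"
where
  "chi cs \<rho> K \<gamma> \<theta> j h t x =
     (if \<bar>t\<bar> < h \<and> x \<in> QA K \<rho> \<and> exp_X cs \<rho> K \<gamma> \<theta> j t x \<in> QA K \<rho> then 1 else 0)"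

definition S_op ::
  "real \<Rightarrow> real \<Rightarrow> ('m, 'n::finite) cube \<Rightarrow> (real^'n \<Rightarrow> real) \<Rightarrow> ('n \<Rightarrow> real) \<Rightarrow> 'n \<Rightarrow> real
    \<Rightarrow> ('m \<Rightarrow> real) \<Rightarrow> 'm \<Rightarrow> real"
where
  "S_op cs \<rho> K \<gamma> \<theta> j h f x =
     (1 - 1 / (2 * h) * (LINT t:{-h..h}|lborel. chi cs \<rho> K \<gamma> \<theta> j h t x)) * f x +
     1 / (2 * h) * (LINT t:{-h..h}|lborel. chi cs \<rho> K \<gamma> \<theta> j h t x * f (exp_X cs \<rho> K \<gamma> \<theta> j t x))"

definition S_total ::
  "real \<Rightarrow> real \<Rightarrow> nat \<Rightarrow> (nat \<Rightarrow> ('m, 'n::finite) cube) \<Rightarrow> (nat \<Rightarrow> real^'n \<Rightarrow> real) \<Rightarrow> (nat \<Rightarrow> 'n \<Rightarrow> real)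
    \<Rightarrow> real \<Rightarrow> ('m \<Rightarrow> real) \<Rightarrow> 'm \<Rightarrow> real"
where
  "S_total cs \<rho> N K \<gamma> \<theta> h f x =
     1 / (real CARD('n) * real N) * (\<Sum>i<N. \<Sum>j\<in>UNIV. S_op cs \<rho> (K i) (\<gamma> i) (\<theta> i) j h f x)"

definition markov_kernel ::
  "(('m::topological_space \<Rightarrow> real) \<Rightarrow> 'm \<Rightarrow> real) \<Rightarrow> nat \<Rightarrow> 'm \<Rightarrow> 'm measure"
where
  "markov_kernel S k x = (THE \<nu>. sets \<nu> = sets borel \<and>
     (\<forall>f. f \<in> borel_measurable borel \<and> bounded (range f) \<longrightarrow> (S ^^ k) f x = (\<integral>y. f y \<partial>\<nu>)))"

text \<open>Pitfall: a step of \<open>S_total\<close> never leaves the cubes containing the current point, so the kernel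
  of the \<open>k\<close>-th iterate at \<open>x\<close> lives within distance \<open>O(k * \<rho>)\<close> of \<open>x\<close>. Hence a lower bound by
  Riemannian volume on balls of radius \<open>\<delta> * h\<close> can only hold with \<open>h \<le> h0\<close> and \<open>\<delta>\<close> (and the factor
  in front of the volume) depending on \<open>\<rho>\<close>: constants uniform for all small \<open>\<rho>\<close> do not exist.\<close>

end

theory Submission
  imports Defs "HOL-Probability.Probability"
begin

text \<open>Fix \<open>\<rho>\<close>. In the coordinates of a cube the flow of the \<open>j\<close>-th vector field moves only the
  \<open>j\<close>-th coordinate, with speed bounded above and below because the density is continuous and positive
  on the larger block. Hence one step of the walk in direction \<open>j\<close> has a component with density at
  least \<open>\<alpha> / h\<close> on an interval of length comparable to \<open>h\<close>, and going through the
  \<open>n\<close> coordinates one after the other gives a density at least \<open>(\<alpha> / h) ^ n\<close> on a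
  coordinate box of size comparable to \<open>h\<close>, provided that the starting point keeps a fixed margin to
  the boundary of the cube. By compactness every point of the manifold has such a margin in one of the
  finitely many cubes. Finally, a curve leaving a coordinate box of size \<open>r\<close> has length at least
  a constant times \<open>r\<close>, so the box contains a Riemannian ball, and the volume is bounded by a
  multiple of Lebesgue measure in the cube coordinates.\<close>

section \<open>Smooth maps\<close>

text \<open>\<open>markov_kernel\<close> is a definite description, so nothing can be said about it
  before a measure representing the iterate is produced and shown to be unique. Each
  \<open>S_op\<close> is therefore realised as the law of a jointly measurable move under a uniform
  time, and these laws are averaged and composed. Joint measurability is obtained by describing the
  flow through its inverse, the travel time, which is an explicit integral.

  The remainder measure is the difference of the kernel and the scaled volume on the ball.
  Everything thus reduces to one inequality for each Borel set, and one-sided estimates suffice: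
  from below for the kernel and the distance, from above for the volume. The lower bound keeps only
  steps in one cube with prescribed directions, which costs a factor 1 / (n N) per step, absorbed
  into \<alpha>.

  The volume is given by densities in the atlas charts, whereas the cubes live in normal charts of
  the maximal atlas; a Lipschitz estimate on small cubes and a covering argument compare the two and
  take the place of a change of variables formula.\<close>

lemma frechet_derivative_pd:
  fixes f :: "real^'n::finite \<Rightarrow> 'b::real_normed_vector"
  assumes "f differentiable (at y)"
  shows "frechet_derivative f (at y) v = (\<Sum>i\<in>UNIV. v $ i *\<^sub>R pd i f y)"
proof -
  have lin: "linear (frechet_derivative f (at y))"
    using assms by (rule linear_frechet_derivative)
  have "v = (\<Sum>i\<in>UNIV. v $ i *\<^sub>R axis i 1)"
    using basis_expansion[of v] by (simp add: scalar_mult_eq_scaleR)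
  then have "frechet_derivative f (at y) v = frechet_derivative f (at y) (\<Sum>i\<in>UNIV. v $ i *\<^sub>R axis i 1)"
    by (rule arg_cong)
  also have "\<dots> = (\<Sum>i\<in>UNIV. v $ i *\<^sub>R pd i f y)"
    by (simp add: linear_sum[OF lin] linear_cmul[OF lin] pd_def)
  finally show ?thesis .
qed

lemma pds_append: "pds (is @ js) f = pds is (pds js f)"
  by (induction "is") auto

lemma smooth_on_pd: "smooth_on S f \<Longrightarrow> smooth_on S (pd i f)"
  unfolding smooth_on_def
proof (intro allI ballI)
  fix "is" y assume "\<forall>is. \<forall>y\<in>S. pds is f differentiable (at y)" "y \<in> S"
  then have "pds (is @ [i]) f differentiable (at y)" by blast
  then show "pds is (pd i f) differentiable (at y)" by (simp add: pds_append)
qed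

lemma smooth_on_differentiable: "smooth_on S f \<Longrightarrow> y \<in> S \<Longrightarrow> f differentiable (at y)"
  unfolding smooth_on_def by (drule spec[of _ "[]"]) simp

lemma smooth_on_has_derivative:
  "smooth_on S f \<Longrightarrow> y \<in> S \<Longrightarrow> (f has_derivative frechet_derivative f (at y)) (at y)"
  using frechet_derivative_works smooth_on_differentiable by blast

lemma smooth_on_continuous: "smooth_on S f \<Longrightarrow> continuous_on S f"
  by (meson continuous_at_imp_continuous_on differentiable_imp_continuous_within smooth_on_differentiable)

text \<open>Partial derivatives of a smooth map are smooth again, hence continuous and bounded on a
  compact set; expanding the derivative in them bounds it as a linear map, so that no continuity in
  the operator norm has to be discussed.\<close>

lemma smooth_on_derivative_bounded:
  fixes f :: "real^'n::finite \<Rightarrow> 'b::real_normed_vector"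
  assumes f: "smooth_on S f" and K: "compact K" "K \<subseteq> S"
  obtains B where "B > 0" "\<And>y v. y \<in> K \<Longrightarrow> norm (frechet_derivative f (at y) v) \<le> B * norm v"
proof -
  have "\<exists>b. \<forall>y\<in>K. norm (pd i f y) \<le> b" for i
  proof -
    have "compact (pd i f ` K)"
      using K smooth_on_continuous[OF smooth_on_pd[OF f]]
      by (meson compact_continuous_image continuous_on_subset)
    then show ?thesis
      using compact_imp_bounded[of "pd i f ` K"] unfolding bounded_iff by blast
  qed
  then obtain b where b: "\<And>i y. y \<in> K \<Longrightarrow> norm (pd i f y) \<le> b i" by metis
  show ?thesis
  proof
    show "(\<Sum>i\<in>UNIV. \<bar>b i\<bar>) + 1 > 0" by (simp add: add_nonneg_pos sum_nonneg)
    fix y v assume y: "y \<in> K"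
    have "norm (frechet_derivative f (at y) v) \<le> (\<Sum>i\<in>UNIV. norm (v $ i *\<^sub>R pd i f y))"
    proof -
      have "y \<in> S" using y K by blast
      show ?thesis
        unfolding frechet_derivative_pd[OF smooth_on_differentiable[OF f \<open>y \<in> S\<close>]] by (rule norm_sum)
    qed
    also have "\<dots> \<le> (\<Sum>i\<in>UNIV. \<bar>b i\<bar> * norm v)"
    proof (rule sum_mono)
      fix i
      have "norm (pd i f y) \<le> \<bar>b i\<bar>" using b[OF y, of i] by linarith
      then show "norm (v $ i *\<^sub>R pd i f y) \<le> \<bar>b i\<bar> * norm v"
        using component_le_norm_cart[of v i]
        by (simp add: mult.commute[of "\<bar>b i\<bar>"] mult_mono)
    qed
    also have "\<dots> \<le> ((\<Sum>i\<in>UNIV. \<bar>b i\<bar>) + 1) * norm v"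
      by (simp add: sum_distrib_right[symmetric] mult_right_mono)
    finally show "norm (frechet_derivative f (at y) v) \<le> ((\<Sum>i\<in>UNIV. \<bar>b i\<bar>) + 1) * norm v" .
  qed
qed

lemma smooth_on_chain_vector_derivative:
  fixes f :: "real^'n::finite \<Rightarrow> 'b::real_normed_vector"
  assumes "smooth_on S f" "(z has_vector_derivative v) (at t)" "z t \<in> S"
  shows "((\<lambda>t. f (z t)) has_vector_derivative frechet_derivative f (at (z t)) v) (at t)"
  using vector_derivative_diff_chain_within[OF assms(2)
      has_derivative_at_withinI[OF smooth_on_has_derivative[OF assms(1,3)]]]
  unfolding o_def .

text \<open>A closed ball inside the open set is compact, which bounds the derivative, and convex,
  which lets the mean value inequality turn this bound into a Lipschitz constant.\<close>

lemma smooth_on_locally_Lipschitz: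
  fixes f :: "real^'n::finite \<Rightarrow> 'b::real_normed_vector"
  assumes f: "smooth_on S f" and S: "open S" "x \<in> S"
  obtains r B where "r > 0" "B > 0" "cball x r \<subseteq> S"
    "\<And>y z. y \<in> cball x r \<Longrightarrow> z \<in> cball x r \<Longrightarrow> norm (f y - f z) \<le> B * norm (y - z)"
proof -
  obtain r where r: "r > 0" "cball x r \<subseteq> S" using S open_contains_cball by blast
  obtain B where B: "B > 0" "\<And>y v. y \<in> cball x r \<Longrightarrow> norm (frechet_derivative f (at y) v) \<le> B * norm v"
    using smooth_on_derivative_bounded[OF f compact_cball r(2)] by blast
  show ?thesis
  proof (rule that[OF r(1) B(1) r(2)])
    fix y z assume yz: "y \<in> cball x r" "z \<in> cball x r"
    show "norm (f y - f z) \<le> B * norm (y - z)"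
    proof (rule differentiable_bound[of "cball x r" f "\<lambda>y. frechet_derivative f (at y)"])
      show "(f has_derivative frechet_derivative f (at u)) (at u within cball x r)" if "u \<in> cball x r" for u
        using has_derivative_at_withinI[OF smooth_on_has_derivative[OF f]] that r(2) by blast
      show "onorm (frechet_derivative f (at u)) \<le> B" if "u \<in> cball x r" for u
        using B that by (intro onorm_le) auto
    qed (use yz in auto)
  qed
qed

section \<open>Measures dominated by Lebesgue measure\<close>

text \<open>Outer regularity puts S into an open set of almost the same Lebesgue measure, and the
  covering lemma covers S inside it by nonoverlapping cubes, each containing a point of S at which
  it is small enough for \<open>small\<close>. Summing over the cubes gives the domination on
  S.\<close>

lemma emeasure_le_of_small_cubes:
  fixes \<nu> :: "'a::euclidean_space measure"
  assumes sets: "sets \<nu> = sets borel" and S: "S \<in> sets borel" "bounded S" and C: "0 \<le> C"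
    and small: "\<And>x. x \<in> S \<Longrightarrow> \<exists>r>0. \<forall>u v s. x \<in> cbox u v \<longrightarrow> cbox u v \<subseteq> ball x r \<longrightarrow>
        (\<forall>i\<in>Basis. v \<bullet> i - u \<bullet> i = s) \<longrightarrow> emeasure \<nu> (cbox u v) \<le> ennreal C * emeasure lborel (cbox u v)"
  shows "emeasure \<nu> S \<le> ennreal C * emeasure lborel S"
proof (rule ennreal_le_epsilon)
  fix e :: real assume e: "0 < e"
  define e' where "e' = e / (C + 1)"
  have e': "e' > 0" "C * e' \<le> e" using e C by (auto simp: e'_def field_simps)
  obtain T where T: "open T" "S \<subseteq> T" "T - S \<in> lmeasurable" "emeasure lebesgue (T - S) < ennreal e'"
    using sets_lebesgue_outer_open[of S e'] S e' by auto
  have LT: "emeasure lborel T \<le> emeasure lborel S + ennreal e'"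
  proof -
    have bT: "T - S \<in> sets borel" using T S by auto
    have "emeasure lborel T = emeasure lborel S + emeasure lborel (T - S)"
      using plus_emeasure[of S lborel "T - S"] S bT T by (simp add: Un_absorb1)
    moreover have "emeasure lborel (T - S) \<le> ennreal e'"
      using T(4) bT by (simp add: less_imp_le)
    ultimately show ?thesis by (simp add: add_left_mono)
  qed
  have "\<exists>r>0. x \<in> S \<longrightarrow> ball x r \<subseteq> T \<and> (\<forall>u v s. x \<in> cbox u v \<longrightarrow> cbox u v \<subseteq> ball x r \<longrightarrow>
        (\<forall>i\<in>Basis. v \<bullet> i - u \<bullet> i = s) \<longrightarrow> emeasure \<nu> (cbox u v) \<le> ennreal C * emeasure lborel (cbox u v))" for x
  proof (cases "x \<in> S")
    case True
    obtain r1 where r1: "r1 > 0" "ball x r1 \<subseteq> T" using T True open_contains_ball by (metis subsetD)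
    obtain r2 where r2: "r2 > 0" "\<forall>u v s. x \<in> cbox u v \<longrightarrow> cbox u v \<subseteq> ball x r2 \<longrightarrow>
        (\<forall>i\<in>Basis. v \<bullet> i - u \<bullet> i = s) \<longrightarrow> emeasure \<nu> (cbox u v) \<le> ennreal C * emeasure lborel (cbox u v)"
      using small[OF True] by blast
    show ?thesis
      using r1 r2 by (intro exI[of _ "min r1 r2"]) (auto simp: subset_iff)
  qed (auto intro: exI[of _ 1])
  then obtain R where R: "\<And>x. R x > 0" "\<And>x. x \<in> S \<Longrightarrow> ball x (R x) \<subseteq> T"
    "\<And>x u v s. x \<in> S \<Longrightarrow> x \<in> cbox u v \<Longrightarrow> cbox u v \<subseteq> ball x (R x) \<Longrightarrow>
        (\<And>i. i \<in> Basis \<Longrightarrow> v \<bullet> i - u \<bullet> i = s) \<Longrightarrow> emeasure \<nu> (cbox u v) \<le> ennreal C * emeasure lborel (cbox u v)"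
    by metis
  have g: "gauge (\<lambda>x. ball x (R x))" using R(1) by (simp add: gauge_def)
  obtain b where b: "\<And>x. x \<in> S \<Longrightarrow> norm x \<le> b" using S(2) bounded_iff by blast
  \<comment> \<open>The root box is a cube containing S; its dyadic subdivisions are then cubes as
    well, as \<open>small\<close> demands.\<close>
  define c where "c = \<bar>b\<bar> + 1"
  have c: "S \<subseteq> cbox (- c *\<^sub>R One) (c *\<^sub>R One)" "box (- c *\<^sub>R One :: 'a) (c *\<^sub>R One) \<noteq> {}"
  proof -
    show "S \<subseteq> cbox (- c *\<^sub>R One) (c *\<^sub>R One)"
    proof
      fix x assume "x \<in> S"
      then have "\<bar>x \<bullet> i\<bar> \<le> c" if "i \<in> Basis" for i
        using b[of x] Basis_le_norm[OF that, of x] by (auto simp: c_def)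
      then show "x \<in> cbox (- c *\<^sub>R One) (c *\<^sub>R One)"
        by (force simp: mem_box abs_le_iff)
    qed
    show "box (- c *\<^sub>R One :: 'a) (c *\<^sub>R One) \<noteq> {}" by (simp add: box_eq_empty c_def)
  qed
  obtain \<D> where D: "countable \<D>"
    "\<And>K. K \<in> \<D> \<Longrightarrow> interior K \<noteq> {} \<and> (\<exists>c d. K = cbox c d)"
    "pairwise (\<lambda>A B. interior A \<inter> interior B = {}) \<D>"
    "\<And>K. K \<in> \<D> \<Longrightarrow> \<exists>x \<in> S \<inter> K. K \<subseteq> ball x (R x)"
    "\<And>u v. cbox u v \<in> \<D> \<Longrightarrow> \<exists>n. \<forall>i \<in> Basis. v \<bullet> i - u \<bullet> i = ((c *\<^sub>R One) \<bullet> i - (- c *\<^sub>R One :: 'a) \<bullet> i) / 2^n"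
    "S \<subseteq> \<Union>\<D>"
    using covering_lemma[OF c g] by metis
  \<comment> \<open>An enumeration by all naturals, padded with the empty set because the family may
    be finite.\<close>
  define F where "F n = (if n \<in> to_nat_on \<D> ` \<D> then from_nat_into \<D> n else {})" for n
  have F: "F n \<in> \<D> \<or> F n = {}" for n
    using D(1) by (auto simp: F_def)
  have UF: "\<Union>(range F) = \<Union>\<D>"
  proof
    show "\<Union>\<D> \<subseteq> \<Union>(range F)"
    proof
      fix x assume "x \<in> \<Union>\<D>"
      then obtain K where "K \<in> \<D>" "x \<in> K" by blast
      then have "x \<in> F (to_nat_on \<D> K)" using D(1) by (simp add: F_def)
      then show "x \<in> \<Union>(range F)" by blast
    qed
    show "\<Union>(range F) \<subseteq> \<Union>\<D>" using F by blast
  qed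
  have disj: "disjoint_family (\<lambda>n. interior (F n))"
    unfolding disjoint_family_on_def
  proof (intro ballI impI)
    fix m n :: nat assume "m \<noteq> n"
    show "interior (F m) \<inter> interior (F n) = {}"
    proof (cases "m \<in> to_nat_on \<D> ` \<D> \<and> n \<in> to_nat_on \<D> ` \<D>")
      case True
      then obtain A B where "A \<in> \<D>" "B \<in> \<D>" "m = to_nat_on \<D> A" "n = to_nat_on \<D> B" by blast
      then show ?thesis using D(1,3) \<open>m \<noteq> n\<close> by (auto simp: F_def pairwise_def)
    qed (auto simp: F_def)
  qed
  \<comment> \<open>Neighbouring cubes may share boundary points, so the right-hand side uses
    interiors, which are disjoint and have the same Lebesgue measure.\<close>
  have cube: "emeasure \<nu> (F n) \<le> ennreal C * emeasure lborel (interior (F n)) \<and> F n \<in> sets borel \<and> F n \<subseteq> T" for n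
  proof (cases "F n = {}")
    case False
    then have Fn: "F n \<in> \<D>" using F by blast
    obtain u v where uv: "F n = cbox u v" using D(2)[OF Fn] by blast
    obtain x where x: "x \<in> S" "x \<in> cbox u v" "cbox u v \<subseteq> ball x (R x)" using D(4)[OF Fn] uv by auto
    obtain k where k: "\<And>i. i \<in> Basis \<Longrightarrow> v \<bullet> i - u \<bullet> i = (2*c) / 2^k"
      using D(5)[of u v] Fn uv by force
    have "emeasure \<nu> (cbox u v) \<le> ennreal C * emeasure lborel (cbox u v)"
      by (rule R(3)[OF x k])
    moreover have "emeasure lborel (cbox u v) = emeasure lborel (interior (cbox u v))"
    proof -
      have "box u v \<noteq> {}" using D(2)[OF Fn] uv by (metis interior_cbox)
      then show ?thesis by (simp add: box_ne_empty less_imp_le)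
    qed
    ultimately show ?thesis using uv x R(2)[OF x(1)] by auto
  qed auto
  have "emeasure \<nu> S \<le> emeasure \<nu> (\<Union>(range F))"
  proof (rule emeasure_mono)
    show "\<Union>(range F) \<in> sets \<nu>" using cube by (auto simp: sets simp del: UN_simps)
  qed (use D(6) UF in simp)
  also have "\<dots> \<le> (\<Sum>n. emeasure \<nu> (F n))"
    using cube by (intro emeasure_subadditive_countably) (auto simp: sets)
  also have "\<dots> \<le> (\<Sum>n. ennreal C * emeasure lborel (interior (F n)))"
    using cube by (intro suminf_le) auto
  also have "\<dots> = ennreal C * (\<Sum>n. emeasure lborel (interior (F n)))"
    by simp
  also have "(\<Sum>n. emeasure lborel (interior (F n))) = emeasure lborel (\<Union>n. interior (F n))"
    using disj by (intro suminf_emeasure) auto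
  also have "\<dots> \<le> emeasure lborel T"
  proof (rule emeasure_mono)
    show "(\<Union>n. interior (F n)) \<subseteq> T" using cube interior_subset by blast
  qed (use T(1) in simp)
  also note LT
  finally have "emeasure \<nu> S \<le> ennreal C * (emeasure lborel S + ennreal e')"
    by (simp add: mult_left_mono)
  also have "\<dots> = ennreal C * emeasure lborel S + ennreal (C * e')"
    using C e' by (simp add: distrib_left ennreal_mult)
  also have "\<dots> \<le> ennreal C * emeasure lborel S + ennreal e"
    using e' by (intro add_left_mono ennreal_leI)
  finally show "emeasure \<nu> S \<le> ennreal C * emeasure lborel S + ennreal e" .
qed

section \<open>Flows along coordinate lines\<close>

text \<open>Written as a translation along the axis: derivatives are immediate in this form, and the
  minorization lemmas use it for a general basis vector.\<close>

definition upd :: "'n::finite \<Rightarrow> real^'n \<Rightarrow> real \<Rightarrow> real^'n" where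
  "upd j w s = w + (s - w $ j) *\<^sub>R axis j 1"

lemma upd_nth [simp]: "upd j w s $ i = (if i = j then s else w $ i)"
  by (simp add: upd_def axis_def)

lemma upd_same [simp]: "upd j w (w $ j) = w"
  by (simp add: upd_def)

lemma upd_upd [simp]: "upd j (upd j w s) s' = upd j w s'"
  by (simp add: vec_eq_iff)

lemma upd_eqI: "(\<And>i. i \<noteq> j \<Longrightarrow> z $ i = w $ i) \<Longrightarrow> z = upd j w (z $ j)"
  by (simp add: vec_eq_iff)

lemma continuous_on_upd [continuous_intros]:
  "continuous_on S f \<Longrightarrow> continuous_on S (\<lambda>x. upd j w (f x))"
  unfolding upd_def by (intro continuous_intros)

lemma upd_has_vector_derivative:
  "(q has_vector_derivative q') F \<Longrightarrow> ((\<lambda>t. upd j w (q t)) has_vector_derivative q' *\<^sub>R axis j 1) F"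
  unfolding upd_def has_vector_derivative_def
  by (auto intro!: derivative_eq_intros simp: algebra_simps)

lemma borel_measurable_vec_nth' [measurable]: "(\<lambda>v::real^'n::finite. v $ j) \<in> borel_measurable borel"
  by (intro borel_measurable_continuous_onI continuous_intros)

lemma borel_measurable_upd [measurable (raw)]:
  fixes f :: "'a \<Rightarrow> real^'n::finite"
  assumes [measurable]: "f \<in> borel_measurable M" "g \<in> borel_measurable M"
  shows "(\<lambda>x. upd j (f x) (g x)) \<in> borel_measurable M"
proof -
  have "(\<lambda>x. f x $ j) \<in> borel_measurable M"
    by measurable
  then show ?thesis unfolding upd_def by measurable
qed

definition obox :: "('n::finite \<Rightarrow> real) \<Rightarrow> (real^'n) set" where
  "obox R = {w. \<forall>j. \<bar>w $ j\<bar> < R j}"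

lemma open_obox: "open (obox (R :: 'n::finite \<Rightarrow> real))"
proof -
  have "obox R = (\<Inter>j. {w. \<bar>w $ j\<bar> < R j})" by (auto simp: obox_def)
  moreover have "open {w::real^'n. \<bar>w $ j\<bar> < R j}" for j
    by (intro open_Collect_less continuous_intros)
  ultimately show ?thesis by (simp add: open_INT)
qed

lemma obox_borel [measurable]: "obox R \<in> sets borel"
  by (simp add: open_obox)

lemma upd_in_obox: "w \<in> obox R \<Longrightarrow> upd j w s \<in> obox R \<longleftrightarrow> \<bar>s\<bar> < R j"
  by (auto simp: obox_def)

text \<open>\<open>R\<close> will be the half-widths of the dilated block: the flow is studied
  there, and membership of its endpoint in the smaller block is tested afterwards.\<close>

locale line_flow =
  fixes R :: "'n::finite \<Rightarrow> real" and \<gamma> :: "real^'n \<Rightarrow> real" and \<kappa> :: real and j :: 'n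
  assumes cont: "continuous_on (obox R) \<gamma>" and pos: "w \<in> obox R \<Longrightarrow> \<gamma> w > 0" and kpos: "\<kappa> > 0"
begin

abbreviation X :: "real^'n \<Rightarrow> real^'n" where "X w \<equiv> (\<kappa> / \<gamma> w) *\<^sub>R axis j 1"

text \<open>The time the flow needs to move the \<open>j\<close>-th coordinate of \<open>w\<close> to \<open>s\<close>. Parametrising
  the segment over \<open>{0..1}\<close> makes joint measurability in \<open>(w, s)\<close> immediate.\<close>

definition tau :: "real^'n \<Rightarrow> real \<Rightarrow> real" where
  "tau w s = (s - w $ j) / \<kappa> * (\<integral>q. indicator {0..1} q * (indicator (obox R) (upd j w (w $ j + q * (s - w $ j))) *
     \<gamma> (upd j w (w $ j + q * (s - w $ j)))) \<partial>lborel)"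

lemma tau_measurable [measurable (raw)]:
  assumes [measurable]: "f \<in> borel_measurable M" "g \<in> borel_measurable M"
  shows "(\<lambda>x. tau (f x) (g x)) \<in> borel_measurable M"
proof -
  have [measurable]: "(\<lambda>w. indicator (obox R) w * \<gamma> w) \<in> borel_measurable borel"
    using borel_measurable_continuous_on_indicator[OF obox_borel cont] by (simp add: mult.commute)
  have "(\<lambda>p. tau (fst p) (snd p)) \<in> borel_measurable (borel \<Otimes>\<^sub>M borel)"
    unfolding tau_def
    by measurable
  then have "(\<lambda>x. tau (fst (f x, g x)) (snd (f x, g x))) \<in> borel_measurable M"
    by (rule measurable_compose[rotated]) measurable
  then show ?thesis by simp
qed

text \<open>The speed of the flow is \<kappa> / \<gamma>, so the travel time must have the
  reciprocal derivative. The fundamental theorem along the segment from \<open>w $ j\<close> to s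
  turns the integral over {0..1} into a difference of values of an antiderivative.\<close>

lemma has_derivative_tau:
  assumes w: "w \<in> obox R" and s: "\<bar>s\<bar> < R j"
  shows "(tau w has_real_derivative \<gamma> (upd j w s) / \<kappa>) (at s)"
proof -
  let ?f = "\<lambda>s. \<gamma> (upd j w s) / \<kappa>"
  have isC: "isCont ?f s" if "\<bar>s\<bar> < R j" for s
  proof -
    have "continuous_on {- R j<..<R j} ?f"
      using kpos w
      by (intro continuous_intros continuous_on_compose2[OF cont])
         (auto simp: upd_in_obox)
    then show ?thesis using that by (simp add: continuous_on_eq_continuous_at abs_less_iff)
  qed
  have wj: "\<bar>w $ j\<bar> < R j" using w by (auto simp: obox_def)
  have "\<exists>F. \<forall>x. ereal (- R j) < ereal x \<longrightarrow> ereal x < ereal (R j) \<longrightarrow> (F has_vector_derivative ?f x) (at x)"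
    using isC wj by (intro einterval_antiderivative) (auto simp: abs_less_iff)
  then obtain F where F': "\<forall>x. ereal (- R j) < ereal x \<longrightarrow> ereal x < ereal (R j) \<longrightarrow> (F has_vector_derivative ?f x) (at x)"
    by blast
  have F: "(F has_vector_derivative ?f x) (at x)" if "\<bar>x\<bar> < R j" for x
    using F' that by (simp add: abs_less_iff)
  have tau_eq: "tau w s = F s - F (w $ j)" if s: "\<bar>s\<bar> < R j" for s
  proof -
    let ?l = "\<lambda>q. w $ j + q * (s - w $ j)"
    have l: "\<bar>?l q\<bar> < R j" if "q \<in> {0..1}" for q
    proof -
      have "?l q = (1 - q) * w $ j + q * s" by (simp add: algebra_simps)
      then show ?thesis
        using that s wj convex_bound_lt[of "w $ j" "R j" s "1 - q" q] convex_bound_lt[of "- w $ j" "R j" "- s" "1 - q" q]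
        by (auto simp: abs_less_iff)
    qed
    have "(LBINT q. indicator {0..1} q *\<^sub>R ((s - w $ j) * ?f (?l q))) = F (?l 1) - F (?l 0)"
    proof (rule integral_FTC_atLeastAtMost)
      fix q :: real assume q: "0 \<le> q" "q \<le> 1"
      have "((F \<circ> ?l) has_vector_derivative (s - w $ j) *\<^sub>R ?f (?l q)) (at q within {0..1})"
        using F[OF l[of q]] q
        by (intro vector_diff_chain_within[OF _ has_vector_derivative_at_within])
           (auto intro!: derivative_eq_intros simp: has_real_derivative_iff_has_vector_derivative[symmetric])
      then show "((\<lambda>q. F (?l q)) has_vector_derivative (s - w $ j) * ?f (?l q)) (at q within {0..1})"
        by (simp add: o_def)
    next
      have "continuous_on {- R j<..<R j} ?f" using isC
        by (intro continuous_at_imp_continuous_on) (auto simp: abs_less_iff)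
      moreover have "continuous_on {0..1} ?l" by (intro continuous_intros)
      moreover have "?l ` {0..1} \<subseteq> {- R j<..<R j}" using l by (force simp: abs_less_iff)
      ultimately have "continuous_on {0..1} (\<lambda>q. ?f (?l q))"
        by (rule continuous_on_compose2)
      then show "continuous_on {0..1} (\<lambda>q. (s - w $ j) * ?f (?l q))"
        by (rule continuous_on_mult_left)
    qed simp
    also have "(\<lambda>q. indicator {0..1} q *\<^sub>R ((s - w $ j) * ?f (?l q))) =
       (\<lambda>q. (s - w $ j) / \<kappa> * (indicator {0..1} q * (indicator (obox R) (upd j w (?l q)) * \<gamma> (upd j w (?l q)))))"
      using l upd_in_obox[OF w, of j] by (auto simp: fun_eq_iff indicator_def)
    finally show ?thesis unfolding tau_def by simp
  qed
  have "((\<lambda>s. F s - F (w $ j)) has_real_derivative ?f s) (at s)"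
    using F[OF s] by (auto intro!: derivative_eq_intros simp: has_real_derivative_iff_has_vector_derivative[symmetric])
  then show ?thesis
    by (rule has_field_derivative_transform_within_open[of _ _ _ "{- R j<..<R j}"])
      (use s tau_eq in \<open>auto simp: abs_less_iff\<close>)
qed

lemma tau_self [simp]: "tau w (w $ j) = 0"
  by (simp add: tau_def)

lemma tau_strict_mono:
  assumes "w \<in> obox R" "\<bar>s\<bar> < R j" "\<bar>s'\<bar> < R j" "s < s'"
  shows "tau w s < tau w s'"
proof (rule DERIV_pos_imp_increasing[OF assms(4)])
  fix x assume "s \<le> x" "x \<le> s'"
  then have "\<bar>x\<bar> < R j" using assms by auto
  then show "\<exists>y. (tau w has_real_derivative y) (at x) \<and> y > 0"
    using has_derivative_tau[OF assms(1)] pos[of "upd j w x"] kpos upd_in_obox[OF assms(1), of j]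
    by (metis divide_pos_pos)
qed

lemma tau_less_iff:
  assumes "w \<in> obox R" "\<bar>s\<bar> < R j" "\<bar>s'\<bar> < R j"
  shows "tau w s < tau w s' \<longleftrightarrow> s < s'"
  using tau_strict_mono[OF assms(1)] assms by (metis less_asym linorder_neqE)

lemma tau_inj:
  assumes "w \<in> obox R" "\<bar>s\<bar> < R j" "\<bar>s'\<bar> < R j" "tau w s = tau w s'"
  shows "s = s'"
  using tau_strict_mono[OF assms(1)] assms by (metis less_irrefl linorder_neqE)

lemma isCont_tau: "w \<in> obox R \<Longrightarrow> \<bar>s\<bar> < R j \<Longrightarrow> isCont (tau w) s"
  using has_derivative_tau DERIV_isCont by blast

lemma tau_bounds:
  assumes w: "w \<in> obox R" and s: "\<bar>s\<bar> < R j" "\<bar>s'\<bar> < R j" "s \<le> s'"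
    and b: "\<And>x. s \<le> x \<Longrightarrow> x \<le> s' \<Longrightarrow> m \<le> \<gamma> (upd j w x) \<and> \<gamma> (upd j w x) \<le> M"
  shows "m * (s' - s) / \<kappa> \<le> tau w s' - tau w s" "tau w s' - tau w s \<le> M * (s' - s) / \<kappa>"
proof -
  have "m * (s' - s) / \<kappa> \<le> tau w s' - tau w s \<and> tau w s' - tau w s \<le> M * (s' - s) / \<kappa>"
  proof (cases "s = s'")
    case False
    then have "s < s'" using s by simp
    moreover have "(tau w has_real_derivative \<gamma> (upd j w x) / \<kappa>) (at x)" if "s \<le> x" "x \<le> s'" for x
      using that s by (intro has_derivative_tau[OF w]) auto
    ultimately obtain z where z: "s < z" "z < s'" "tau w s' - tau w s = (s' - s) * (\<gamma> (upd j w z) / \<kappa>)"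
      using MVT2[of s s' "tau w" "\<lambda>x. \<gamma> (upd j w x) / \<kappa>"] by blast
    then have mM: "m \<le> \<gamma> (upd j w z)" "\<gamma> (upd j w z) \<le> M" using b by auto
    have "(s' - s) / \<kappa> * m \<le> (s' - s) / \<kappa> * \<gamma> (upd j w z)" "(s' - s) / \<kappa> * \<gamma> (upd j w z) \<le> (s' - s) / \<kappa> * M"
      using mM s kpos by (intro mult_left_mono; simp)+
    then show ?thesis using z(3) by (simp add: mult.commute)
  qed simp
  then show "m * (s' - s) / \<kappa> \<le> tau w s' - tau w s" "tau w s' - tau w s \<le> M * (s' - s) / \<kappa>" by auto
qed

text \<open>Along a solution the other coordinates are constant, and \<open>tau w\<close> of the
  j-th coordinate minus the time has derivative zero, which determines the endpoint. Conversely the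
  inverse function of \<open>tau w\<close> moves the j-th coordinate at the right speed.\<close>

lemma flow_to_iff:
  assumes w: "w \<in> obox R"
  shows "flow_to (obox R) X t w z \<longleftrightarrow> (\<exists>s. \<bar>s\<bar> < R j \<and> z = upd j w s \<and> tau w s = t)"
proof
  assume "flow_to (obox R) X t w z"
  then obtain u where u: "u 0 = w" "u t = z" and uO: "\<And>s. s \<in> closed_segment 0 t \<Longrightarrow> u s \<in> obox R"
    and ud: "\<And>s. s \<in> closed_segment 0 t \<Longrightarrow> (u has_vector_derivative X (u s)) (at s within closed_segment 0 t)"
    unfolding flow_to_def by blast
  have comp: "((\<lambda>s. u s $ i) has_vector_derivative X (u s) $ i) (at s within closed_segment 0 t)"
    if "s \<in> closed_segment 0 t" for s i
    using bounded_linear.has_vector_derivative[OF bounded_linear_vec_nth ud[OF that]] .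
  have const: "u s $ i = w $ i" if "i \<noteq> j" "s \<in> closed_segment 0 t" for i s
  proof -
    have "((\<lambda>s. u s $ i) has_vector_derivative 0) (at s within closed_segment 0 t)"
      if "s \<in> closed_segment 0 t" for s
      using comp[OF that, of i] \<open>i \<noteq> j\<close> by (simp add: axis_def)
    then obtain c where c: "\<And>s. s \<in> closed_segment 0 t \<Longrightarrow> u s $ i = c"
      using has_vector_derivative_zero_constant[OF convex_closed_segment, of 0 t "\<lambda>s. u s $ i"] by blast
    show ?thesis using c[of s] c[of 0] that u(1) by simp
  qed
  have us: "u s = upd j w (u s $ j)" if "s \<in> closed_segment 0 t" for s
    using const that by (intro upd_eqI) auto
  have uj: "\<bar>u s $ j\<bar> < R j" if "s \<in> closed_segment 0 t" for s
    using uO[OF that] by (auto simp: obox_def)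
  have "((\<lambda>s. tau w (u s $ j) - s) has_vector_derivative 0) (at s within closed_segment 0 t)"
    if s: "s \<in> closed_segment 0 t" for s
  proof -
    have "((\<lambda>s. u s $ j) has_real_derivative \<kappa> / \<gamma> (u s)) (at s within closed_segment 0 t)"
      using comp[OF s, of j] by (simp add: has_real_derivative_iff_has_vector_derivative)
    moreover have "(tau w has_real_derivative \<gamma> (u s) / \<kappa>) (at (u s $ j))"
      using has_derivative_tau[OF w uj[OF s]] us[OF s] by simp
    ultimately have "((\<lambda>s. tau w (u s $ j)) has_real_derivative \<gamma> (u s) / \<kappa> * (\<kappa> / \<gamma> (u s))) (at s within closed_segment 0 t)"
      by (rule DERIV_chain2[rotated])
    moreover have "\<gamma> (u s) / \<kappa> * (\<kappa> / \<gamma> (u s)) = 1"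
      using pos[OF uO[OF s]] kpos by simp
    ultimately show ?thesis
      by (auto intro!: derivative_eq_intros simp: has_real_derivative_iff_has_vector_derivative[symmetric])
  qed
  then obtain c where "\<And>s. s \<in> closed_segment 0 t \<Longrightarrow> tau w (u s $ j) - s = c"
    using has_vector_derivative_zero_constant[OF convex_closed_segment, of 0 t "\<lambda>s. tau w (u s $ j) - s"] by blast
  from this[of 0] this[of t] u have "tau w (z $ j) = t" by simp
  then show "\<exists>s. \<bar>s\<bar> < R j \<and> z = upd j w s \<and> tau w s = t"
    using us[of t] uj[of t] u by (intro exI[of _ "z $ j"]) auto
next
  assume "\<exists>s. \<bar>s\<bar> < R j \<and> z = upd j w s \<and> tau w s = t"
  then obtain s1 where s1: "\<bar>s1\<bar> < R j" "z = upd j w s1" "tau w s1 = t" by blast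
  let ?I = "{- R j<..<R j}"
  define \<sigma> where "\<sigma> = inv_into ?I (tau w)"
  have inj: "inj_on (tau w) ?I"
    using tau_inj[OF w] by (auto intro!: inj_onI simp: abs_less_iff)
  have \<sigma>: "\<sigma> (tau w s) = s" if "\<bar>s\<bar> < R j" for s
    using that inv_into_f_f[OF inj] by (auto simp: \<sigma>_def abs_less_iff)
  have wj: "\<bar>w $ j\<bar> < R j" using w by (auto simp: obox_def)
  have ct: "continuous_on ?I (tau w)"
    using isCont_tau[OF w] by (auto intro!: continuous_at_imp_continuous_on simp: abs_less_iff)
  \<comment> \<open>The segment from \<open>w $ j\<close> to s1 is connected and its image under
    \<open>tau w\<close> contains 0 and t, so every intermediate time is attained inside the
    box.\<close>
  have hit: "\<exists>s. \<bar>s\<bar> < R j \<and> tau w s = q" if q: "q \<in> closed_segment 0 t" for q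
  proof -
    have "closed_segment (w $ j) s1 \<subseteq> ?I"
      using wj s1 by (auto simp: closed_segment_eq_real_ivl abs_less_iff split: if_splits)
    then have "connected (tau w ` closed_segment (w $ j) s1)"
      using ct by (intro connected_continuous_image) (auto intro: continuous_on_subset)
    moreover have "0 \<in> tau w ` closed_segment (w $ j) s1" "t \<in> tau w ` closed_segment (w $ j) s1"
      using s1 by (force intro: image_eqI[of _ _ "w $ j"], force)
    ultimately have "q \<in> tau w ` closed_segment (w $ j) s1"
      using q closed_segment_subset[of 0 "tau w ` closed_segment (w $ j) s1" t]
      by (metis is_interval_convex_1 is_interval_connected_1 subsetD)
    then obtain x where "x \<in> closed_segment (w $ j) s1" "q = tau w x" by blast
    moreover from this have "x \<in> ?I" using \<open>closed_segment (w $ j) s1 \<subseteq> ?I\<close> by blast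
    ultimately show ?thesis by (intro exI[of _ x]) (auto simp: abs_less_iff)
  qed
  show "flow_to (obox R) X t w z"
    unfolding flow_to_def
  proof (intro exI[of _ "\<lambda>q. upd j w (\<sigma> q)"] conjI ballI)
    show "upd j w (\<sigma> 0) = w" using \<sigma>[OF wj] by simp
    show "upd j w (\<sigma> t) = z" using \<sigma>[OF s1(1)] s1 by simp
    fix q assume "q \<in> closed_segment 0 t"
    then obtain s where s: "\<bar>s\<bar> < R j" "tau w s = q" using hit by blast
    show "upd j w (\<sigma> q) \<in> obox R" using s \<sigma>[OF s(1)] upd_in_obox[OF w] by auto
    have g: "\<gamma> (upd j w s) > 0" using s upd_in_obox[OF w, of j] pos by blast
    \<comment> \<open>By the inverse function rule \<sigma> has the derivative \<kappa> / \<gamma>,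
      which is the speed of the field.\<close>
    have "(\<sigma> has_derivative (*) (\<kappa> / \<gamma> (upd j w s))) (at (tau w s))"
    proof (rule has_derivative_inverse_strong[of ?I s "tau w" \<sigma>])
      show "open ?I" "s \<in> ?I" "continuous_on ?I (tau w)" using s ct by (auto simp: abs_less_iff)
      show "\<sigma> (tau w z) = z" if "z \<in> ?I" for z using that \<sigma> by (auto simp: abs_less_iff)
      show "(tau w has_derivative (*) (\<gamma> (upd j w s) / \<kappa>)) (at s)"
        using has_derivative_tau[OF w s(1)] by (simp add: has_field_derivative_def)
    qed (use g kpos in \<open>auto simp: fun_eq_iff\<close>)
    then have "(\<sigma> has_real_derivative \<kappa> / \<gamma> (upd j w s)) (at (tau w s))"
      by (simp add: has_field_derivative_def)
    then have "(\<sigma> has_vector_derivative \<kappa> / \<gamma> (upd j w (\<sigma> q))) (at q)"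
      using s \<sigma>[OF s(1)] by (simp add: has_real_derivative_iff_has_vector_derivative)
    then show "((\<lambda>q. upd j w (\<sigma> q)) has_vector_derivative X (upd j w (\<sigma> q))) (at q within closed_segment 0 t)"
      by (rule has_vector_derivative_at_within[OF upd_has_vector_derivative])
  qed
qed

text \<open>Injectivity of \<open>tau w\<close> gives the uniqueness on which the definite
  description in \<open>flow\<close> rests.\<close>

lemma flow_eq:
  assumes "w \<in> obox R" "\<bar>s\<bar> < R j"
  shows "flow (obox R) X (tau w s) w = upd j w s"
  unfolding flow_def flow_to_iff[OF assms(1)]
proof (rule the_equality)
  show "\<exists>s'. \<bar>s'\<bar> < R j \<and> upd j w s = upd j w s' \<and> tau w s' = tau w s"
    using assms(2) by blast
  fix z assume "\<exists>s'. \<bar>s'\<bar> < R j \<and> z = upd j w s' \<and> tau w s' = tau w s"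
  then show "z = upd j w s" using tau_inj[OF assms(1) _ assms(2)] by blast
qed

text \<open>The substitution t = \<open>tau w s\<close> has Jacobian \<gamma> / \<kappa>, at least m
  / \<kappa> on the window, and the condition on h places the image of the window inside {-h<..<h}.
  This is how a uniform time becomes a position whose density is bounded below.\<close>

lemma substitution_lower:
  fixes F :: "real \<Rightarrow> ennreal"
  assumes w: "w \<in> obox R" and r: "0 < r" "\<bar>w $ j\<bar> + r < R j" and m: "0 \<le> m" and h: "M * r / \<kappa> < h"
    and b: "\<And>s. \<bar>s - w $ j\<bar> \<le> r \<Longrightarrow> m \<le> \<gamma> (upd j w s) \<and> \<gamma> (upd j w s) \<le> M"
    and F [measurable]: "F \<in> borel_measurable borel"
  shows "ennreal (m / \<kappa>) * (\<integral>\<^sup>+s. indicator {s. \<bar>s - w $ j\<bar> < r} s * F (tau w s) \<partial>lborel)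
    \<le> (\<integral>\<^sup>+t. indicator {-h<..<h} t * F t \<partial>lborel)"
proof -
  let ?a = "w $ j - r" and ?b = "w $ j + r"
  have in_R: "\<bar>s\<bar> < R j" if "?a \<le> s" "s \<le> ?b" for s using that r by auto
  have tb: "tau w ?b \<le> M * r / \<kappa>"
    using tau_bounds(2)[OF w in_R[of "w $ j"] in_R[of ?b], of m M] b r by (auto simp: abs_le_iff)
  have ta: "- (M * r / \<kappa>) \<le> tau w ?a"
    using tau_bounds(2)[OF w in_R[of ?a] in_R[of "w $ j"], of m M] b r by (auto simp: abs_le_iff)
  have [measurable]: "(\<lambda>s. tau w s) \<in> borel_measurable borel" by measurable
  have "ennreal (m / \<kappa>) * (\<integral>\<^sup>+s. indicator {s. \<bar>s - w $ j\<bar> < r} s * F (tau w s) \<partial>lborel)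
    = (\<integral>\<^sup>+s. ennreal (m / \<kappa>) * (indicator {s. \<bar>s - w $ j\<bar> < r} s * F (tau w s)) \<partial>lborel)"
    by (subst nn_integral_cmult) auto
  also have "\<dots> \<le> (\<integral>\<^sup>+s. F (tau w s) * ennreal (\<gamma> (upd j w s) / \<kappa>) * indicator {?a..?b} s \<partial>lborel)"
  proof (rule nn_integral_mono)
    fix s
    show "ennreal (m / \<kappa>) * (indicator {s. \<bar>s - w $ j\<bar> < r} s * F (tau w s))
      \<le> F (tau w s) * ennreal (\<gamma> (upd j w s) / \<kappa>) * indicator {?a..?b} s"
    proof (cases "\<bar>s - w $ j\<bar> < r")
      case True
      then have "m / \<kappa> \<le> \<gamma> (upd j w s) / \<kappa>" using b[of s] kpos by (simp add: divide_right_mono)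
      then have "ennreal (m / \<kappa>) * F (tau w s) \<le> ennreal (\<gamma> (upd j w s) / \<kappa>) * F (tau w s)"
        by (intro mult_right_mono ennreal_leI) auto
      moreover have "s \<in> {?a..?b}" using True by (auto simp: abs_less_iff)
      ultimately show ?thesis using True by (simp add: mult.commute)
    qed simp
  qed
  also have "\<dots> = (\<integral>\<^sup>+t. F t * indicator {tau w ?a..tau w ?b} t \<partial>lborel)"
  proof (rule nn_integral_substitution_aux[symmetric])
    fix s assume s: "s \<in> {?a..?b}"
    show "(tau w has_real_derivative \<gamma> (upd j w s) / \<kappa>) (at s)"
      using s by (intro has_derivative_tau w in_R) auto
    show "0 \<le> \<gamma> (upd j w s) / \<kappa>"
      using s b[of s] m kpos by (auto simp: abs_le_iff)
  next
    show "continuous_on {?a..?b} (\<lambda>s. \<gamma> (upd j w s) / \<kappa>)"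
      using kpos upd_in_obox[OF w, of j] in_R
      by (intro continuous_intros continuous_on_compose2[OF cont]) auto
  qed (use r in auto)
  also have "\<dots> \<le> (\<integral>\<^sup>+t. indicator {-h<..<h} t * F t \<partial>lborel)"
    using ta tb h by (intro nn_integral_mono) (auto simp: indicator_def)
  finally show ?thesis .
qed

text \<open>From a coordinate of modulus at most R1, reaching R2 or - R2 takes time at least m * (R2
  - R1) / \<kappa>; the intermediate value theorem for \<open>tau w\<close> supplies all shorter
  times.\<close>

lemma tau_surj:
  assumes w: "w \<in> obox R" and s: "\<bar>w $ j\<bar> \<le> R1" "R1 < R2" "R2 < R j"
    and b: "\<And>s. \<bar>s\<bar> \<le> R2 \<Longrightarrow> m \<le> \<gamma> (upd j w s)" and m: "0 < m"
    and t: "\<bar>t\<bar> < m * (R2 - R1) / \<kappa>"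
  shows "\<exists>s. \<bar>s\<bar> < R2 \<and> tau w s = t"
proof -
  have cp: "compact ((\<lambda>s. \<gamma> (upd j w s)) ` {- R2..R2})"
  proof (intro compact_continuous_image continuous_on_compose2[OF cont])
    show "continuous_on {- R2..R2} (\<lambda>s. upd j w s)" by (intro continuous_intros)
    have "\<bar>q\<bar> < R j" if "q \<in> {- R2..R2}" for q using that s(3) by (simp add: abs_less_iff)
    then show "(\<lambda>s. upd j w s) ` {- R2..R2} \<subseteq> obox R" by (simp add: image_subset_iff upd_in_obox[OF w])
  qed simp
  obtain M where M': "\<forall>y\<in>(\<lambda>s. \<gamma> (upd j w s)) ` {- R2..R2}. norm y \<le> M"
    using compact_imp_bounded[OF cp] unfolding bounded_iff by blast
  have M: "\<gamma> (upd j w s) \<le> M" if "\<bar>s\<bar> \<le> R2" for s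
  proof -
    have "s \<in> {- R2..R2}" using that by auto
    then have "norm (\<gamma> (upd j w s)) \<le> M" using M' by blast
    then show ?thesis by simp
  qed
  have d: "m * (R2 - R1) / \<kappa> \<le> m * (R2 - w $ j) / \<kappa>" "m * (R2 - R1) / \<kappa> \<le> m * (w $ j + R2) / \<kappa>"
    using s m kpos by (auto intro!: divide_right_mono mult_left_mono)
  have u: "m * (R2 - w $ j) / \<kappa> \<le> tau w R2"
    using tau_bounds(1)[OF w, of "w $ j" R2 m M] b M s by auto
  have l: "m * (w $ j + R2) / \<kappa> \<le> - tau w (- R2)"
    using tau_bounds(1)[OF w, of "- R2" "w $ j" m M] b M s by auto
  have tt: "tau w (- R2) < t" "t < tau w R2" using u l d t by auto
  have "isCont (tau w) x" if "- R2 \<le> x \<and> x \<le> R2" for x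
    using that s(3) by (intro isCont_tau[OF w]) (simp add: abs_less_iff)
  moreover have "- R2 \<le> R2" using s by simp
  ultimately obtain x where x: "- R2 \<le> x" "x \<le> R2" "tau w x = t"
    using IVT[of "tau w" "- R2" t R2] tt by (metis less_imp_le)
  moreover have "x \<noteq> R2" "x \<noteq> - R2" using tt x by auto
  ultimately show ?thesis by (intro exI[of _ x]) auto
qed

text \<open>The inverse of \<open>tau w\<close>, that is, the j-th coordinate at time t of the flow
  started at w; an arbitrary value where the time t is not attained.\<close>

definition sig :: "real \<Rightarrow> real^'n \<Rightarrow> real" where
  "sig t w = (SOME s. \<bar>s\<bar> < R j \<and> tau w s = t)"

lemma sig_tau: "w \<in> obox R \<Longrightarrow> \<bar>s\<bar> < R j \<Longrightarrow> sig (tau w s) w = s"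
  unfolding sig_def by (rule some_equality) (use tau_inj[of w _ s] in blast)+

text \<open>Since \<open>tau w\<close> increases, \<open>sig t w < y\<close> is the same as
  \<open>t < tau w y\<close>, and \<open>tau\<close> is jointly measurable. Thresholds y of modulus
  at least R2 are decided by the bound for \<open>sig\<close>, and R2 < R j keeps the other ones
  where \<open>tau w\<close> is monotone.\<close>

lemma sig_measurable:
  assumes A [measurable]: "A \<in> sets (borel \<Otimes>\<^sub>M borel)" and R2: "R2 < R j"
    and A': "\<And>t w. (t, w) \<in> A \<Longrightarrow> w \<in> obox R \<and> (\<exists>s. \<bar>s\<bar> < R2 \<and> tau w s = t)"
  shows "(\<lambda>(t, w). if (t, w) \<in> A then sig t w else 0) \<in> borel_measurable (borel \<Otimes>\<^sub>M borel)"
proof (rule borel_measurableI_less)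
  fix y :: real
  let ?f = "\<lambda>(t, w). if (t, w) \<in> A then sig t w else 0"
  have eq: "{p \<in> space (borel \<Otimes>\<^sub>M borel). ?f p < y} =
    (if 0 < y then UNIV - A else {}) \<union>
    (if y \<le> - R2 then {} else if R2 \<le> y then A else A \<inter> {p \<in> space (borel \<Otimes>\<^sub>M borel). fst p < tau (snd p) y})"
  proof (rule set_eqI)
    fix p :: "real \<times> (real^'n)"
    obtain t w where p: "p = (t, w)" by fastforce
    show "p \<in> {p \<in> space (borel \<Otimes>\<^sub>M borel). ?f p < y} \<longleftrightarrow> p \<in> (if 0 < y then UNIV - A else {}) \<union>
      (if y \<le> - R2 then {} else if R2 \<le> y then A else A \<inter> {p \<in> space (borel \<Otimes>\<^sub>M borel). fst p < tau (snd p) y})"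
    proof (cases "p \<in> A")
      case True
      then obtain s where w: "w \<in> obox R" and s: "\<bar>s\<bar> < R2" "tau w s = t" using A' p by blast
      have "sig t w = s" using sig_tau[OF w, of s] s R2 by auto
      moreover have "t < tau w y \<longleftrightarrow> s < y" if "\<not> y \<le> - R2" "\<not> R2 \<le> y"
        using tau_less_iff[OF w, of s y] s R2 that by auto
      ultimately show ?thesis using True p s by (auto simp: space_pair_measure)
    qed (auto simp: p space_pair_measure)
  qed
  have "{p \<in> space (borel \<Otimes>\<^sub>M borel). fst p < tau (snd p) y} \<in> sets (borel \<Otimes>\<^sub>M borel)"
    by measurable
  moreover have "UNIV \<in> sets (borel \<Otimes>\<^sub>M borel)"
    by (metis sets.top space_borel space_pair_measure UNIV_Times_UNIV)
  moreover have "UNIV - A \<in> sets (borel \<Otimes>\<^sub>M borel)"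
    using sets.compl_sets[OF A] by (simp add: space_pair_measure)
  ultimately show "{p \<in> space (borel \<Otimes>\<^sub>M borel). ?f p < y} \<in> sets (borel \<Otimes>\<^sub>M borel)"
    unfolding eq using A by auto
qed

end

section \<open>Iterated Markov kernels\<close>

text \<open>Bounded Borel functions are exactly the tests in \<open>markov_kernel\<close>;
  measurability into \<open>prob_algebra\<close> is what composing kernels by \<open>bind\<close>
  calls for.\<close>

definition rep_kernel :: "(('m::topological_space \<Rightarrow> real) \<Rightarrow> 'm \<Rightarrow> real) \<Rightarrow> ('m \<Rightarrow> 'm measure) \<Rightarrow> bool" where
  "rep_kernel T K \<longleftrightarrow> K \<in> borel \<rightarrow>\<^sub>M prob_algebra borel \<and>
     (\<forall>f\<in>borel_measurable borel. bounded (range f) \<longrightarrow> (\<forall>x. T f x = (\<integral>y. f y \<partial>K x)))"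

text \<open>The step K comes first and the remaining ones start from the new point. This order
  matches both \<open>T ^^ Suc k\<close> and the peeling off of one coordinate per step in the
  minorization.\<close>

primrec kernel_pow :: "('m::topological_space \<Rightarrow> 'm measure) \<Rightarrow> nat \<Rightarrow> 'm \<Rightarrow> 'm measure" where
  "kernel_pow K 0 x = return borel x"
| "kernel_pow K (Suc k) x = bind (K x) (kernel_pow K k)"

lemma kernel_pow_measurable:
  assumes "K \<in> borel \<rightarrow>\<^sub>M prob_algebra borel"
  shows "kernel_pow K k \<in> borel \<rightarrow>\<^sub>M prob_algebra borel"
proof (induction k)
  case 0
  have "kernel_pow K 0 = return borel" by (simp add: fun_eq_iff)
  then show ?case by simp
next
  case (Suc k)
  have "kernel_pow K (Suc k) = (\<lambda>x. bind (K x) (kernel_pow K k))" by (simp add: fun_eq_iff)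
  then show ?case using measurable_bind_prob_space[OF assms Suc] by simp
qed

lemma prob_kernelD:
  fixes x :: "'m::topological_space"
  assumes "K \<in> borel \<rightarrow>\<^sub>M prob_algebra borel"
  shows "prob_space (K x)" "sets (K x) = sets borel" "space (K x) = UNIV"
proof -
  have "K x \<in> space (prob_algebra borel)" using measurable_space[OF assms, of x] by simp
  then show "prob_space (K x)" and s: "sets (K x) = sets borel" by (auto simp: space_prob_algebra)
  then show "space (K x) = UNIV" using sets_eq_imp_space_eq[OF s] by simp
qed

lemma integral_bind_prob:
  fixes f :: "'b \<Rightarrow> real"
  assumes f: "f \<in> borel_measurable L" "bounded (range f)"
    and M: "prob_space M" and N: "N \<in> M \<rightarrow>\<^sub>M prob_algebra L"
  shows "(\<integral>y. f y \<partial>bind M N) = (\<integral>x. (\<integral>y. f y \<partial>N x) \<partial>M)"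
proof -
  obtain B where B: "\<And>x. \<bar>f x\<bar> \<le> B" using f(2) unfolding bounded_iff by auto
  have "emeasure (N x) (space (N x)) \<le> ennreal 1" if "x \<in> space M" for x
    using measurable_space[OF N that] by (auto simp: space_prob_algebra prob_space.emeasure_space_1)
  then show ?thesis
    using M by (intro integral_bind[OF f(1) B measurable_prob_algebraD[OF N], where B'=1])
      (auto simp: prob_space.finite_measure)
qed

lemma kernel_integral_bounded:
  fixes f :: "'m::topological_space \<Rightarrow> real"
  assumes K: "K \<in> borel \<rightarrow>\<^sub>M prob_algebra borel" and f: "f \<in> borel_measurable borel" "bounded (range f)"
  shows "(\<lambda>x. \<integral>y. f y \<partial>K x) \<in> borel_measurable borel" "bounded (range (\<lambda>x. \<integral>y. f y \<partial>K x))"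
proof -
  show "(\<lambda>x. \<integral>y. f y \<partial>K x) \<in> borel_measurable borel"
    using measurable_compose[OF measurable_prob_algebraD[OF K] integral_measurable_subprob_algebra[OF f(1)]] .
  obtain B where B: "\<And>x. \<bar>f x\<bar> \<le> B" using f(2) unfolding bounded_iff by auto
  have "\<bar>\<integral>y. f y \<partial>K x\<bar> \<le> B" for x
  proof -
    interpret prob_space "K x" by (rule prob_kernelD(1)[OF K])
    have m: "f \<in> borel_measurable (K x)"
      using f(1) measurable_cong_sets[OF prob_kernelD(2)[OF K] refl] by blast
    have i: "integrable (K x) f" using B m by (intro integrable_const_bound[where B=B]) auto
    have "\<bar>\<integral>y. f y \<partial>K x\<bar> \<le> (\<integral>y. \<bar>f y\<bar> \<partial>K x)" by (rule integral_abs_bound)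
    also have "\<dots> \<le> (\<integral>y. B \<partial>K x)" using i B by (intro integral_mono) auto
    finally show ?thesis using prob_space by simp
  qed
  then show "bounded (range (\<lambda>x. \<integral>y. f y \<partial>K x))" unfolding bounded_iff by auto
qed

text \<open>Induction through the iterated integral for \<open>bind\<close>; the integrand of the
  outer step is again bounded and Borel, so the representation of T applies to it.\<close>

lemma rep_kernel_pow:
  assumes "rep_kernel T K"
  shows "rep_kernel (T ^^ k) (kernel_pow K k)"
  unfolding rep_kernel_def
proof (intro conjI ballI impI allI)
  have K: "K \<in> borel \<rightarrow>\<^sub>M prob_algebra borel"
    and T: "\<And>f x. f \<in> borel_measurable borel \<Longrightarrow> bounded (range f) \<Longrightarrow> T f x = (\<integral>y. f y \<partial>K x)"
    using assms by (auto simp: rep_kernel_def)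
  show "kernel_pow K k \<in> borel \<rightarrow>\<^sub>M prob_algebra borel" by (rule kernel_pow_measurable[OF K])
  fix f :: "'a \<Rightarrow> real" and x assume f: "f \<in> borel_measurable borel" "bounded (range f)"
  show "(T ^^ k) f x = (\<integral>y. f y \<partial>kernel_pow K k x)"
  proof (induction k arbitrary: x)
    case 0
    then show ?case using f by (simp add: integral_return)
  next
    case (Suc k)
    have eq: "(T ^^ k) f = (\<lambda>x. \<integral>y. f y \<partial>kernel_pow K k x)" using Suc by blast
    have "(T ^^ Suc k) f x = (\<integral>z. (\<integral>y. f y \<partial>kernel_pow K k z) \<partial>K x)"
      using T kernel_integral_bounded[OF kernel_pow_measurable[OF K] f] by (simp add: eq)
    also have "\<dots> = (\<integral>y. f y \<partial>bind (K x) (kernel_pow K k))"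
      using integral_bind_prob[OF f prob_kernelD(1)[OF K]] kernel_pow_measurable[OF K, of k]
        measurable_cong_sets[OF prob_kernelD(2)[OF K] refl] by metis
    finally show ?case by simp
  qed
qed

text \<open>Existence is \<open>rep_kernel_pow\<close>; uniqueness follows by testing with
  indicators of Borel sets.\<close>

lemma markov_kernel_eq:
  assumes "rep_kernel T K"
  shows "markov_kernel T k x = kernel_pow K k x"
  unfolding markov_kernel_def
proof (rule the_equality)
  have R: "kernel_pow K k \<in> borel \<rightarrow>\<^sub>M prob_algebra borel"
    "\<And>f x. f \<in> borel_measurable borel \<Longrightarrow> bounded (range f) \<Longrightarrow> (T ^^ k) f x = (\<integral>y. f y \<partial>kernel_pow K k x)"
    using rep_kernel_pow[OF assms, of k] by (auto simp: rep_kernel_def)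
  show "sets (kernel_pow K k x) = sets borel \<and>
    (\<forall>f. f \<in> borel_measurable borel \<and> bounded (range f) \<longrightarrow> (T ^^ k) f x = (\<integral>y. f y \<partial>kernel_pow K k x))"
    using R prob_kernelD(2)[OF R(1)] by auto
  interpret P: prob_space "kernel_pow K k x" by (rule prob_kernelD(1)[OF R(1)])
  fix \<nu> assume \<nu>: "sets \<nu> = sets borel \<and>
    (\<forall>f. f \<in> borel_measurable borel \<and> bounded (range f) \<longrightarrow> (T ^^ k) f x = (\<integral>y. f y \<partial>\<nu>))"
  have "sets \<nu> = sets borel" using \<nu> by blast
  then have sp: "space \<nu> = UNIV" by (metis sets_eq_imp_space_eq space_borel)
  have m: "measure \<nu> B = measure (kernel_pow K k x) B" if "B \<in> sets borel" for B
  proof -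
    have b: "bounded (range (indicator B :: 'a \<Rightarrow> real))"
      by (intro boundedI[of _ 1]) (auto simp: indicator_def)
    have i: "(indicator B :: 'a \<Rightarrow> real) \<in> borel_measurable borel" using that by simp
    have "(T ^^ k) (indicator B) x = (\<integral>y. indicator B y \<partial>\<nu>)" using \<nu> i b by blast
    then have "(\<integral>y. (indicator B y :: real) \<partial>\<nu>) = (\<integral>y. indicator B y \<partial>kernel_pow K k x)"
      using R(2)[OF i b, of x] by (rule trans[OF sym])
    then show ?thesis by (simp add: sp prob_kernelD(3)[OF R(1)])
  qed
  \<comment> \<open>A competitor is not known to be finite. As \<open>measure\<close> is 0 on sets
    of infinite measure, the value 1 excludes infinite mass, and then \<open>measure\<close>
    determines \<open>emeasure\<close>.\<close>
  have one: "measure \<nu> UNIV = 1"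
    using m[of UNIV] P.prob_space by (simp add: prob_kernelD(3)[OF R(1)])
  then have "emeasure \<nu> (space \<nu>) \<noteq> \<infinity>" unfolding sp by (auto simp: measure_def)
  then interpret N: finite_measure \<nu> by (rule finite_measureI)
  show "\<nu> = kernel_pow K k x"
  proof (rule measure_eqI)
    show "sets \<nu> = sets (kernel_pow K k x)" using \<nu> prob_kernelD(2)[OF R(1)] by simp
    fix B assume "B \<in> sets \<nu>"
    then show "emeasure \<nu> B = emeasure (kernel_pow K k x) B"
      using m[of B] \<nu> by (simp add: N.emeasure_eq_measure P.emeasure_eq_measure)
  qed
qed

text \<open>An average is the kernel of a two-stage experiment: draw an index uniformly, then apply
  its kernel. Discarding all indices but one leaves a lower bound with the weight of that
  index.\<close>

lemma rep_kernel_average: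
  assumes I: "finite I" "I \<noteq> {}" and K: "\<And>i. i \<in> I \<Longrightarrow> rep_kernel (T i) (K i)"
    and S: "\<And>f x. S f x = (1 / real (card I)) * (\<Sum>i\<in>I. T i f x)"
  obtains L where "rep_kernel S L"
    "\<And>F x i. i \<in> I \<Longrightarrow> F \<in> borel_measurable borel \<Longrightarrow>
        ennreal (1 / real (card I)) * (\<integral>\<^sup>+y. F y \<partial>K i x) \<le> (\<integral>\<^sup>+y. F y \<partial>L x)"
proof
  let ?p = "pmf_of_set I"
  define L where "L x = bind (measure_pmf ?p) (\<lambda>i. if i \<in> I then K i x else return borel x)" for x
  let ?K = "\<lambda>i x. if i \<in> I then K i x else return borel x"
  have K': "?K i \<in> borel \<rightarrow>\<^sub>M prob_algebra borel" for i
    using K[of i] measurable_return_prob_space[of borel] by (cases "i \<in> I") (simp_all add: rep_kernel_def)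
  have Kx: "(\<lambda>i. ?K i x) \<in> measure_pmf ?p \<rightarrow>\<^sub>M prob_algebra borel" for x
    using measurable_space[OF K', of x] by simp
  have joint: "(\<lambda>(x, i). ?K i x) \<in> borel \<Otimes>\<^sub>M count_space UNIV \<rightarrow>\<^sub>M prob_algebra borel"
  proof -
    \<comment> \<open>All indices outside I carry the same Dirac kernel and are collapsed to one
      representative, so that the index ranges over a finite set and measurability in the pair
      follows from that in x for each index.\<close>
    have "(\<lambda>p. ?K (if snd p \<in> I then snd p else (SOME i. i \<notin> I)) (fst p)) \<in> borel \<Otimes>\<^sub>M count_space UNIV \<rightarrow>\<^sub>M prob_algebra borel"
    proof (rule measurable_compose_countable'[where f="\<lambda>i p. ?K i (fst p)" and I="insert (SOME i. i \<notin> I) I"])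
      show "(\<lambda>p. ?K i (fst p)) \<in> borel \<Otimes>\<^sub>M count_space UNIV \<rightarrow>\<^sub>M prob_algebra borel" for i
        by (rule measurable_compose[OF measurable_fst K'])
      show "(\<lambda>p. if snd p \<in> I then snd p else (SOME i. i \<notin> I)) \<in> borel \<Otimes>\<^sub>M count_space UNIV \<rightarrow>\<^sub>M count_space (insert (SOME i. i \<notin> I) I)"
        by (rule measurable_compose[OF measurable_snd]) auto
    qed (use I in \<open>simp add: countable_finite\<close>)
    moreover have "(\<lambda>p. ?K (if snd p \<in> I then snd p else (SOME i. i \<notin> I)) (fst p)) = (\<lambda>(x, i). ?K i x)"
      by (auto simp: fun_eq_iff some_in_eq dest: someI[of "\<lambda>i. i \<notin> I"])
    ultimately show ?thesis by simp
  qed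
  have L: "L \<in> borel \<rightarrow>\<^sub>M prob_algebra borel"
  proof -
    have "(\<lambda>x. measure_pmf ?p) \<in> borel \<rightarrow>\<^sub>M prob_algebra (count_space UNIV)"
      by (rule measurable_const) (simp add: space_prob_algebra prob_space_measure_pmf)
    then show ?thesis unfolding L_def[abs_def] using joint by (rule measurable_bind_prob_space2)
  qed
  show "rep_kernel S L"
    unfolding rep_kernel_def
  proof (intro conjI ballI impI allI L)
    fix f :: "'b \<Rightarrow> real" and x assume f: "f \<in> borel_measurable borel" "bounded (range f)"
    have "(\<integral>y. f y \<partial>L x) = (\<integral>i. (\<integral>y. f y \<partial>?K i x) \<partial>measure_pmf ?p)"
      unfolding L_def by (rule integral_bind_prob[OF f prob_space_measure_pmf Kx])
    also have "\<dots> = (\<Sum>i\<in>I. \<integral>y. f y \<partial>?K i x) / card I"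
      by (rule integral_pmf_of_set[OF I(2,1)])
    also have "\<dots> = S f x"
      using K f by (simp add: S rep_kernel_def)
    finally show "S f x = (\<integral>y. f y \<partial>L x)" ..
  qed
  fix F :: "'b \<Rightarrow> ennreal" and x i assume i: "i \<in> I" and F: "F \<in> borel_measurable borel"
  have "(\<integral>\<^sup>+y. F y \<partial>L x) = (\<integral>\<^sup>+i. (\<integral>\<^sup>+y. F y \<partial>?K i x) \<partial>measure_pmf ?p)"
    unfolding L_def by (rule nn_integral_bind[OF F measurable_prob_algebraD[OF Kx]])
  also have "\<dots> = (\<Sum>i\<in>I. \<integral>\<^sup>+y. F y \<partial>?K i x) / card I"
    by (rule nn_integral_pmf_of_set[OF I(2,1)])
  also have "\<dots> = ennreal (1 / real (card I)) * (\<Sum>i\<in>I. \<integral>\<^sup>+y. F y \<partial>?K i x)"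
  proof -
    have "card I > 0" using I by (simp add: card_gt_0_iff)
    then have "ennreal (1 / real (card I)) = 1 / ennreal (real (card I))"
      using divide_ennreal[of 1 "real (card I)"] by simp
    then show ?thesis
      by (simp add: ennreal_of_nat_eq_real_of_nat divide_ennreal_def mult.commute)
  qed
  finally have "(\<integral>\<^sup>+y. F y \<partial>L x) = ennreal (1 / real (card I)) * (\<Sum>i\<in>I. \<integral>\<^sup>+y. F y \<partial>?K i x)" .
  moreover have "(\<integral>\<^sup>+y. F y \<partial>?K i x) \<le> (\<Sum>i\<in>I. \<integral>\<^sup>+y. F y \<partial>?K i x)"
    using I i by (intro member_le_sum) auto
  ultimately show "ennreal (1 / real (card I)) * (\<integral>\<^sup>+y. F y \<partial>K i x) \<le> (\<integral>\<^sup>+y. F y \<partial>L x)"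
    using i by (simp add: mult_left_mono)
qed

section \<open>Lower bounds for iterates, one coordinate per step\<close>

lemma borel_measurable_PiM_sum:
  fixes w :: "'a::euclidean_space"
  assumes "J \<subseteq> Basis"
  shows "(\<lambda>v. \<Sum>b\<in>Basis. (if b \<in> J then v b else w \<bullet> b) *\<^sub>R b) \<in> borel_measurable (Pi\<^sub>M J (\<lambda>_. lborel :: real measure))"
proof (rule borel_measurable_sum)
  fix b :: 'a
  have "(\<lambda>v. v b) \<in> borel_measurable (Pi\<^sub>M J (\<lambda>_. lborel :: real measure))" if "b \<in> J"
    using measurable_component_singleton[OF that, of "\<lambda>_. lborel :: real measure"] by simp
  then show "(\<lambda>v. (if b \<in> J then v b else w \<bullet> b) *\<^sub>R b) \<in> borel_measurable (Pi\<^sub>M J (\<lambda>_. lborel :: real measure))"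
    by (cases "b \<in> J") auto
qed

lemma borel_measurable_PiM_prod_indicator:
  assumes "finite J" and S: "\<And>b. b \<in> J \<Longrightarrow> S b \<in> sets borel"
  shows "(\<lambda>v. \<Prod>b\<in>J. indicator (S b) (v b) :: ennreal) \<in> borel_measurable (Pi\<^sub>M J (\<lambda>_. lborel :: real measure))"
proof (rule borel_measurable_prod_ennreal)
  fix b assume b: "b \<in> J"
  have "(\<lambda>v. v b) \<in> Pi\<^sub>M J (\<lambda>_. lborel :: real measure) \<rightarrow>\<^sub>M lborel"
    using measurable_component_singleton[OF b, of "\<lambda>_. lborel :: real measure"] by simp
  moreover have "(indicator (S b) :: real \<Rightarrow> ennreal) \<in> borel_measurable lborel"
    using S[OF b] by simp
  ultimately show "(\<lambda>v. indicator (S b) (v b) :: ennreal) \<in> borel_measurable (Pi\<^sub>M J (\<lambda>_. lborel :: real measure))"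
    by (rule measurable_compose)
qed

text \<open>Induction on the set I of coordinates still to be moved. A step in direction b spreads
  this coordinate over a window about its starting value; the windows of the others are unchanged,
  so the windows multiply to a box. The margin r is asked only for coordinates in I: a coordinate
  already moved may have used up its margin but still lies inside the block, which suffices for the
  later steps.\<close>

lemma kernel_minorization:
  fixes P :: "'a::euclidean_space \<Rightarrow> 'm::topological_space"
  assumes K: "K \<in> borel \<rightarrow>\<^sub>M prob_algebra borel" and P: "P \<in> borel \<rightarrow>\<^sub>M borel" and r: "0 < r"
    and step: "\<And>w b F. (\<And>b. b \<in> Basis \<Longrightarrow> \<bar>w \<bullet> b\<bar> < R b) \<Longrightarrow> b \<in> Basis \<Longrightarrow> \<bar>w \<bullet> b\<bar> + r \<le> R b \<Longrightarrow> F \<in> borel_measurable borel \<Longrightarrow>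
      \<alpha> * (\<integral>\<^sup>+s. indicator {s. \<bar>s - w \<bullet> b\<bar> < r} s * F (P (w + (s - w \<bullet> b) *\<^sub>R b)) \<partial>lborel) \<le> (\<integral>\<^sup>+y. F y \<partial>K (P w))"
    and I: "I \<subseteq> Basis" and w: "\<And>b. b \<in> Basis \<Longrightarrow> \<bar>w \<bullet> b\<bar> < R b" "\<And>b. b \<in> I \<Longrightarrow> \<bar>w \<bullet> b\<bar> + r \<le> R b"
    and F: "F \<in> borel_measurable borel"
  shows "\<alpha> ^ card I * (\<integral>\<^sup>+v. (\<Prod>b\<in>I. indicator {s. \<bar>s - w \<bullet> b\<bar> < r} (v b)) *
      F (P (\<Sum>b\<in>Basis. (if b \<in> I then v b else w \<bullet> b) *\<^sub>R b)) \<partial>Pi\<^sub>M I (\<lambda>_. lborel))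
    \<le> (\<integral>\<^sup>+y. F y \<partial>kernel_pow K (card I) (P w))"
proof -
  interpret product_sigma_finite "\<lambda>_::'a. lborel :: real measure" ..
  have "finite I" using I finite_subset finite_Basis by blast
  then show ?thesis using I w
  proof (induction I arbitrary: w rule: finite_induct)
    case empty
    show ?case using F by (simp add: PiM_empty euclidean_representation nn_integral_return)
  next
    case (insert b I)
    let ?ind = "\<lambda>w b s. indicator {s. \<bar>s - w \<bullet> b\<bar> < r} (s::real) :: ennreal"
    let ?w = "\<lambda>s. w + (s - w \<bullet> b) *\<^sub>R b"
    \<comment> \<open>The test function of the first step is the integral against the remaining
      steps; this is why \<open>step\<close> is assumed for nonnegative Borel functions and not just
      for sets.\<close>
    define G where "G y = (\<integral>\<^sup>+z. F z \<partial>kernel_pow K (card I) y)" for y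
    have Kp: "kernel_pow K k \<in> borel \<rightarrow>\<^sub>M prob_algebra borel" for k by (rule kernel_pow_measurable[OF K])
    have G: "G \<in> borel_measurable borel"
      unfolding G_def
      using measurable_compose[OF measurable_prob_algebraD[OF Kp] nn_integral_measurable_subprob_algebra[OF F]] .
    have b: "b \<in> Basis" using insert by auto
    have wb: "?w s \<bullet> b' = (if b' = b then s else w \<bullet> b')" if "b' \<in> Basis" for b' s
      using b that by (auto simp: inner_add_left inner_Basis)
    let ?f = "\<lambda>v. (\<Prod>b'\<in>insert b I. ?ind w b' (v b')) * F (P (\<Sum>b'\<in>Basis. (if b' \<in> insert b I then v b' else w \<bullet> b') *\<^sub>R b'))"
    have f: "?f \<in> borel_measurable (Pi\<^sub>M (insert b I) (\<lambda>_. lborel))"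
    proof (rule borel_measurable_times_ennreal)
      show "(\<lambda>v. \<Prod>b'\<in>insert b I. ?ind w b' (v b')) \<in> borel_measurable (Pi\<^sub>M (insert b I) (\<lambda>_. lborel))"
        using insert by (intro borel_measurable_PiM_prod_indicator) auto
      show "(\<lambda>v. F (P (\<Sum>b'\<in>Basis. (if b' \<in> insert b I then v b' else w \<bullet> b') *\<^sub>R b'))) \<in> borel_measurable (Pi\<^sub>M (insert b I) (\<lambda>_. lborel))"
        using measurable_compose[OF measurable_compose[OF borel_measurable_PiM_sum[OF insert.prems(1)] P] F] .
    qed
    have fb: "?f (x(b := y)) = ?ind w b y * ((\<Prod>b'\<in>I. ?ind (?w y) b' (x b')) *
        F (P (\<Sum>b'\<in>Basis. (if b' \<in> I then x b' else ?w y \<bullet> b') *\<^sub>R b')))" for x y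
    proof -
      have "(\<Prod>b'\<in>I. ?ind w b' ((x(b := y)) b')) = (\<Prod>b'\<in>I. ?ind (?w y) b' (x b'))"
        using insert wb[of _ y] by (intro prod.cong) (auto simp: subset_iff)
      moreover have "(\<Sum>b'\<in>Basis. (if b' \<in> insert b I then (x(b := y)) b' else w \<bullet> b') *\<^sub>R b') =
          (\<Sum>b'\<in>Basis. (if b' \<in> I then x b' else ?w y \<bullet> b') *\<^sub>R b')"
        using insert wb[of _ y] by (intro sum.cong) auto
      ultimately show ?thesis using insert.hyps by (simp add: mult.assoc)
    qed
    have meas: "(\<lambda>x. (\<Prod>b'\<in>I. ?ind (?w y) b' (x b')) *
        F (P (\<Sum>b'\<in>Basis. (if b' \<in> I then x b' else ?w y \<bullet> b') *\<^sub>R b'))) \<in> borel_measurable (Pi\<^sub>M I (\<lambda>_. lborel))" for y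
    proof (rule borel_measurable_times_ennreal)
      show "(\<lambda>v. \<Prod>b'\<in>I. ?ind (?w y) b' (v b')) \<in> borel_measurable (Pi\<^sub>M I (\<lambda>_. lborel))"
        using insert by (intro borel_measurable_PiM_prod_indicator) auto
      show "(\<lambda>v. F (P (\<Sum>b'\<in>Basis. (if b' \<in> I then v b' else ?w y \<bullet> b') *\<^sub>R b'))) \<in> borel_measurable (Pi\<^sub>M I (\<lambda>_. lborel))"
        using measurable_compose[OF measurable_compose[OF borel_measurable_PiM_sum P] F] insert.prems(1) by blast
    qed
    let ?H = "\<lambda>y. \<integral>\<^sup>+x. (\<Prod>b'\<in>I. ?ind (?w y) b' (x b')) *
        F (P (\<Sum>b'\<in>Basis. (if b' \<in> I then x b' else ?w y \<bullet> b') *\<^sub>R b')) \<partial>Pi\<^sub>M I (\<lambda>_. lborel)"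
    \<comment> \<open>Outside the window of b both sides vanish, so the induction hypothesis is
      applied only at points that stay in the block.\<close>
    have IH: "?ind w b y * (\<alpha> ^ card I * ?H y) \<le> ?ind w b y * G (P (?w y))" for y
    proof (cases "\<bar>y - w \<bullet> b\<bar> < r")
      case True
      have yb: "\<bar>y\<bar> < R b" using True insert.prems(3)[of b] by auto
      have "\<alpha> ^ card I * ?H y \<le> G (P (?w y))"
        unfolding G_def
      proof (rule insert.IH)
        show "I \<subseteq> Basis" using insert by auto
        show "\<bar>?w y \<bullet> b'\<bar> < R b'" if "b' \<in> Basis" for b'
          using wb[OF that, of y] insert.prems(2)[OF that] yb by auto
        show "\<bar>?w y \<bullet> b'\<bar> + r \<le> R b'" if "b' \<in> I" for b'
          using wb[of b' y] insert.prems(1,3) insert.hyps(2) that by auto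
      qed
      then show ?thesis by (rule mult_left_mono) simp
    qed simp
    have "\<alpha> ^ card (insert b I) * (\<integral>\<^sup>+v. ?f v \<partial>Pi\<^sub>M (insert b I) (\<lambda>_. lborel))
        = \<alpha> ^ Suc (card I) * (\<integral>\<^sup>+y. \<integral>\<^sup>+x. ?f (x(b := y)) \<partial>Pi\<^sub>M I (\<lambda>_. lborel) \<partial>lborel)"
      using insert.hyps by (simp only: product_nn_integral_insert_rev[OF insert.hyps f] card_insert_disjoint[OF insert.hyps])
    also have "\<dots> = \<alpha> * (\<alpha> ^ card I * (\<integral>\<^sup>+y. ?ind w b y * ?H y \<partial>lborel))"
      by (simp only: fb nn_integral_cmult[OF meas] power_Suc mult.assoc)
    also have "\<dots> \<le> \<alpha> * (\<integral>\<^sup>+y. \<alpha> ^ card I * (?ind w b y * ?H y) \<partial>lborel)"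
    proof (intro mult_left_mono)
      have "(\<lambda>y. ?ind w b y * ?H y) \<in> borel_measurable lborel"
      proof -
        have "(\<lambda>y. \<integral>\<^sup>+x. ?f (x(b := y)) \<partial>Pi\<^sub>M I (\<lambda>_. lborel)) \<in> borel_measurable lborel"
        proof (rule sigma_finite_measure.borel_measurable_nn_integral)
          show "sigma_finite_measure (Pi\<^sub>M I (\<lambda>_::'a. lborel :: real measure))"
            using insert.hyps(1) by (rule sigma_finite)
          have "(\<lambda>(y, x). x(b := y)) \<in> lborel \<Otimes>\<^sub>M Pi\<^sub>M I (\<lambda>_. lborel) \<rightarrow>\<^sub>M Pi\<^sub>M (insert b I) (\<lambda>_. lborel :: real measure)"
            unfolding split_def
            by (rule measurable_fun_upd[where J=I]) auto
          from measurable_compose[OF this f]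
          show "(\<lambda>(y, x). ?f (x(b := y))) \<in> borel_measurable (lborel \<Otimes>\<^sub>M Pi\<^sub>M I (\<lambda>_. lborel))"
            by (simp only: split_def)
        qed
        then show ?thesis by (simp only: fb nn_integral_cmult[OF meas])
      qed
      then show "\<alpha> ^ card I * (\<integral>\<^sup>+y. ?ind w b y * ?H y \<partial>lborel) \<le> (\<integral>\<^sup>+y. \<alpha> ^ card I * (?ind w b y * ?H y) \<partial>lborel)"
        by (simp add: nn_integral_cmult)
    qed simp
    also have "\<dots> \<le> \<alpha> * (\<integral>\<^sup>+y. ?ind w b y * G (P (?w y)) \<partial>lborel)"
      using IH by (intro mult_left_mono nn_integral_mono) (auto simp: ac_simps)
    also have "\<dots> \<le> (\<integral>\<^sup>+y. G y \<partial>K (P w))"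
      by (rule step[OF _ b _ G]) (use insert.prems in auto)
    also have "\<dots> = (\<integral>\<^sup>+y. F y \<partial>kernel_pow K (card (insert b I)) (P w))"
    proof -
      have N: "kernel_pow K (card I) \<in> K (P w) \<rightarrow>\<^sub>M subprob_algebra borel"
        using measurable_prob_algebraD[OF Kp] measurable_cong_sets[OF prob_kernelD(2)[OF K] refl] by blast
      then show ?thesis
        using insert.hyps nn_integral_bind[OF F N] by (simp add: G_def)
    qed
    finally show ?case .
  qed
qed

text \<open>With all coordinates moved, Lebesgue measure is the image of the product measure over
  the basis, which turns the product of the windows into a box.\<close>

lemma kernel_minorization_lborel:
  fixes P :: "'a::euclidean_space \<Rightarrow> 'm::topological_space"
  assumes K: "K \<in> borel \<rightarrow>\<^sub>M prob_algebra borel" and P: "P \<in> borel \<rightarrow>\<^sub>M borel" and r: "0 < r"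
    and step: "\<And>w b F. (\<And>b. b \<in> Basis \<Longrightarrow> \<bar>w \<bullet> b\<bar> < R b) \<Longrightarrow> b \<in> Basis \<Longrightarrow> \<bar>w \<bullet> b\<bar> + r \<le> R b \<Longrightarrow> F \<in> borel_measurable borel \<Longrightarrow>
      \<alpha> * (\<integral>\<^sup>+s. indicator {s. \<bar>s - w \<bullet> b\<bar> < r} s * F (P (w + (s - w \<bullet> b) *\<^sub>R b)) \<partial>lborel) \<le> (\<integral>\<^sup>+y. F y \<partial>K (P w))"
    and w: "\<And>b. b \<in> Basis \<Longrightarrow> \<bar>w \<bullet> b\<bar> + r \<le> R b"
    and F: "F \<in> borel_measurable borel"
  shows "\<alpha> ^ DIM('a) * (\<integral>\<^sup>+z. indicator {z. \<forall>b\<in>Basis. \<bar>z \<bullet> b - w \<bullet> b\<bar> < r} z * F (P z) \<partial>lborel)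
    \<le> (\<integral>\<^sup>+y. F y \<partial>kernel_pow K DIM('a) (P w))"
proof -
  have "(\<integral>\<^sup>+z. indicator {z. \<forall>b\<in>Basis. \<bar>z \<bullet> b - w \<bullet> b\<bar> < r} z * F (P z) \<partial>lborel) =
    (\<integral>\<^sup>+v. (\<Prod>b\<in>Basis. indicator {s. \<bar>s - w \<bullet> b\<bar> < r} (v b)) *
      F (P (\<Sum>b\<in>Basis. (if b \<in> Basis then v b else w \<bullet> b) *\<^sub>R b)) \<partial>Pi\<^sub>M Basis (\<lambda>_. lborel))"
  proof -
    have m1: "(\<lambda>v. \<Sum>b\<in>Basis. v b *\<^sub>R b :: 'a) \<in> Pi\<^sub>M Basis (\<lambda>_. lborel) \<rightarrow>\<^sub>M borel"
      using borel_measurable_PiM_sum[of "Basis :: 'a set" undefined] by simp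
    have o: "open {z::'a. \<forall>b\<in>Basis. \<bar>z \<bullet> b - w \<bullet> b\<bar> < r}"
      unfolding Collect_ball_eq by (intro open_INT ballI open_Collect_less continuous_intros) auto
    have m2: "(\<lambda>z. indicator {z. \<forall>b\<in>Basis. \<bar>z \<bullet> b - w \<bullet> b\<bar> < r} z * F (P z)) \<in> borel_measurable borel"
      using o measurable_compose[OF P F] by (intro borel_measurable_times_ennreal borel_measurable_indicator) auto
    then have m2': "(\<lambda>z. indicator {z. \<forall>b\<in>Basis. \<bar>z \<bullet> b - w \<bullet> b\<bar> < r} z * F (P z))
        \<in> borel_measurable (distr (Pi\<^sub>M Basis (\<lambda>_. lborel)) borel (\<lambda>v. \<Sum>b\<in>Basis. v b *\<^sub>R b))"
      by simp
    have ind: "indicator {z. \<forall>b\<in>Basis. \<bar>z \<bullet> b - w \<bullet> b\<bar> < r} (\<Sum>b\<in>Basis. v b *\<^sub>R b) =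
        (\<Prod>b\<in>Basis. indicator {s. \<bar>s - w \<bullet> b\<bar> < r} (v b) :: ennreal)" for v
    proof (cases "\<forall>b\<in>Basis. \<bar>v b - w \<bullet> b\<bar> < r")
      case False
      then obtain b where "b \<in> Basis" "\<not> \<bar>v b - w \<bullet> b\<bar> < r" by blast
      then have "(\<Prod>b\<in>Basis. indicator {s. \<bar>s - w \<bullet> b\<bar> < r} (v b) :: ennreal) = 0"
        by (intro prod_zero bexI[of _ b]) (auto simp: indicator_def)
      then show ?thesis using False by (auto simp: indicator_def)
    qed (simp add: indicator_def)
    show ?thesis
      by (subst lborel_eq, subst nn_integral_distr[OF m1 m2']) (simp add: ind)
  qed
  moreover have "\<alpha> ^ card (Basis :: 'a set) * (\<integral>\<^sup>+v. (\<Prod>b\<in>Basis. indicator {s. \<bar>s - w \<bullet> b\<bar> < r} (v b)) *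
      F (P (\<Sum>b\<in>Basis. (if b \<in> Basis then v b else w \<bullet> b) *\<^sub>R b)) \<partial>Pi\<^sub>M Basis (\<lambda>_. lborel))
    \<le> (\<integral>\<^sup>+y. F y \<partial>kernel_pow K (card (Basis :: 'a set)) (P w))"
  proof (rule kernel_minorization[OF K P r step order_refl _ _ F])
    show "\<bar>w \<bullet> b\<bar> < R b" if "b \<in> Basis" for b using w[OF that] r by linarith
  qed (use w in auto)
  ultimately show ?thesis by simp
qed

section \<open>Lengths of curves and the Riemannian distance\<close>

lemma chart_facts:
  assumes "is_chart c"
  shows "open (fst c)" "open (img c)" "continuous_on (fst c) (snd c)" "continuous_on (img c) (par c)"
    "p \<in> fst c \<Longrightarrow> par c (snd c p) = p" "p \<in> fst c \<Longrightarrow> snd c p \<in> img c"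
    "y \<in> img c \<Longrightarrow> snd c (par c y) = y" "y \<in> img c \<Longrightarrow> par c y \<in> fst c"
  using assms unfolding is_chart_def homeomorphism_def img_def by auto

lemma open_par_image:
  assumes c: "is_chart c" and S: "open S" "S \<subseteq> img c"
  shows "open (par c ` S)"
proof -
  have "par c ` S = snd c -` S \<inter> fst c"
    using chart_facts(5-8)[OF c] S(2) by force
  then show ?thesis
    using continuous_open_preimage[OF chart_facts(3,1)[OF c] S(1)] by (simp add: Int_commute)
qed

lemma open_snd_image:
  assumes c: "is_chart c" and S: "open S" "S \<subseteq> fst c"
  shows "open (snd c ` S)"
proof -
  have "snd c ` S = par c -` S \<inter> img c"
    using chart_facts(5-8)[OF c] S(2) by force
  then show ?thesis
    using continuous_open_preimage[OF chart_facts(4,2)[OF c] S(1)] by (simp add: Int_commute)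
qed

lemma isCont_openE:
  assumes f: "isCont f t" and U: "open U" "f t \<in> U"
  obtains V where "open V" "t \<in> V" "\<And>s. s \<in> V \<Longrightarrow> f s \<in> U"
proof -
  have "\<forall>W. open W \<and> f t \<in> W \<longrightarrow> (\<exists>S. open S \<and> t \<in> S \<and> (\<forall>s\<in>S. f s \<in> W))"
    using f by (simp only: continuous_at_open)
  then have "\<exists>S. open S \<and> t \<in> S \<and> (\<forall>s\<in>S. f s \<in> U)" using U by (elim allE[of _ U]) simp
  then show ?thesis using that by blast
qed

lemma smooth_on_jac: "smooth_on S f \<Longrightarrow> y \<in> S \<Longrightarrow> jac f y *v v = frechet_derivative f (at y) v"
  unfolding jac_def
  using matrix_vector_mul(2)[OF linear_frechet_derivative[OF smooth_on_differentiable]] by metis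

text \<open>Continuity keeps the curve in the domain of c near t, where its d-coordinates are the
  transition map applied to its c-coordinates; the rest is the chain rule.\<close>

lemma chart_change_vector_derivative:
  assumes c: "is_chart c" and d: "is_chart d" and cd: "smooth_on (snd c ` (fst c \<inter> fst d)) (trans_map c d)"
    and \<gamma>: "isCont \<gamma> t" "\<gamma> t \<in> fst c" "\<gamma> t \<in> fst d"
    and v: "((snd c \<circ> \<gamma>) has_vector_derivative v) (at t)"
  shows "((snd d \<circ> \<gamma>) has_vector_derivative jac (trans_map c d) (snd c (\<gamma> t)) *v v) (at t)"
proof -
  have S: "snd c (\<gamma> t) \<in> snd c ` (fst c \<inter> fst d)" using \<gamma> by blast
  have "((\<lambda>t. trans_map c d ((snd c \<circ> \<gamma>) t)) has_vector_derivative
      frechet_derivative (trans_map c d) (at ((snd c \<circ> \<gamma>) t)) v) (at t)"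
    using S by (intro smooth_on_chain_vector_derivative[OF cd v]) simp
  then have D: "((\<lambda>t. trans_map c d (snd c (\<gamma> t))) has_vector_derivative jac (trans_map c d) (snd c (\<gamma> t)) *v v) (at t)"
    by (simp add: smooth_on_jac[OF cd S])
  obtain U where U: "open U" "t \<in> U" "\<And>s. s \<in> U \<Longrightarrow> \<gamma> s \<in> fst c"
    using isCont_openE[OF \<gamma>(1) chart_facts(1)[OF c] \<gamma>(2)] by blast
  show ?thesis
    by (rule has_vector_derivative_transform_within_open[OF D U(1,2)])
      (use U(3) chart_facts(5)[OF c] in \<open>simp add: trans_map_def\<close>)
qed

locale riemannian =
  fixes atl :: "('m::t2_space, 'n::finite) chart set"
    and g :: "('m, 'n) chart \<Rightarrow> real^'n \<Rightarrow> real^'n^'n"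
  assumes atlas: "smooth_atlas atl" and metric: "riemannian_metric atl g"
begin

lemma atl_is_chart: "c \<in> atl \<Longrightarrow> is_chart c"
  using atlas by (simp add: smooth_atlas_def)

lemma atl_max: "c \<in> atl \<Longrightarrow> c \<in> max_atlas atl"
  using atlas by (simp add: smooth_atlas_def max_atlas_def)

lemma max_is_chart: "c \<in> max_atlas atl \<Longrightarrow> is_chart c"
  by (simp add: max_atlas_def)

lemma trans_smooth:
  assumes "c \<in> max_atlas atl" "d \<in> atl"
  shows "smooth_on (snd c ` (fst c \<inter> fst d)) (trans_map c d)"
    "smooth_on (snd d ` (fst d \<inter> fst c)) (trans_map d c)"
  using assms by (auto simp: max_atlas_def compatible_def Int_commute)

lemma atl_cover: obtains c where "c \<in> atl" "p \<in> fst c"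
proof -
  have "p \<in> (\<Union>c\<in>atl. fst c)" using atlas by (simp add: smooth_atlas_def)
  then show ?thesis using that by blast
qed

lemma metric_smooth: "c \<in> max_atlas atl \<Longrightarrow> smooth_on (img c) (g c)"
  using metric by (simp add: riemannian_metric_def)

lemma metric_pos: "c \<in> max_atlas atl \<Longrightarrow> y \<in> img c \<Longrightarrow> v \<noteq> 0 \<Longrightarrow> v \<bullet> (g c y *v v) > 0"
  using metric unfolding riemannian_metric_def by blast

lemma metric_nonneg: "c \<in> max_atlas atl \<Longrightarrow> y \<in> img c \<Longrightarrow> v \<bullet> (g c y *v v) \<ge> 0"
  using metric_pos[of c y v] by (cases "v = 0") auto

lemma metric_change:
  assumes "c \<in> max_atlas atl" "d \<in> max_atlas atl" "p \<in> fst c" "p \<in> fst d"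
  shows "v \<bullet> (g c (snd c p) *v v) =
    (jac (trans_map c d) (snd c p) *v v) \<bullet> (g d (snd d p) *v (jac (trans_map c d) (snd c p) *v v))"
proof -
  let ?J = "jac (trans_map c d) (snd c p)"
  have "g c (snd c p) = transpose ?J ** g d (snd d p) ** ?J"
    using metric assms unfolding riemannian_metric_def by blast
  then have "g c (snd c p) *v v = (g d (snd d p) *v (?J *v v)) v* ?J"
    by (metis matrix_vector_mul_assoc transpose_matrix_vector)
  then show ?thesis
    using dot_lmul_matrix[of "g d (snd d p) *v (?J *v v)" ?J v] by (simp add: inner_commute)
qed

text \<open>\<open>speed\<close> uses an arbitrarily chosen atlas chart. The transformation law of
  the metric gives the same value in every chart of the maximal atlas, in particular in the normal
  charts of the cubes.\<close>

lemma speed_eq: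
  assumes c: "c \<in> max_atlas atl" and \<gamma>: "isCont \<gamma> t" "\<gamma> t \<in> fst c"
    and v: "((snd c \<circ> \<gamma>) has_vector_derivative v) (at t)"
  shows "speed atl g \<gamma> t = sqrt (v \<bullet> (g c (snd c (\<gamma> t)) *v v))"
proof -
  define d where "d = (SOME c. c \<in> atl \<and> \<gamma> t \<in> fst c)"
  have "\<exists>c. c \<in> atl \<and> \<gamma> t \<in> fst c" using atl_cover by blast
  then have d: "d \<in> atl" "\<gamma> t \<in> fst d" unfolding d_def by (metis (mono_tags, lifting) someI_ex)+
  have "((snd d \<circ> \<gamma>) has_vector_derivative jac (trans_map c d) (snd c (\<gamma> t)) *v v) (at t)"
    using c d \<gamma> v by (intro chart_change_vector_derivative trans_smooth max_is_chart atl_is_chart)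
  then have "vector_derivative (snd d \<circ> \<gamma>) (at t) = jac (trans_map c d) (snd c (\<gamma> t)) *v v"
    by (rule vector_derivative_at)
  then show ?thesis
    using metric_change[OF c atl_max[OF d(1)] \<gamma>(2) d(2), of v]
    unfolding speed_def by (simp add: Let_def d_def[symmetric])
qed

text \<open>The endpoints are put into the exceptional set because \<open>at 0\<close> and \<open>at 1\<close> refer to
  two-sided neighbourhoods, where the curve is arbitrary.\<close>

definition regular :: "(real \<Rightarrow> 'm) \<Rightarrow> real set \<Rightarrow> bool" where
  "regular \<gamma> T \<longleftrightarrow> finite T \<and> {0, 1} \<subseteq> T \<and> continuous_on {0..1} \<gamma> \<and>
     (\<forall>t\<in>{0..1} - T. \<forall>c\<in>atl. \<gamma> t \<in> fst c \<longrightarrow>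
        (\<exists>e>0. (snd c \<circ> \<gamma>) C1_differentiable_on {t - e<..<t + e}))"

lemma pw_C1_curve_iff_regular: "pw_C1_curve atl \<gamma> \<longleftrightarrow> (\<exists>T. regular \<gamma> T)"
proof
  assume "pw_C1_curve atl \<gamma>"
  then obtain T where "finite T" "continuous_on {0..1} \<gamma>" "\<forall>t\<in>{0..1} - T. \<forall>c\<in>atl. \<gamma> t \<in> fst c \<longrightarrow>
        (\<exists>e>0. (snd c \<circ> \<gamma>) C1_differentiable_on {t - e<..<t + e})"
    unfolding pw_C1_curve_def by blast
  then have "regular \<gamma> (T \<union> {0, 1})" unfolding regular_def by simp
  then show "\<exists>T. regular \<gamma> T" ..
qed (auto simp: regular_def pw_C1_curve_def)

lemma regular_in: "regular \<gamma> T \<Longrightarrow> t \<in> {0..1} - T \<Longrightarrow> 0 < t \<and> t < 1"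
  unfolding regular_def by (cases "t = 0"; cases "t = 1") auto

lemma regular_isCont: "regular \<gamma> T \<Longrightarrow> 0 < t \<Longrightarrow> t < 1 \<Longrightarrow> isCont \<gamma> t"
  unfolding regular_def using continuous_on_interior[of "{0..1}" \<gamma> t] by simp

text \<open>Differentiability of the curve is demanded in atlas charts; transition maps carry it
  over to the maximal atlas.\<close>

lemma regular_derivative:
  assumes \<gamma>: "regular \<gamma> T" and t: "t \<in> {0..1} - T" and c: "c \<in> max_atlas atl" "\<gamma> t \<in> fst c"
  obtains v where "((snd c \<circ> \<gamma>) has_vector_derivative v) (at t)"
proof -
  obtain d where d: "d \<in> atl" "\<gamma> t \<in> fst d" using atl_cover by blast
  obtain e where e: "e > 0" "(snd d \<circ> \<gamma>) C1_differentiable_on {t - e<..<t + e}"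
    using \<gamma> t d unfolding regular_def by blast
  then obtain D where D: "\<And>s. s \<in> {t - e<..<t + e} \<Longrightarrow> ((snd d \<circ> \<gamma>) has_vector_derivative D s) (at s)"
    unfolding C1_differentiable_on_def by blast
  have "t \<in> {t - e<..<t + e}" using e by simp
  note D' = D[OF this]
  show ?thesis
    by (rule that, rule chart_change_vector_derivative[OF atl_is_chart[OF d(1)] max_is_chart[OF c(1)]
          trans_smooth(2)[OF c(1) d(1)] _ d(2) c(2) D'])
      (use regular_isCont[OF \<gamma>] regular_in[OF \<gamma> t] in blast)
qed

lemma continuous_quadratic:
  fixes G :: "'a::topological_space \<Rightarrow> real^'n^'n" and D :: "'a \<Rightarrow> real^'n"
  assumes "continuous_on S G" "continuous_on S D"
  shows "continuous_on S (\<lambda>s. D s \<bullet> (G s *v D s))"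
proof -
  have "D s \<bullet> (G s *v D s) = (\<Sum>i\<in>UNIV. D s $ i * (\<Sum>j\<in>UNIV. G s $ i $ j * D s $ j))" for s
    by (simp add: inner_vec_def matrix_vector_mult_def)
  then show ?thesis
    by (simp only:) (intro continuous_intros assms)
qed

lemma speed_continuous:
  assumes \<gamma>: "regular \<gamma> T"
  shows "continuous_on ({0..1} - T) (speed atl g \<gamma>)"
proof (rule continuous_at_imp_continuous_on, rule ballI)
  fix t assume t: "t \<in> {0..1} - T"
  obtain c where c: "c \<in> atl" "\<gamma> t \<in> fst c" using atl_cover by blast
  obtain e where e: "e > 0" "(snd c \<circ> \<gamma>) C1_differentiable_on {t - e<..<t + e}"
    using \<gamma> t c unfolding regular_def by blast
  then obtain D where D: "\<And>s. s \<in> {t - e<..<t + e} \<Longrightarrow> ((snd c \<circ> \<gamma>) has_vector_derivative D s) (at s)"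
    "continuous_on {t - e<..<t + e} D"
    unfolding C1_differentiable_on_def by blast
  have "isCont \<gamma> t" using regular_isCont[OF \<gamma>] regular_in[OF \<gamma> t] by blast
  then obtain U where U: "open U" "t \<in> U" "\<And>s. s \<in> U \<Longrightarrow> \<gamma> s \<in> fst c"
    using chart_facts(1)[OF atl_is_chart[OF c(1)]] c(2) by (rule isCont_openE) blast
  let ?V = "U \<inter> {t - e<..<t + e} \<inter> {0<..<1}"
  have V: "open ?V" using U(1) by (intro open_Int open_greaterThanLessThan)
  have tV: "t \<in> ?V" using U e regular_in[OF \<gamma> t] by auto
  have eq: "speed atl g \<gamma> s = sqrt (D s \<bullet> (g c (snd c (\<gamma> s)) *v D s))" if "s \<in> ?V" for s
    using that U D(1) regular_isCont[OF \<gamma>] by (intro speed_eq atl_max c) auto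
  have ct: "continuous_on ?V (\<lambda>s. snd c (\<gamma> s))"
    using D(1) by (intro continuous_at_imp_continuous_on ballI)
      (auto simp: o_def intro!: has_vector_derivative_continuous)
  have "continuous_on ?V (\<lambda>s. sqrt (D s \<bullet> (g c (snd c (\<gamma> s)) *v D s)))"
  proof (intro continuous_on_real_sqrt continuous_quadratic)
    show "continuous_on ?V D" using D(2) by (rule continuous_on_subset) auto
    show "continuous_on ?V (\<lambda>s. g c (snd c (\<gamma> s)))"
      using chart_facts(6)[OF atl_is_chart[OF c(1)]] U(3)
      by (intro continuous_on_compose2[OF smooth_on_continuous[OF metric_smooth[OF atl_max[OF c(1)]]] ct]) auto
  qed
  then have "continuous_on ?V (speed atl g \<gamma>)"
    by (rule continuous_on_eq) (simp add: eq)
  then show "isCont (speed atl g \<gamma>) t"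
    using V tV continuous_on_eq_continuous_at by blast
qed

text \<open>At exceptional times and outside {0..1} \<open>speed\<close> may be arbitrary. Cutting
  it off there gives a nonnegative Borel function on the line with the same integral over
  {0..1}.\<close>

definition rspeed :: "(real \<Rightarrow> 'm) \<Rightarrow> real set \<Rightarrow> real \<Rightarrow> real" where
  "rspeed \<gamma> T t = indicator ({0..1} - T) t * speed atl g \<gamma> t"

lemma rspeed_measurable:
  assumes "regular \<gamma> T" shows "rspeed \<gamma> T \<in> borel_measurable borel"
proof -
  have T: "{0..1} - T \<in> sets borel"
    using assms by (intro sets.Diff borel_closed finite_imp_closed closed_atLeastAtMost) (simp_all add: regular_def)
  show ?thesis
    using borel_measurable_continuous_on_indicator[OF T speed_continuous[OF assms]]
    unfolding rspeed_def[abs_def] by (simp add: mult.commute)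
qed

lemma speed_nonneg: assumes "regular \<gamma> T" "t \<in> {0..1} - T" shows "speed atl g \<gamma> t \<ge> 0"
proof -
  obtain c where c: "c \<in> atl" "\<gamma> t \<in> fst c" using atl_cover by blast
  obtain v where v: "((snd c \<circ> \<gamma>) has_vector_derivative v) (at t)"
    by (rule regular_derivative[OF assms atl_max[OF c(1)] c(2)])
  show ?thesis
    using speed_eq[OF atl_max[OF c(1)] _ c(2) v] regular_isCont[OF assms(1)] regular_in[OF assms]
      metric_nonneg[OF atl_max[OF c(1)] chart_facts(6)[OF atl_is_chart[OF c(1)] c(2)], of v] by simp
qed

lemma rspeed_nonneg: "regular \<gamma> T \<Longrightarrow> rspeed \<gamma> T t \<ge> 0"
  using speed_nonneg by (simp add: rspeed_def indicator_def)

lemma AE_not_in_finite: "finite (T :: real set) \<Longrightarrow> AE t in lborel. t \<notin> T"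
  using finite_imp_null_set_lborel AE_not_in by blast

lemma curve_length_eq:
  assumes "regular \<gamma> T"
  shows "curve_length atl g \<gamma> = (\<integral>\<^sup>+t. ennreal (rspeed \<gamma> T t) \<partial>lborel)"
  unfolding curve_length_def
proof (rule nn_integral_cong_AE)
  have "finite T" using assms by (simp add: regular_def)
  from AE_not_in_finite[OF this]
  show "AE t in lborel. ennreal (speed atl g \<gamma> t) * indicator {0..1} t = ennreal (rspeed \<gamma> T t)"
    by eventually_elim (auto simp: rspeed_def indicator_def)
qed

section \<open>Reparametrised and joined curves\<close>

lemma speed_rescale:
  assumes eq: "\<And>s. s \<in> V \<Longrightarrow> \<beta> s = \<gamma> (2 * s - k)" and V: "open V" "t \<in> V"
    and \<gamma>: "regular \<gamma> T" "2 * t - k \<in> {0..1} - T" and \<beta>: "isCont \<beta> t"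
  shows "speed atl g \<beta> t = 2 * speed atl g \<gamma> (2 * t - k)"
proof -
  obtain c where c: "c \<in> atl" "\<gamma> (2 * t - k) \<in> fst c" using atl_cover by blast
  obtain v where v: "((snd c \<circ> \<gamma>) has_vector_derivative v) (at (2 * t - k))"
    by (rule regular_derivative[OF \<gamma> atl_max[OF c(1)] c(2)])
  have "((\<lambda>s. 2 * s - k) has_vector_derivative 2) (at t)"
    by (auto intro!: derivative_eq_intros simp: has_real_derivative_iff_has_vector_derivative[symmetric])
  from vector_diff_chain_at[OF this v]
  have "((\<lambda>s. snd c (\<gamma> (2 * s - k))) has_vector_derivative 2 *\<^sub>R v) (at t)" by (simp add: o_def)
  then have "((snd c \<circ> \<beta>) has_vector_derivative 2 *\<^sub>R v) (at t)"
    by (rule has_vector_derivative_transform_within_open[OF _ V]) (simp add: eq)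
  moreover have b: "\<beta> t = \<gamma> (2 * t - k)" using eq V by blast
  ultimately have "speed atl g \<beta> t = sqrt ((2 *\<^sub>R v) \<bullet> (g c (snd c (\<beta> t)) *v (2 *\<^sub>R v)))"
    using c by (intro speed_eq[OF atl_max[OF c(1)] \<beta>]) auto
  also have "\<dots> = sqrt (2\<^sup>2 * (v \<bullet> (g c (snd c (\<beta> t)) *v v)))"
    by (simp add: matrix_vector_mult_scaleR power2_eq_square)
  also have "\<dots> = 2 * speed atl g \<gamma> (2 * t - k)"
    using speed_eq[OF atl_max[OF c(1)] _ c(2) v] regular_isCont[OF \<gamma>(1)] regular_in[OF \<gamma>]
    by (simp add: b real_sqrt_mult)
  finally show ?thesis .
qed

lemma C1_rescale:
  assumes eq: "\<And>s. s \<in> V \<Longrightarrow> \<beta> s = \<gamma> (2 * s - k)" and V: "open V" "t \<in> V"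
    and f: "e > 0" "(f \<circ> \<gamma>) C1_differentiable_on {2 * t - k - e<..<2 * t - k + e}"
  shows "\<exists>e>0. (f \<circ> \<beta> :: real \<Rightarrow> real^'n) C1_differentiable_on {t - e<..<t + e}"
proof -
  obtain e1 where e1: "e1 > 0" "\<And>s. \<bar>s - t\<bar> < e1 \<Longrightarrow> s \<in> V"
    using V by (metis open_dist dist_real_def)
  obtain D where D: "\<And>s. s \<in> {2 * t - k - e<..<2 * t - k + e} \<Longrightarrow> ((f \<circ> \<gamma>) has_vector_derivative D s) (at s)"
    "continuous_on {2 * t - k - e<..<2 * t - k + e} D"
    using f(2) unfolding C1_differentiable_on_def by blast
  define e' where "e' = min (e / 2) e1"
  have e': "e' > 0" "e' \<le> e / 2" "e' \<le> e1" using e1 f by (auto simp: e'_def)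
  have inI: "2 * s - k \<in> {2 * t - k - e<..<2 * t - k + e}" if "s \<in> {t - e'<..<t + e'}" for s
    using that e' by auto
  have "(f \<circ> \<beta>) C1_differentiable_on {t - e'<..<t + e'}"
    unfolding C1_differentiable_on_def
  proof (intro exI conjI ballI)
    fix s assume s: "s \<in> {t - e'<..<t + e'}"
    have "((\<lambda>s. 2 * s - k) has_vector_derivative 2) (at s)"
      by (auto intro!: derivative_eq_intros simp: has_real_derivative_iff_has_vector_derivative[symmetric])
    from vector_diff_chain_at[OF this D(1)[OF inI[OF s]]]
    have "((\<lambda>s. f (\<gamma> (2 * s - k))) has_vector_derivative 2 *\<^sub>R D (2 * s - k)) (at s)" by (simp add: o_def)
    then show "((f \<circ> \<beta>) has_vector_derivative 2 *\<^sub>R D (2 * s - k)) (at s)"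
    proof (rule has_vector_derivative_transform_within_open)
      show "s \<in> {t - e'<..<t + e'}" by (rule s)
      fix q assume "q \<in> {t - e'<..<t + e'}"
      then have "\<bar>q - t\<bar> < e1" using e' by (auto simp: abs_less_iff)
      then show "f (\<gamma> (2 * q - k)) = (f \<circ> \<beta>) q" using e1(2) eq by simp
    qed simp
  next
    show "continuous_on {t - e'<..<t + e'} (\<lambda>s. 2 *\<^sub>R D (2 * s - k))"
      using inI by (intro continuous_on_scaleR continuous_on_const continuous_on_compose2[OF D(2)] continuous_intros) blast
  qed
  then show ?thesis using e' by blast
qed

text \<open>Each half of the joined curve is one of the given curves run at double speed, and double
  speed on half the time preserves length. An inequality is all that infima over curves call
  for.\<close>

lemma regular_join:
  assumes 1: "regular \<gamma>1 T1" and 2: "regular \<gamma>2 T2" and j: "\<gamma>1 1 = \<gamma>2 0"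
  shows "\<exists>T. regular (\<gamma>1 +++ \<gamma>2) T"
    "curve_length atl g (\<gamma>1 +++ \<gamma>2) \<le> curve_length atl g \<gamma>1 + curve_length atl g \<gamma>2"
proof -
  define T where "T = (\<lambda>t. t / 2) ` T1 \<union> (\<lambda>t. (t + 1) / 2) ` T2"
  let ?\<gamma> = "\<gamma>1 +++ \<gamma>2"
  have lo: "?\<gamma> s = \<gamma>1 (2 * s - 0)" if "s \<in> {..<1/2}" for s using that by (simp add: joinpaths_def)
  have hi: "?\<gamma> s = \<gamma>2 (2 * s - 1)" if "s \<in> {1/2<..}" for s using that by (simp add: joinpaths_def)
  have ct: "continuous_on {0..1} ?\<gamma>"
    using path_join_imp[of \<gamma>1 \<gamma>2] 1 2 j by (simp add: regular_def path_def pathfinish_def pathstart_def)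
  \<comment> \<open>The junction 1/2 is exceptional because 1 belongs to T1 and 0 to T2; the
    one-sided derivatives there may differ.\<close>
  have T: "finite T" "{0, 1} \<subseteq> T" "1/2 \<in> T"
    using 1 2 by (auto simp: T_def regular_def intro: image_eqI[of _ _ 0] image_eqI[of _ _ 1])
  have cases: "(t < 1/2 \<and> 2 * t - 0 \<in> {0..1} - T1) \<or> (1/2 < t \<and> 2 * t - 1 \<in> {0..1} - T2)" if t: "t \<in> {0..1} - T" for t
  proof -
    have "t \<noteq> 1/2" using t T by blast
    moreover have "2 * t \<notin> T1" using t by (auto simp: T_def dest: imageI[of _ _ "\<lambda>t. t / 2"])
    moreover have "2 * t - 1 \<notin> T2" using t by (auto simp: T_def dest: imageI[of _ _ "\<lambda>t. (t + 1) / 2"])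
    ultimately show ?thesis using t by auto
  qed
  have reg: "regular ?\<gamma> T"
    unfolding regular_def
  proof (intro conjI ballI impI T(1,2) ct)
    fix t c assume t: "t \<in> {0..1} - T" and c: "c \<in> atl" "?\<gamma> t \<in> fst c"
    from cases[OF t] show "\<exists>e>0. (snd c \<circ> ?\<gamma>) C1_differentiable_on {t - e<..<t + e}"
    proof
      assume a: "t < 1/2 \<and> 2 * t - 0 \<in> {0..1} - T1"
      then have "\<gamma>1 (2 * t - 0) \<in> fst c" using lo[of t] c by simp
      then obtain e where "e > 0" "(snd c \<circ> \<gamma>1) C1_differentiable_on {2 * t - 0 - e<..<2 * t - 0 + e}"
        using 1 a c unfolding regular_def by blast
      then show ?thesis using a lo
        by (intro C1_rescale[where V="{..<1/2}" and \<gamma>=\<gamma>1 and k=0 and e=e]) auto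
    next
      assume a: "1/2 < t \<and> 2 * t - 1 \<in> {0..1} - T2"
      then have "\<gamma>2 (2 * t - 1) \<in> fst c" using hi[of t] c by simp
      then obtain e where "e > 0" "(snd c \<circ> \<gamma>2) C1_differentiable_on {2 * t - 1 - e<..<2 * t - 1 + e}"
        using 2 a c unfolding regular_def by blast
      then show ?thesis using a hi
        by (intro C1_rescale[where V="{1/2<..}" and \<gamma>=\<gamma>2 and k=1 and e=e]) auto
    qed
  qed
  then show "\<exists>T. regular ?\<gamma> T" ..
  have [measurable]: "rspeed \<gamma>1 T1 \<in> borel_measurable borel" "rspeed \<gamma>2 T2 \<in> borel_measurable borel"
    using rspeed_measurable 1 2 by auto
  \<comment> \<open>At each regular time one summand is the speed of the joined curve and the other
    one is nonnegative. The arguments have the form of \<open>nn_integral_real_affine\<close>, by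
    which each summand integrates to one of the lengths.\<close>
  have sp: "rspeed ?\<gamma> T t \<le> 2 * rspeed \<gamma>1 T1 (0 + 2 * t) + 2 * rspeed \<gamma>2 T2 (- 1 + 2 * t)" for t
  proof (cases "t \<in> {0..1} - T")
    case True
    have iC: "isCont ?\<gamma> t" using regular_isCont[OF reg] regular_in[OF reg True] by blast
    from cases[OF True] show ?thesis
    proof
      assume a: "t < 1/2 \<and> 2 * t - 0 \<in> {0..1} - T1"
      then have "speed atl g ?\<gamma> t = 2 * speed atl g \<gamma>1 (2 * t - 0)"
        using iC lo by (intro speed_rescale[where V="{..<1/2}", OF _ _ _ 1]) auto
      then show ?thesis using a True rspeed_nonneg[OF 2, of "- 1 + 2 * t"] by (simp add: rspeed_def)
    next
      assume a: "1/2 < t \<and> 2 * t - 1 \<in> {0..1} - T2"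
      then have "speed atl g ?\<gamma> t = 2 * speed atl g \<gamma>2 (2 * t - 1)"
        using iC hi by (intro speed_rescale[where V="{1/2<..}", OF _ _ _ 2]) auto
      moreover have "- 1 + 2 * t = 2 * t - 1" by simp
      ultimately show ?thesis using a True rspeed_nonneg[OF 1, of "0 + 2 * t"] by (simp only: rspeed_def) simp
    qed
  next
    case False
    then show ?thesis using rspeed_nonneg[OF 1, of "0 + 2 * t"] rspeed_nonneg[OF 2, of "- 1 + 2 * t"]
      by (simp add: rspeed_def)
  qed
  have "curve_length atl g ?\<gamma> = (\<integral>\<^sup>+t. ennreal (rspeed ?\<gamma> T t) \<partial>lborel)"
    by (rule curve_length_eq[OF reg])
  also have "\<dots> \<le> (\<integral>\<^sup>+t. 2 * ennreal (rspeed \<gamma>1 T1 (0 + 2 * t)) + 2 * ennreal (rspeed \<gamma>2 T2 (- 1 + 2 * t)) \<partial>lborel)"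
  proof (rule nn_integral_mono)
    fix t
    have "ennreal (rspeed ?\<gamma> T t) \<le> ennreal (2 * rspeed \<gamma>1 T1 (0 + 2 * t) + 2 * rspeed \<gamma>2 T2 (- 1 + 2 * t))"
      by (rule ennreal_leI[OF sp])
    also have "\<dots> = 2 * ennreal (rspeed \<gamma>1 T1 (0 + 2 * t)) + 2 * ennreal (rspeed \<gamma>2 T2 (- 1 + 2 * t))"
      using rspeed_nonneg[OF 1] rspeed_nonneg[OF 2] by (simp add: ennreal_plus ennreal_mult)
    finally show "ennreal (rspeed ?\<gamma> T t) \<le> 2 * ennreal (rspeed \<gamma>1 T1 (0 + 2 * t)) + 2 * ennreal (rspeed \<gamma>2 T2 (- 1 + 2 * t))" .
  qed
  also have "\<dots> = 2 * (\<integral>\<^sup>+t. ennreal (rspeed \<gamma>1 T1 (0 + 2 * t)) \<partial>lborel) + 2 * (\<integral>\<^sup>+t. ennreal (rspeed \<gamma>2 T2 (- 1 + 2 * t)) \<partial>lborel)"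
    by (subst nn_integral_add) (auto simp: nn_integral_cmult)
  also have "\<dots> = curve_length atl g \<gamma>1 + curve_length atl g \<gamma>2"
    unfolding curve_length_eq[OF 1] curve_length_eq[OF 2]
    by (subst (3) nn_integral_real_affine[where c=2 and t=0], simp_all, subst (3) nn_integral_real_affine[where c=2 and t="-1"], simp_all)
  finally show "curve_length atl g ?\<gamma> \<le> curve_length atl g \<gamma>1 + curve_length atl g \<gamma>2" .
qed

section \<open>Short curves inside a chart\<close>

lemma metric_bounded:
  assumes c: "c \<in> max_atlas atl" and K: "compact K" "K \<subseteq> img c"
  obtains B where "B > 0" "\<And>y v. y \<in> K \<Longrightarrow> v \<bullet> (g c y *v v) \<le> B\<^sup>2 * (norm v)\<^sup>2"
proof -
  have "compact (g c ` K)"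
    using K smooth_on_continuous[OF metric_smooth[OF c]]
    by (meson compact_continuous_image continuous_on_subset)
  then obtain b where b: "\<And>y. y \<in> K \<Longrightarrow> norm (g c y) \<le> b"
    using compact_imp_bounded[of "g c ` K"] unfolding bounded_iff by blast
  let ?n = "real CARD('n)"
  \<comment> \<open>A quadratic form whose entries are bounded by the modulus of b is at most n * n
    times that modulus times the squared norm, with n = \<open>CARD('n)\<close>. Adding 1 makes B
    positive; the square in the claim yields speeds at most B times the norm.\<close>
  define B where "B = sqrt (?n * ?n * \<bar>b\<bar>) + 1"
  show ?thesis
  proof
    show "B > 0" by (simp add: B_def add_nonneg_pos)
    fix y v assume y: "y \<in> K"
    have "v \<bullet> (g c y *v v) = (\<Sum>i\<in>UNIV. \<Sum>j\<in>UNIV. v $ i * (g c y $ i $ j * v $ j))"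
      by (simp add: inner_vec_def matrix_vector_mult_def sum_distrib_left)
    also have "\<dots> \<le> (\<Sum>i\<in>(UNIV::'n set). \<Sum>j\<in>(UNIV::'n set). \<bar>b\<bar> * (norm v)\<^sup>2)"
    proof (intro sum_mono)
      fix i j
      have g: "\<bar>g c y $ i $ j\<bar> \<le> \<bar>b\<bar>"
        using b[OF y] component_le_norm_cart[of "g c y $ i" j] Finite_Cartesian_Product.norm_nth_le[of "g c y" i] by linarith
      have "v $ i * (g c y $ i $ j * v $ j) \<le> \<bar>v $ i\<bar> * (\<bar>g c y $ i $ j\<bar> * \<bar>v $ j\<bar>)"
        by (metis abs_ge_self abs_mult)
      also have "\<dots> \<le> norm v * (\<bar>b\<bar> * norm v)"
        using g component_le_norm_cart[of v] by (intro mult_mono) auto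
      finally show "v $ i * (g c y $ i $ j * v $ j) \<le> \<bar>b\<bar> * (norm v)\<^sup>2"
        by (simp add: power2_eq_square mult_ac)
    qed
    also have "\<dots> = (?n * ?n * \<bar>b\<bar>) * (norm v)\<^sup>2" by simp
    also have "\<dots> \<le> B\<^sup>2 * (norm v)\<^sup>2"
    proof (rule mult_right_mono)
      have "?n * ?n * \<bar>b\<bar> = (sqrt (?n * ?n * \<bar>b\<bar>))\<^sup>2" by simp
      also have "\<dots> \<le> B\<^sup>2" unfolding B_def by (intro power_mono) auto
      finally show "?n * ?n * \<bar>b\<bar> \<le> B\<^sup>2" .
    qed simp
    finally show "v \<bullet> (g c y *v v) \<le> B\<^sup>2 * (norm v)\<^sup>2" .
  qed
qed

text \<open>The straight segment in coordinates stays in the convex set S, where its speed is at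
  most B times its Euclidean length. Its smoothness in the other charts comes from the transition
  maps.\<close>

lemma segment_curve:
  assumes c: "c \<in> max_atlas atl" and S: "convex S" "S \<subseteq> img c" and B: "B \<ge> 0" "\<And>y v. y \<in> S \<Longrightarrow> v \<bullet> (g c y *v v) \<le> B\<^sup>2 * (norm v)\<^sup>2"
    and y: "y0 \<in> S" "y1 \<in> S"
  obtains \<gamma> T where "regular \<gamma> T" "\<gamma> 0 = par c y0" "\<gamma> 1 = par c y1" "curve_length atl g \<gamma> \<le> ennreal (B * norm (y1 - y0))"
proof -
  note ch = chart_facts[OF max_is_chart[OF c]]
  define z where "z t = y0 + t *\<^sub>R (y1 - y0)" for t :: real
  define \<gamma> where "\<gamma> t = par c (z t)" for t
  have zS: "z t \<in> S" if "t \<in> {0..1}" for t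
    using convexD_alt[OF S(1) y, of t] that by (simp add: z_def algebra_simps)
  have zd: "(z has_vector_derivative (y1 - y0)) (at t)" for t
    unfolding z_def[abs_def] by (auto intro!: derivative_eq_intros)
  have zc: "continuous_on A z" for A unfolding z_def[abs_def] by (intro continuous_intros)
  have "\<exists>e>0. (snd d \<circ> \<gamma>) C1_differentiable_on {t - e<..<t + e}"
    if t: "t \<in> {0..1}" and d: "d \<in> atl" "\<gamma> t \<in> fst d" for t d
  proof -
    let ?W = "snd c ` (fst c \<inter> fst d)" and ?f = "trans_map c d"
    have W: "open ?W"
      by (rule open_snd_image[OF max_is_chart[OF c]])
        (use ch(1) chart_facts(1)[OF atl_is_chart[OF d(1)]] in auto)
    have "z t \<in> img c" using zS[OF t] S by blast
    then have "z t \<in> ?W" using d(2) ch(7,8)[of "z t"] by (metis IntI \<gamma>_def image_eqI)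
    moreover have "open (z -` ?W)" using W zc[of UNIV] by (rule open_vimage)
    ultimately obtain e where e: "e > 0" "\<And>s. \<bar>s - t\<bar> < e \<Longrightarrow> z s \<in> ?W"
      unfolding open_dist by (auto simp: dist_real_def vimage_def)
    have ze: "z s \<in> ?W" if "s \<in> {t - e<..<t + e}" for s using that by (intro e(2)) (auto simp: abs_less_iff)
    have sm: "smooth_on ?W ?f" by (rule trans_smooth(1)[OF c d(1)])
    have "(snd d \<circ> \<gamma>) C1_differentiable_on {t - e<..<t + e}"
      unfolding C1_differentiable_on_def
    proof (intro exI conjI ballI)
      fix s assume s: "s \<in> {t - e<..<t + e}"
      have "((\<lambda>s. ?f (z s)) has_vector_derivative frechet_derivative ?f (at (z s)) (y1 - y0)) (at s)"
        by (rule smooth_on_chain_vector_derivative[OF sm zd ze[OF s]])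
      \<comment> \<open>Expanded in partial derivatives, the velocity is visibly continuous in time,
        as \<open>C1_differentiable_on\<close> demands.\<close>
      also have "frechet_derivative ?f (at (z s)) (y1 - y0) = (\<Sum>i\<in>UNIV. (y1 - y0) $ i *\<^sub>R pd i ?f (z s))"
        by (rule frechet_derivative_pd[OF smooth_on_differentiable[OF sm ze[OF s]]])
      finally show "((snd d \<circ> \<gamma>) has_vector_derivative (\<Sum>i\<in>UNIV. (y1 - y0) $ i *\<^sub>R pd i ?f (z s))) (at s)"
        by (simp add: o_def \<gamma>_def[abs_def] trans_map_def)
    next
      have "continuous_on {t - e<..<t + e} (\<lambda>s. pd i ?f (z s))" for i
        using ze by (intro continuous_on_compose2[OF smooth_on_continuous[OF smooth_on_pd[OF sm]] zc]) blast
      then show "continuous_on {t - e<..<t + e} (\<lambda>s. \<Sum>i\<in>UNIV. (y1 - y0) $ i *\<^sub>R pd i ?f (z s))"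
        by (intro continuous_on_sum continuous_on_scaleR continuous_on_const)
    qed
    then show ?thesis using e by blast
  qed
  moreover have "continuous_on {0..1} \<gamma>"
    unfolding \<gamma>_def[abs_def] using zS S by (intro continuous_on_compose2[OF ch(4) zc]) blast
  ultimately have reg: "regular \<gamma> {0, 1}" unfolding regular_def by auto
  have "rspeed \<gamma> {0, 1} t \<le> B * norm (y1 - y0) * indicator {0..1} t" for t
  proof (cases "t \<in> {0..1} - {0, 1}")
    case True
    then have t: "0 < t" "t < 1" by auto
    then have zt: "z t \<in> S" using zS by simp
    have "((\<lambda>s. z s) has_vector_derivative (y1 - y0)) (at t)" by (rule zd)
    then have "((snd c \<circ> \<gamma>) has_vector_derivative (y1 - y0)) (at t)"
    proof (rule has_vector_derivative_transform_within_open)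
      show "open {0<..<1::real}" "t \<in> {0<..<1}" using t by auto
      fix s :: real assume "s \<in> {0<..<1}"
      then have "z s \<in> img c" using zS[of s] S by auto
      then show "z s = (snd c \<circ> \<gamma>) s" by (simp add: \<gamma>_def ch(7))
    qed
    moreover have "z t \<in> img c" using zt S by blast
    ultimately have "speed atl g \<gamma> t = sqrt ((y1 - y0) \<bullet> (g c (z t) *v (y1 - y0)))"
      using speed_eq[OF c regular_isCont[OF reg t], of "y1 - y0"] by (simp add: \<gamma>_def ch(7,8))
    also have "\<dots> \<le> sqrt (B\<^sup>2 * (norm (y1 - y0))\<^sup>2)"
      using B(2)[OF zt] by (rule real_sqrt_le_mono)
    also have "\<dots> = B * norm (y1 - y0)" using B(1) by (simp add: real_sqrt_mult)
    finally show ?thesis using True by (simp add: rspeed_def)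
  next
    case False
    then show ?thesis using B(1) by (simp add: rspeed_def)
  qed
  then have le: "rspeed \<gamma> {0, 1} t \<le> B * norm (y1 - y0) * indicator {0..1} t" for t .
  have "curve_length atl g \<gamma> \<le> (\<integral>\<^sup>+t. ennreal (B * norm (y1 - y0)) * indicator {0..1::real} t \<partial>lborel)"
    unfolding curve_length_eq[OF reg]
  proof (rule nn_integral_mono)
    fix t :: real
    show "ennreal (rspeed \<gamma> {0, 1} t) \<le> ennreal (B * norm (y1 - y0)) * indicator {0..1} t"
      using ennreal_leI[OF le[of t]] by (cases "t \<in> {0..1}") simp_all
  qed
  also have "\<dots> = ennreal (B * norm (y1 - y0))" by (simp add: nn_integral_cmult_indicator)
  finally show ?thesis
    by (intro that[OF reg]) (auto simp: \<gamma>_def z_def)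
qed

section \<open>Openness of balls and finiteness of the distance\<close>

lemma chart_nbhd:
  obtains c r B where "c \<in> max_atlas atl" "y \<in> fst c" "r > 0" "ball (snd c y) r \<subseteq> img c" "B > 0"
    "\<And>z v. z \<in> ball (snd c y) r \<Longrightarrow> v \<bullet> (g c z *v v) \<le> B\<^sup>2 * (norm v)\<^sup>2"
proof -
  obtain c where c: "c \<in> atl" "y \<in> fst c" using atl_cover by blast
  note ch = chart_facts[OF atl_is_chart[OF c(1)]]
  obtain r where r: "r > 0" "cball (snd c y) r \<subseteq> img c"
    using ch(2) ch(6)[OF c(2)] open_contains_cball by blast
  obtain B where B: "B > 0" "\<And>z v. z \<in> cball (snd c y) r \<Longrightarrow> v \<bullet> (g c z *v v) \<le> B\<^sup>2 * (norm v)\<^sup>2"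
    using metric_bounded[OF atl_max[OF c(1)] compact_cball r(2)] by blast
  show ?thesis
    using r B by (intro that[OF atl_max[OF c(1)] c(2) r(1) _ B(1)]) (auto intro: less_imp_le)
qed

lemma extend_curve:
  assumes c: "c \<in> max_atlas atl" and r: "ball (snd c y) r \<subseteq> img c" and B: "B > 0"
    "\<And>z v. z \<in> ball (snd c y) r \<Longrightarrow> v \<bullet> (g c z *v v) \<le> B\<^sup>2 * (norm v)\<^sup>2"
    and z: "z0 \<in> ball (snd c y) r" "z1 \<in> ball (snd c y) r"
    and \<gamma>: "pw_C1_curve atl \<gamma>" "\<gamma> 0 = x" "\<gamma> 1 = par c z0"
  obtains \<beta> where "pw_C1_curve atl \<beta>" "\<beta> 0 = x" "\<beta> 1 = par c z1"
    "curve_length atl g \<beta> \<le> curve_length atl g \<gamma> + ennreal (B * norm (z1 - z0))"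
proof -
  obtain T where T: "regular \<gamma> T" using \<gamma> pw_C1_curve_iff_regular by blast
  obtain \<sigma> T' where \<sigma>: "regular \<sigma> T'" "\<sigma> 0 = par c z0" "\<sigma> 1 = par c z1"
    "curve_length atl g \<sigma> \<le> ennreal (B * norm (z1 - z0))"
    by (rule segment_curve[OF c convex_ball r less_imp_le[OF B(1)] B(2) z])
  have j: "\<gamma> 1 = \<sigma> 0" using \<gamma> \<sigma> by simp
  show ?thesis
  proof (rule that[of "\<gamma> +++ \<sigma>"])
    show "pw_C1_curve atl (\<gamma> +++ \<sigma>)" using regular_join(1)[OF T \<sigma>(1) j] pw_C1_curve_iff_regular by blast
    show "(\<gamma> +++ \<sigma>) 0 = x" "(\<gamma> +++ \<sigma>) 1 = par c z1" using \<gamma> \<sigma> by (simp_all add: joinpaths_def)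
    show "curve_length atl g (\<gamma> +++ \<sigma>) \<le> curve_length atl g \<gamma> + ennreal (B * norm (z1 - z0))"
      using regular_join(2)[OF T \<sigma>(1) j] \<sigma>(4) by (meson add_left_mono order_trans)
  qed
qed

text \<open>The infimum inside \<open>riem_dist\<close> before its conversion to a real number, so
  that an infinite value is still visible.\<close>

definition dist_inf :: "'m \<Rightarrow> 'm \<Rightarrow> ennreal" where
  "dist_inf x y = (INF \<gamma>\<in>{\<gamma>. pw_C1_curve atl \<gamma> \<and> \<gamma> 0 = x \<and> \<gamma> 1 = y}. curve_length atl g \<gamma>)"

lemma dist_inf_less_iff:
  "dist_inf x y < s \<longleftrightarrow> (\<exists>\<gamma>. pw_C1_curve atl \<gamma> \<and> \<gamma> 0 = x \<and> \<gamma> 1 = y \<and> curve_length atl g \<gamma> < s)"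
  by (auto simp: dist_inf_def INF_less_iff)

text \<open>A curve of length below s leaves room for a short segment in a chart about its endpoint,
  so all points near the endpoint are reached by curves of length below s.\<close>

lemma open_dist_inf_less: "open {y. dist_inf x y < s}"
proof (subst open_subopen, intro ballI)
  fix y assume "y \<in> {y. dist_inf x y < s}"
  then obtain \<gamma> where \<gamma>: "pw_C1_curve atl \<gamma>" "\<gamma> 0 = x" "\<gamma> 1 = y" "curve_length atl g \<gamma> < s"
    by (auto simp: dist_inf_less_iff)
  obtain c r B where c: "c \<in> max_atlas atl" "y \<in> fst c" "r > 0" "ball (snd c y) r \<subseteq> img c" "B > 0"
    "\<And>z v. z \<in> ball (snd c y) r \<Longrightarrow> v \<bullet> (g c z *v v) \<le> B\<^sup>2 * (norm v)\<^sup>2"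
    using chart_nbhd by metis
  note ch = chart_facts[OF max_is_chart[OF c(1)]]
  have "\<exists>e>0. curve_length atl g \<gamma> + ennreal e < s"
  proof -
    obtain q where q: "curve_length atl g \<gamma> < q" "q < s" using dense \<gamma>(4) by blast
    show ?thesis
    proof (cases q)
      case (real q')
      obtain l where l: "curve_length atl g \<gamma> = ennreal l" "l \<ge> 0"
        using q(1) by (cases "curve_length atl g \<gamma>") auto
      have "l < q'" using q(1) l real by (simp add: ennreal_less_iff)
      moreover have "curve_length atl g \<gamma> + ennreal (q' - l) = q"
        using l real \<open>l < q'\<close> by (simp add: ennreal_plus[symmetric] del: ennreal_plus)
      ultimately show ?thesis using q(2) by (intro exI[of _ "q' - l"]) auto
    qed (use q in auto)
  qed
  then obtain e where e: "e > 0" "curve_length atl g \<gamma> + ennreal e < s" by blast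
  \<comment> \<open>Segments from the centre of the ball of radius r' have length at most B * r',
    hence at most e.\<close>
  define r' where "r' = min r (e / B)"
  have r': "r' > 0" "r' \<le> r" "B * r' \<le> e" using c e by (auto simp: r'_def min_def field_simps)
  let ?U = "par c ` ball (snd c y) r'"
  have sub: "ball (snd c y) r' \<subseteq> img c" using c(4) r'(2) subset_ball by blast
  have "open ?U" by (rule open_par_image[OF max_is_chart[OF c(1)] open_ball sub])
  moreover have "y \<in> ?U" using ch(5)[OF c(2)] r'(1) by (metis centre_in_ball image_eqI)
  moreover have "?U \<subseteq> {y. dist_inf x y < s}"
  proof clarify
    fix z assume z: "z \<in> ball (snd c y) r'"
    have z0: "snd c y \<in> ball (snd c y) r" "z \<in> ball (snd c y) r" using c(3) z r'(2) by auto
    have "\<gamma> 1 = par c (snd c y)" using \<gamma>(3) ch(5)[OF c(2)] by simp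
    from extend_curve[OF c(1) c(4) c(5,6) z0 \<gamma>(1,2) this]
    obtain \<beta> where \<beta>: "pw_C1_curve atl \<beta>" "\<beta> 0 = x" "\<beta> 1 = par c z"
      "curve_length atl g \<beta> \<le> curve_length atl g \<gamma> + ennreal (B * norm (z - snd c y))" by blast
    have "norm (z - snd c y) \<le> r'" using z by (simp add: dist_norm norm_minus_commute)
    then have "B * norm (z - snd c y) \<le> B * r'" using c(5) by (simp add: mult_left_mono)
    then have "B * norm (z - snd c y) \<le> e" using r'(3) by linarith
    then have "curve_length atl g \<beta> \<le> curve_length atl g \<gamma> + ennreal e"
      using \<beta>(4) by (meson add_left_mono ennreal_leI order_trans)
    then have "curve_length atl g \<beta> < s" using e(2) by (rule le_less_trans)
    then show "dist_inf x (par c z) < s" using \<beta> dist_inf_less_iff by blast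
  qed
  ultimately show "\<exists>T. open T \<and> y \<in> T \<and> T \<subseteq> {y. dist_inf x y < s}" by blast
qed

text \<open>Without this \<open>riem_dist\<close> would be the junk value 0 for points not joined by a curve of
  finite length.\<close>

lemma dist_inf_finite:
  assumes "connected (UNIV :: 'm set)"
  shows "dist_inf x y < \<infinity>"
proof -
  let ?S = "{y. dist_inf x y < \<infinity>}"
  \<comment> \<open>A curve of finite length to a point near y could be prolonged by a segment back
    to y. Hence the set of points at finite distance and its complement are both open, and
    connectedness decides.\<close>
  have "open (- ?S)"
  proof (subst open_subopen, intro ballI)
    fix y assume y: "y \<in> - ?S"
    obtain c r B where c: "c \<in> max_atlas atl" "y \<in> fst c" "r > 0" "ball (snd c y) r \<subseteq> img c" "B > 0"
      "\<And>z v. z \<in> ball (snd c y) r \<Longrightarrow> v \<bullet> (g c z *v v) \<le> B\<^sup>2 * (norm v)\<^sup>2"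
      using chart_nbhd by metis
    note ch = chart_facts[OF max_is_chart[OF c(1)]]
    let ?U = "par c ` ball (snd c y) r"
    have "open ?U" by (rule open_par_image[OF max_is_chart[OF c(1)] open_ball c(4)])
    moreover have "y \<in> ?U" using ch(5)[OF c(2)] c(3) by (metis centre_in_ball image_eqI)
    moreover have "?U \<subseteq> - ?S"
    proof clarify
      fix z assume z: "z \<in> ball (snd c y) r" "dist_inf x (par c z) < \<infinity>"
      then obtain \<gamma> where \<gamma>: "pw_C1_curve atl \<gamma>" "\<gamma> 0 = x" "\<gamma> 1 = par c z" "curve_length atl g \<gamma> < \<infinity>"
        by (auto simp: dist_inf_less_iff)
      have y0: "snd c y \<in> ball (snd c y) r" using c(3) by simp
      from extend_curve[OF c(1) c(4) c(5,6) z(1) y0 \<gamma>(1-3)]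
      obtain \<beta> where \<beta>: "pw_C1_curve atl \<beta>" "\<beta> 0 = x" "\<beta> 1 = par c (snd c y)"
        "curve_length atl g \<beta> \<le> curve_length atl g \<gamma> + ennreal (B * norm (snd c y - z))" by blast
      have "curve_length atl g \<gamma> + ennreal (B * norm (snd c y - z)) < \<infinity>" using \<gamma>(4) by simp
      then have "curve_length atl g \<beta> < \<infinity>" using \<beta>(4) by (rule le_less_trans[rotated])
      then have "dist_inf x (par c (snd c y)) < \<infinity>" using \<beta> dist_inf_less_iff by blast
      then show False using y ch(5)[OF c(2)] by simp
    qed
    ultimately show "\<exists>T. open T \<and> y \<in> T \<and> T \<subseteq> - ?S" by blast
  qed
  moreover have "open ?S" by (rule open_dist_inf_less)
  moreover have "x \<in> ?S"
  proof -
    obtain c r B where c: "c \<in> max_atlas atl" "x \<in> fst c" "r > 0" "ball (snd c x) r \<subseteq> img c" "B > 0"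
      "\<And>z v. z \<in> ball (snd c x) r \<Longrightarrow> v \<bullet> (g c z *v v) \<le> B\<^sup>2 * (norm v)\<^sup>2"
      using chart_nbhd by metis
    have x0: "snd c x \<in> ball (snd c x) r" using c(3) by simp
    obtain \<sigma> T' where \<sigma>: "regular \<sigma> T'" "\<sigma> 0 = par c (snd c x)" "\<sigma> 1 = par c (snd c x)"
      "curve_length atl g \<sigma> \<le> ennreal (B * norm (snd c x - snd c x))"
      by (rule segment_curve[OF c(1) convex_ball c(4) less_imp_le[OF c(5)] c(6) x0 x0])
    then have "curve_length atl g \<sigma> < \<infinity>" by (auto intro: le_less_trans)
    then show ?thesis
      using \<sigma> pw_C1_curve_iff_regular chart_facts(5)[OF max_is_chart[OF c(1)] c(2)] dist_inf_less_iff
      by (metis mem_Collect_eq)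
  qed
  ultimately have "- ?S = {}"
    using connectedD[OF assms, of ?S "- ?S"] by blast
  then show ?thesis by blast
qed

lemma riem_dist_less_iff:
  assumes "connected (UNIV :: 'm set)" and "s > 0"
  shows "riem_dist atl g x y < s \<longleftrightarrow> dist_inf x y < ennreal s"
proof -
  obtain q where q: "dist_inf x y = ennreal q" "q \<ge> 0"
    using dist_inf_finite[OF assms(1), of x y] by (cases "dist_inf x y") auto
  have "riem_dist atl g x y = q"
    using q by (simp add: riem_dist_def dist_inf_def[symmetric])
  then show ?thesis using q by (simp add: ennreal_less_iff)
qed

text \<open>Openness makes the ball in the final decomposition a Borel set, so that its indicator
  can serve in a density.\<close>

lemma open_riem_ball:
  assumes "connected (UNIV :: 'm set)"
  shows "open {y. riem_dist atl g x y < s}"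
proof (cases "s > 0")
  case True
  then show ?thesis using riem_dist_less_iff[OF assms] open_dist_inf_less by simp
next
  case False
  then have "{y. riem_dist atl g x y < s} = {}"
    by (auto simp: riem_dist_def not_less intro: order_trans[OF _ enn2real_nonneg])
  then show ?thesis by simp
qed

section \<open>Lower bounds for the distance in coordinates\<close>

lemma metric_lower:
  assumes c: "c \<in> max_atlas atl" and K: "compact K" "K \<subseteq> img c"
  obtains l where "l > 0" "\<And>y v. y \<in> K \<Longrightarrow> l\<^sup>2 * (norm v)\<^sup>2 \<le> v \<bullet> (g c y *v v)"
proof (cases "K = {}")
  case True
  then show ?thesis by (intro that[of 1]) auto
next
  case False
  \<comment> \<open>By homogeneity in v it suffices to minimise the quadratic form over the compact
    product of K with the unit sphere, where it is positive.\<close>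
  let ?F = "\<lambda>p. snd p \<bullet> (g c (fst p) *v snd p)"
  let ?S = "K \<times> sphere 0 (1::real)"
  have "sphere 0 1 \<noteq> ({} :: (real^'n) set)" by (simp add: sphere_eq_empty)
  then have ne: "?S \<noteq> ({} :: ((real^'n) \<times> (real^'n)) set)" using False by auto
  have ct: "continuous_on (?S :: ((real^'n) \<times> (real^'n)) set) ?F"
  proof (rule continuous_quadratic)
    show "continuous_on ?S (\<lambda>p. g c (fst p))"
      using K(2) by (intro continuous_on_compose2[OF smooth_on_continuous[OF metric_smooth[OF c]]] continuous_intros) auto
  qed (intro continuous_intros)
  obtain p where p: "p \<in> ?S" "\<And>q. q \<in> ?S \<Longrightarrow> ?F p \<le> ?F q"
    using continuous_attains_inf[OF compact_Times[OF K(1) compact_sphere] ne ct] by blast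
  have "snd p \<noteq> 0" using p(1) by auto
  then have pos: "?F p > 0" using metric_pos[OF c] p(1) K(2) by auto
  show ?thesis
  proof (rule that[of "sqrt (?F p)"])
    show "sqrt (?F p) > 0" using pos by simp
    fix y and v :: "real^'n" assume y: "y \<in> K"
    show "(sqrt (?F p))\<^sup>2 * (norm v)\<^sup>2 \<le> v \<bullet> (g c y *v v)"
    proof (cases "v = 0")
      case False
      let ?u = "inverse (norm v) *\<^sub>R v"
      have "?F p \<le> ?F (y, ?u)" using y False by (intro p(2)) simp
      also have "\<dots> = (inverse (norm v))\<^sup>2 * (v \<bullet> (g c y *v v))"
        by (simp add: matrix_vector_mult_scaleR power2_eq_square)
      finally have "?F p * (norm v)\<^sup>2 \<le> (inverse (norm v))\<^sup>2 * (v \<bullet> (g c y *v v)) * (norm v)\<^sup>2"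
        by (rule mult_right_mono) simp
      also have "\<dots> = v \<bullet> (g c y *v v)" using False by (simp add: power_inverse)
      finally show ?thesis using pos by simp
    qed simp
  qed
qed

text \<open>If y is not in the image of the open box, every curve to y leaves this image. Up to the
  first exit its cube coordinates stay in K, where their velocity is at most \<Lambda> times the
  Riemannian speed. At the exit some coordinate has moved by at least r, so the length is at least r
  / \<Lambda>.\<close>

lemma dist_lower:
  fixes f \<phi> :: "real^'n \<Rightarrow> real^'n"
  assumes conn: "connected (UNIV :: 'm set)" and c: "c \<in> max_atlas atl"
    and Q: "continuous_on Q \<phi>" "\<phi> ` Q \<subseteq> img c" "open (\<phi> ` Q)"
    and f: "smooth_on (\<phi> ` Q) f" "\<And>w. w \<in> Q \<Longrightarrow> f (\<phi> w) = w"
    and K: "compact K" "K \<subseteq> Q"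
  obtains \<Lambda> where "\<Lambda> > 0" "\<And>w r y. r > 0 \<Longrightarrow> {z. \<forall>i. \<bar>z $ i - w $ i\<bar> \<le> r} \<subseteq> K \<Longrightarrow>
    riem_dist atl g (par c (\<phi> w)) y < r / \<Lambda> \<Longrightarrow> \<exists>z. (\<forall>i. \<bar>z $ i - w $ i\<bar> < r) \<and> y = par c (\<phi> z)"
proof -
  note ch = chart_facts[OF max_is_chart[OF c]]
  have cK: "compact (\<phi> ` K)" using compact_continuous_image K Q(1) continuous_on_subset by blast
  obtain L where L: "L > 0" "\<And>y v. y \<in> \<phi> ` K \<Longrightarrow> norm (frechet_derivative f (at y) v) \<le> L * norm v"
    using smooth_on_derivative_bounded[OF f(1) cK] K(2) by blast
  obtain l where l: "l > 0" "\<And>y v. y \<in> \<phi> ` K \<Longrightarrow> l\<^sup>2 * (norm v)\<^sup>2 \<le> v \<bullet> (g c y *v v)"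
    using metric_lower[OF c cK] K(2) Q(2) by blast
  \<comment> \<open>L bounds the passage from chart to cube coordinates, 1 / l that from Riemannian
    to Euclidean length in the chart.\<close>
  define \<Lambda> where "\<Lambda> = L / l"
  have \<Lambda>: "\<Lambda> > 0" using L l by (simp add: \<Lambda>_def)
  define P where "P z = par c (\<phi> z)" for z
  have Pinv: "f (snd c (P z)) = z" "snd c (P z) = \<phi> z" "P z \<in> fst c" if "z \<in> Q" for z
    using ch(7,8)[of "\<phi> z"] f(2)[OF that] Q(2) that by (auto simp: P_def)
  have cf: "continuous_on (\<phi> ` Q) f" by (rule smooth_on_continuous[OF f(1)])
  have openP: "open (P ` V)" if V: "open V" "V \<subseteq> Q" for V
  proof -
    have "\<phi> ` V = \<phi> ` Q \<inter> f -` V" using f(2) V(2) by force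
    then have "open (\<phi> ` V)" using continuous_open_preimage[OF cf Q(3) V(1)] by simp
    then have "open (par c ` \<phi> ` V)" using V(2) Q(2) by (intro open_par_image[OF max_is_chart[OF c]]) auto
    then show ?thesis by (simp add: P_def image_image)
  qed
  have cP: "continuous_on Q P" unfolding P_def[abs_def] using continuous_on_compose2[OF ch(4) Q(1,2)] .
  show ?thesis
  proof (rule that[OF \<Lambda>])
    fix w :: "real^'n" and r :: real and y
    assume r: "r > 0" and sub: "{z. \<forall>i. \<bar>z $ i - w $ i\<bar> \<le> r} \<subseteq> K"
      and d: "riem_dist atl g (par c (\<phi> w)) y < r / \<Lambda>"
    define CB where "CB = {z. \<forall>i. \<bar>z $ i - w $ i\<bar> \<le> r}"
    define OB where "OB = {z. \<forall>i. \<bar>z $ i - w $ i\<bar> < r}"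
    have CBQ: "CB \<subseteq> Q" "CB \<subseteq> K" using sub K(2) by (auto simp: CB_def)
    have OBCB: "OB \<subseteq> CB" by (auto simp: OB_def CB_def intro: less_imp_le)
    have wOB: "w \<in> OB" using r by (simp add: OB_def)
    have "0 < r / \<Lambda>" using r \<Lambda> by simp
    then have "dist_inf (P w) y < ennreal (r / \<Lambda>)"
      using d riem_dist_less_iff[OF conn] by (simp add: P_def)
    then obtain \<gamma> where \<gamma>: "pw_C1_curve atl \<gamma>" "\<gamma> 0 = P w" "\<gamma> 1 = y" "curve_length atl g \<gamma> < ennreal (r / \<Lambda>)"
      by (auto simp: dist_inf_less_iff)
    obtain T where T: "regular \<gamma> T" using \<gamma>(1) pw_C1_curve_iff_regular by blast
    have c\<gamma>: "continuous_on {0..1} \<gamma>" "finite T" using T by (auto simp: regular_def)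
    show "\<exists>z. (\<forall>i. \<bar>z $ i - w $ i\<bar> < r) \<and> y = par c (\<phi> z)"
    proof (rule ccontr)
      assume no: "\<not> ?thesis"
      have "closed CB" unfolding CB_def by (intro closed_Collect_all closed_Collect_le continuous_intros)
      then have "compact CB" using K(1) CBQ(2) by (metis Int_absorb1 compact_Int_closed)
      then have clPCB: "closed (P ` CB)"
        using cP CBQ(1) by (meson compact_continuous_image compact_imp_closed continuous_on_subset)
      have "open OB"
      proof -
        have "OB = (\<Inter>i. {z. \<bar>z $ i - w $ i\<bar> < r})" by (auto simp: OB_def)
        moreover have "open {z. \<bar>z $ i - w $ i\<bar> < r}" for i
          by (intro open_Collect_less continuous_intros)
        ultimately show ?thesis by (simp add: open_INT)
      qed
      then have oU: "open (P ` OB)" using openP OBCB CBQ(1) by auto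
      \<comment> \<open>The times at which the curve is outside the image of the open box; this set
        is closed, so its infimum t0 is the first exit time.\<close>
      define E where "E = {0..1} \<inter> \<gamma> -` (- P ` OB)"
      have clE: "closed E" unfolding E_def
        using oU by (intro continuous_closed_preimage c\<gamma>(1)) auto
      have "1 \<in> E" using no \<gamma>(3) by (auto simp: E_def OB_def P_def)
      define t0 where "t0 = Inf E"
      have bE: "bdd_below E" by (rule bdd_belowI[of _ 0]) (auto simp: E_def)
      have t0E: "t0 \<in> E" unfolding t0_def using clE \<open>1 \<in> E\<close> bE by (intro closed_contains_Inf) auto
      have t01: "0 \<le> t0" "t0 \<le> 1" using t0E by (auto simp: E_def)
      have "0 \<notin> E" using \<gamma>(2) wOB by (auto simp: E_def)
      then have t0: "0 < t0" using t0E t01 by (cases "t0 = 0") auto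
      have before: "\<gamma> t \<in> P ` OB" if "0 \<le> t" "t < t0" for t
      proof (rule ccontr)
        assume "\<gamma> t \<notin> P ` OB"
        then have "t \<in> E" using that t01 by (simp add: E_def)
        then have "t0 \<le> t" unfolding t0_def by (rule cInf_lower[OF _ bE])
        then show False using that by simp
      qed
      \<comment> \<open>At t0 the curve has left the open box but, by closedness, still lies in the
        image of the closed one, so its cube coordinates make sense on all of {0..t0}.\<close>
      have inCB: "\<gamma> t \<in> P ` CB" if "t \<in> {0..t0}" for t
      proof -
        have "closed ({0..t0} \<inter> \<gamma> -` (P ` CB))"
          using c\<gamma>(1) t01 clPCB by (intro continuous_closed_preimage) (auto intro: continuous_on_subset)
        moreover have "{0<..<t0} \<subseteq> {0..t0} \<inter> \<gamma> -` (P ` CB)"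
        proof
          fix t assume "t \<in> {0<..<t0}"
          then have "t \<in> {0..t0}" "\<gamma> t \<in> P ` OB" using before[of t] by auto
          then show "t \<in> {0..t0} \<inter> \<gamma> -` (P ` CB)" using image_mono[OF OBCB, of P] by blast
        qed
        ultimately have "closure {0<..<t0} \<subseteq> {0..t0} \<inter> \<gamma> -` (P ` CB)" by (rule closure_minimal[rotated])
        then show ?thesis using that t0 by auto
      qed
      define \<zeta> where "\<zeta> t = f (snd c (\<gamma> t))" for t
      have \<zeta>: "\<zeta> t \<in> CB" "\<gamma> t = P (\<zeta> t)" "snd c (\<gamma> t) = \<phi> (\<zeta> t)" "\<gamma> t \<in> fst c" if t: "t \<in> {0..t0}" for t
      proof -
        obtain z where z: "z \<in> CB" "\<gamma> t = P z" using inCB[OF t] by blast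
        then have "z \<in> Q" using CBQ by blast
        then show "\<zeta> t \<in> CB" "\<gamma> t = P (\<zeta> t)" "snd c (\<gamma> t) = \<phi> (\<zeta> t)" "\<gamma> t \<in> fst c"
          using z Pinv[of z] by (auto simp: \<zeta>_def)
      qed
      have "\<zeta> t0 \<notin> OB"
        using t0E \<zeta>(2)[of t0] t01 by (auto simp: E_def)
      then obtain i where i: "r \<le> \<bar>\<zeta> t0 $ i - w $ i\<bar>" by (auto simp: OB_def not_less)
      have "\<zeta> 0 = w" using \<gamma>(2) Pinv(1)[of w] wOB OBCB CBQ by (auto simp: \<zeta>_def)
      then have ge: "r \<le> norm (\<zeta> t0 - \<zeta> 0)"
        using i component_le_norm_cart[of "\<zeta> t0 - \<zeta> 0" i] by simp
      have c\<zeta>: "continuous_on {0..t0} \<zeta>"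
        unfolding \<zeta>_def[abs_def]
      proof (rule continuous_on_compose2[OF cf])
        show "continuous_on {0..t0} (\<lambda>t. snd c (\<gamma> t))"
          using c\<gamma>(1) t01 \<zeta>(4) by (intro continuous_on_compose2[OF ch(3)]) (auto intro: continuous_on_subset)
        show "(\<lambda>t. snd c (\<gamma> t)) ` {0..t0} \<subseteq> \<phi> ` Q"
          using \<zeta>(1,3) CBQ(1) by blast
      qed
      have der: "\<exists>u. (\<zeta> has_vector_derivative u) (at t) \<and> norm u \<le> \<Lambda> * rspeed \<gamma> T t" if t: "t \<in> {0<..<t0} - T" for t
      proof -
        have t': "t \<in> {0..1} - T" "t \<in> {0..t0}" using t t01 by auto
        obtain v where v: "((snd c \<circ> \<gamma>) has_vector_derivative v) (at t)"
          by (rule regular_derivative[OF T t'(1) c \<zeta>(4)[OF t'(2)]])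
        have K': "(snd c \<circ> \<gamma>) t \<in> \<phi> ` K" "(snd c \<circ> \<gamma>) t \<in> \<phi> ` Q" using \<zeta>(1,3)[OF t'(2)] CBQ by auto
        have "speed atl g \<gamma> t = sqrt (v \<bullet> (g c (snd c (\<gamma> t)) *v v))"
          using regular_isCont[OF T] regular_in[OF T t'(1)] by (intro speed_eq[OF c _ \<zeta>(4)[OF t'(2)] v]) auto
        moreover have "sqrt (l\<^sup>2 * (norm v)\<^sup>2) \<le> sqrt (v \<bullet> (g c (snd c (\<gamma> t)) *v v))"
          using l(2)[OF K'(1), of v] by (intro real_sqrt_le_mono) simp
        ultimately have sp: "l * norm v \<le> rspeed \<gamma> T t"
          using t' l(1) by (simp add: rspeed_def real_sqrt_mult)
        have "norm (frechet_derivative f (at ((snd c \<circ> \<gamma>) t)) v) \<le> L * norm v" by (rule L(2)[OF K'(1)])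
        also have "\<dots> = \<Lambda> * (l * norm v)" using l(1) by (simp add: \<Lambda>_def)
        also have "\<dots> \<le> \<Lambda> * rspeed \<gamma> T t" using sp \<Lambda> by (intro mult_left_mono) auto
        finally have "norm (frechet_derivative f (at ((snd c \<circ> \<gamma>) t)) v) \<le> \<Lambda> * rspeed \<gamma> T t" .
        moreover have "(\<zeta> has_vector_derivative frechet_derivative f (at ((snd c \<circ> \<gamma>) t)) v) (at t)"
          using smooth_on_chain_vector_derivative[OF f(1) v K'(2)] by (simp add: \<zeta>_def[abs_def])
        ultimately show ?thesis by blast
      qed
      \<comment> \<open>Set to zero at exceptional times, so that the bound by the speed holds
        everywhere and the integrals can be compared directly.\<close>
      define D where "D t = (if t \<in> {0<..<t0} - T then vector_derivative \<zeta> (at t) else 0)" for t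
      have D: "(\<zeta> has_vector_derivative D t) (at t)" "norm (D t) \<le> \<Lambda> * rspeed \<gamma> T t" if "t \<in> {0<..<t0} - T" for t
        using der[OF that] that by (auto simp: D_def vector_derivative_at)
      have Dle: "norm (D t) \<le> \<Lambda> * rspeed \<gamma> T t" for t
        using D(2)[of t] rspeed_nonneg[OF T, of t] \<Lambda> by (cases "t \<in> {0<..<t0} - T") (simp_all add: D_def)
      have HD: "(D has_integral (\<zeta> t0 - \<zeta> 0)) {0..t0}"
        by (rule fundamental_theorem_of_calculus_interior_strong[OF c\<gamma>(2) t01(1) D(1) c\<zeta>])
      have fin: "(\<integral>\<^sup>+t. ennreal (rspeed \<gamma> T t) \<partial>lborel) < ennreal (r / \<Lambda>)"
        using \<gamma>(4) curve_length_eq[OF T] by simp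
      have int: "integrable lborel (rspeed \<gamma> T)"
        using rspeed_measurable[OF T] rspeed_nonneg[OF T] fin
        by (intro integrableI_nonneg) (auto intro: less_trans)
      have "ennreal (integral\<^sup>L lborel (rspeed \<gamma> T)) < ennreal (r / \<Lambda>)"
        using fin rspeed_nonneg[OF T] by (simp add: nn_integral_eq_integral[OF int])
      then have lt: "integral\<^sup>L lborel (rspeed \<gamma> T) < r / \<Lambda>"
        using rspeed_nonneg[OF T] by (subst (asm) ennreal_less_iff) auto
      have hi: "(rspeed \<gamma> T has_integral integral\<^sup>L lborel (rspeed \<gamma> T)) UNIV"
        by (rule has_integral_integral_lborel[OF int])
      then have iU: "rspeed \<gamma> T integrable_on UNIV" by blast
      then have iI: "rspeed \<gamma> T integrable_on {0..t0}" by (rule integrable_on_subinterval) auto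
      have "integral {0..t0} (rspeed \<gamma> T) \<le> integral UNIV (rspeed \<gamma> T)"
        using rspeed_nonneg[OF T] by (intro integral_subset_le iI iU) auto
      also have "\<dots> = integral\<^sup>L lborel (rspeed \<gamma> T)" using hi by (rule integral_unique)
      finally have Ile: "integral {0..t0} (rspeed \<gamma> T) < r / \<Lambda>" using lt by linarith
      have "norm (\<zeta> t0 - \<zeta> 0) = norm (integral {0..t0} D)" using HD by (simp add: integral_unique)
      also have "\<dots> \<le> integral {0..t0} (\<lambda>t. \<Lambda> * rspeed \<gamma> T t)"
        using HD iI Dle by (intro integral_norm_bound_integral integrable_on_mult_right) auto
      also have "\<dots> = \<Lambda> * integral {0..t0} (rspeed \<gamma> T)" by simp
      also have "\<dots> < \<Lambda> * (r / \<Lambda>)" using Ile \<Lambda> by (rule mult_strict_left_mono)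
      also have "\<dots> = r" using \<Lambda> by simp
      finally show False using ge by simp
    qed
  qed
qed

end

section \<open>Riemannian volume in cube coordinates\<close>

lemma continuous_on_det:
  fixes G :: "'a::topological_space \<Rightarrow> real^'n::finite^'n"
  assumes "continuous_on S G"
  shows "continuous_on S (\<lambda>y. det (G y))"
  unfolding det_def using assms by (intro continuous_intros)

context riemannian
begin

text \<open>\<open>vol\<close> is given by densities in atlas charts. Near a point of K the passage
  from cube coordinates to such a chart is Lipschitz, so the image of a cube of side s lies in a box
  whose side is a fixed multiple of s, and its volume is at most a constant times the Lebesgue
  measure of the cube. Pulling the volume back to a measure on the coordinate space lets
  \<open>emeasure_le_of_small_cubes\<close> extend this to Borel sets.\<close>

lemma volume_bounded:
  fixes f \<phi> :: "real^'n \<Rightarrow> real^'n"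
  assumes vol: "riemannian_volume atl g vol" and c: "c \<in> max_atlas atl"
    and Q: "open Q" "smooth_on Q \<phi>" "\<phi> ` Q \<subseteq> img c" "open (\<phi> ` Q)"
    and f: "continuous_on (\<phi> ` Q) f" "\<And>w. w \<in> Q \<Longrightarrow> f (\<phi> w) = w"
    and K: "compact K" "K \<subseteq> Q"
  obtains C where "C > 0" "\<And>E. E \<in> sets borel \<Longrightarrow> E \<subseteq> K \<Longrightarrow>
    (\<lambda>w. par c (\<phi> w)) ` E \<in> sets borel \<and> emeasure vol ((\<lambda>w. par c (\<phi> w)) ` E) \<le> ennreal C * emeasure lborel E"
proof -
  note ch = chart_facts[OF max_is_chart[OF c]]
  define P where "P z = par c (\<phi> z)" for z
  have Pinv: "f (snd c (P z)) = z" "snd c (P z) = \<phi> z" "P z \<in> fst c" if "z \<in> Q" for z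
    using ch(7,8)[of "\<phi> z"] f(2)[OF that] Q(3) that by (auto simp: P_def)
  have c\<phi>: "continuous_on Q \<phi>" by (rule smooth_on_continuous[OF Q(2)])
  have cP: "continuous_on Q P" unfolding P_def[abs_def] using continuous_on_compose2[OF ch(4) c\<phi> Q(3)] .
  have svol: "sets vol = sets borel" using vol by (simp add: riemannian_volume_def)
  have cPK: "closed (P ` K)"
    using cP K by (meson compact_continuous_image compact_imp_closed continuous_on_subset)
  \<comment> \<open>A Borel inverse of P on the compact image of K. Its dummy value 0 elsewhere does
    no harm, as the measure pushed forward below is restricted to that image.\<close>
  define p where "p x = (if x \<in> P ` K then f (snd c x) else 0)" for x
  have mp: "p \<in> borel_measurable borel"
    unfolding p_def[abs_def]
  proof (rule borel_measurable_continuous_on_if)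
    show "continuous_on (P ` K) (\<lambda>x. f (snd c x))"
    proof (rule continuous_on_compose2[OF f(1)])
      show "continuous_on (P ` K) (snd c)"
        using Pinv(3) K(2) by (intro continuous_on_subset[OF ch(3)]) auto
      show "snd c ` P ` K \<subseteq> \<phi> ` Q" using Pinv(2) K(2) by force
    qed
  qed (use cPK in auto)
  have PE: "P ` (K \<inter> E) = P ` K \<inter> p -` E" for E
  proof -
    have "p (P z) = z" if "z \<in> K" for z
      using Pinv(1)[of z] that K(2) by (auto simp: p_def)
    then show ?thesis by force
  qed
  have PEb: "P ` (K \<inter> E) \<in> sets borel" if "E \<in> sets borel" for E
    unfolding PE using measurable_sets[OF mp that] cPK by auto
  define \<nu> where "\<nu> = distr (density vol (indicator (P ` K))) borel p"
  have mp': "p \<in> borel_measurable (density vol (indicator (P ` K)))"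
    using mp svol by (simp cong: measurable_cong_sets)
  have spvol: "space vol = UNIV" using svol by (metis sets_eq_imp_space_eq space_borel)
  have \<nu>: "emeasure \<nu> E = emeasure vol (P ` (K \<inter> E))" if "E \<in> sets borel" for E
  proof -
    have E': "p -` E \<in> sets vol" using measurable_sets[OF mp that] by (simp add: svol)
    have "emeasure \<nu> E = emeasure (density vol (indicator (P ` K))) (p -` E)"
      unfolding \<nu>_def using that by (subst emeasure_distr[OF mp']) (simp_all add: spvol)
    also have "\<dots> = (\<integral>\<^sup>+x. indicator (P ` K) x * indicator (p -` E) x \<partial>vol)"
      using E' cPK by (intro emeasure_density) (auto simp: svol intro!: borel_measurable_indicator)
    also have "\<dots> = (\<integral>\<^sup>+x. indicator (P ` K \<inter> p -` E) x \<partial>vol)"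
      by (intro nn_integral_cong) (auto simp: indicator_def)
    also have "\<dots> = emeasure vol (P ` (K \<inter> E))"
      using PEb[OF that] by (simp add: PE svol)
    finally show ?thesis .
  qed
  let ?n = "real CARD('n)"
  have loc: "\<exists>r>0. \<exists>C\<ge>0. \<forall>u v s. cbox u v \<subseteq> ball x r \<longrightarrow> (\<forall>i\<in>Basis. v \<bullet> i - u \<bullet> i = s) \<longrightarrow>
      emeasure \<nu> (cbox u v) \<le> ennreal C * emeasure lborel (cbox u v)" if x: "x \<in> K" for x
  proof -
    have xQ: "x \<in> Q" using x K by blast
    obtain d where d: "d \<in> atl" "P x \<in> fst d" using atl_cover by blast
    note chd = chart_facts[OF atl_is_chart[OF d(1)]]
    let ?W = "snd c ` (fst c \<inter> fst d)" and ?t = "trans_map c d"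
    have W: "open ?W" by (rule open_snd_image[OF max_is_chart[OF c]]) (use ch(1) chd(1) in auto)
    have xW: "\<phi> x \<in> ?W" using Pinv(2,3)[OF xQ] d(2) by (metis IntI image_eqI)
    obtain r1 B1 where 1: "r1 > 0" "B1 > 0" "cball x r1 \<subseteq> Q"
      "\<And>y z. y \<in> cball x r1 \<Longrightarrow> z \<in> cball x r1 \<Longrightarrow> norm (\<phi> y - \<phi> z) \<le> B1 * norm (y - z)"
      using smooth_on_locally_Lipschitz[OF Q(2,1) xQ] by blast
    obtain r2 B2 where 2: "r2 > 0" "B2 > 0" "cball (\<phi> x) r2 \<subseteq> ?W"
      "\<And>y z. y \<in> cball (\<phi> x) r2 \<Longrightarrow> z \<in> cball (\<phi> x) r2 \<Longrightarrow> norm (?t y - ?t z) \<le> B2 * norm (y - z)"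
      using smooth_on_locally_Lipschitz[OF trans_smooth(1)[OF c d(1)] W xW] by blast
    have t_img: "?t y \<in> img d" if "y \<in> ?W" for y
      using that ch(5) chd(6) by (auto simp: trans_map_def)
    define Z where "Z = ?t ` cball (\<phi> x) r2"
    have "compact Z" unfolding Z_def
      using 2(3) smooth_on_continuous[OF trans_smooth(1)[OF c d(1)]]
      by (meson compact_cball compact_continuous_image continuous_on_subset)
    moreover have "Z \<subseteq> img d" unfolding Z_def using 2(3) t_img by blast
    ultimately have "compact ((\<lambda>y. sqrt (det (g d y))) ` Z)"
      using smooth_on_continuous[OF metric_smooth[OF atl_max[OF d(1)]]]
      by (intro compact_continuous_image continuous_on_real_sqrt continuous_on_det) (auto intro: continuous_on_subset)
    from compact_imp_bounded[OF this]
    obtain M' where "\<forall>y\<in>(\<lambda>y. sqrt (det (g d y))) ` Z. norm y \<le> M'"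
      unfolding bounded_iff by blast
    then have M': "\<bar>sqrt (det (g d (?t y)))\<bar> \<le> M'" if "y \<in> cball (\<phi> x) r2" for y
      using that unfolding Z_def by (metis imageI real_norm_def)
    define M where "M = \<bar>M'\<bar>"
    have M: "M \<ge> 0" "sqrt (det (g d (?t y))) \<le> M" if "y \<in> cball (\<phi> x) r2" for y
      using M'[OF that] by (auto simp: M_def)
    \<comment> \<open>Within radius r both Lipschitz estimates are available: \<phi> maps this ball
      into the region on which the transition map is controlled.\<close>
    define r where "r = min r1 (r2 / B1)"
    have r: "r > 0" "r \<le> r1" "B1 * r \<le> r2" using 1 2 by (auto simp: r_def min_def field_simps)
    have \<phi>r: "\<phi> y \<in> cball (\<phi> x) r2" "y \<in> cball x r1" if "y \<in> ball x r" for y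
    proof -
      show y1: "y \<in> cball x r1" using that r(2) by auto
      have "norm (\<phi> x - \<phi> y) \<le> B1 * norm (x - y)" using 1(1) y1 by (intro 1(4)) auto
      also have "\<dots> \<le> B1 * r" using that 1(2) by (intro mult_left_mono) (auto simp: dist_norm)
      finally show "\<phi> y \<in> cball (\<phi> x) r2" using r(3) by (simp add: dist_norm)
    qed
    define L where "L = B2 * B1"
    have L: "L > 0" using 1 2 by (simp add: L_def)
    define h where "h y = ?t (\<phi> y)" for y
    have hL: "norm (h y - h z) \<le> L * norm (y - z)" if "y \<in> ball x r" "z \<in> ball x r" for y z
    proof -
      have "norm (h y - h z) \<le> B2 * norm (\<phi> y - \<phi> z)"
        unfolding h_def using \<phi>r that by (intro 2(4)) auto
      also have "\<dots> \<le> B2 * (B1 * norm (y - z))"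
        using 1(4) 2(2) \<phi>r that by (intro mult_left_mono) auto
      finally show ?thesis by (simp add: L_def mult.assoc)
    qed
    \<comment> \<open>With n = \<open>CARD('n)\<close>, points of a cube of side s are at most n * s
      apart, so the image lies in a box of side 2 * L * n * s; M bounds the volume density
      there.\<close>
    define C where "C = M * (2 * L * ?n) ^ CARD('n)"
    have C: "C \<ge> 0" using L by (simp add: C_def M_def)
    have "emeasure \<nu> (cbox u v) \<le> ennreal C * emeasure lborel (cbox u v)"
      if uv: "cbox u v \<subseteq> ball x r" "\<forall>i\<in>Basis. v \<bullet> i - u \<bullet> i = s" for u v :: "real^'n" and s
    proof (cases "K \<inter> cbox u v = {}")
      case True
      then show ?thesis by (simp add: \<nu>)
    next
      case False
      then obtain y0 where y0: "y0 \<in> K" "y0 \<in> cbox u v" by blast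
      have ns: "norm (y - z) \<le> ?n * s" if "y \<in> cbox u v" "z \<in> cbox u v" for y z
      proof -
        have "norm (y - z) \<le> (\<Sum>b\<in>Basis. \<bar>(y - z) \<bullet> b\<bar>)" by (rule norm_le_l1)
        also have "\<dots> \<le> (\<Sum>b\<in>(Basis :: (real^'n) set). s)"
        proof (rule sum_mono)
          fix b :: "real^'n" assume b: "b \<in> Basis"
          have "u \<bullet> b \<le> y \<bullet> b" "y \<bullet> b \<le> v \<bullet> b" "u \<bullet> b \<le> z \<bullet> b" "z \<bullet> b \<le> v \<bullet> b"
            using that b by (auto simp: mem_box)
          moreover have "v \<bullet> b - u \<bullet> b = s" using uv(2) b by blast
          ultimately show "\<bar>(y - z) \<bullet> b\<bar> \<le> s" by (simp add: inner_diff_left abs_le_iff)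
        qed
        also have "\<dots> = ?n * s" by simp
        finally show ?thesis .
      qed
      have s: "s \<ge> 0"
      proof -
        have "0 \<le> ?n * s" using ns[OF y0(2) y0(2)] by simp
        then show ?thesis by (simp add: zero_le_mult_iff)
      qed
      define e where "e = L * (?n * s)"
      have e: "e \<ge> 0" using L s by (simp add: e_def)
      let ?box = "cbox (h y0 - e *\<^sub>R One) (h y0 + e *\<^sub>R One)"
      have hbox: "h y \<in> ?box" if "y \<in> K \<inter> cbox u v" for y
      proof -
        have "norm (h y - h y0) \<le> L * norm (y - y0)" using that y0 uv(1) by (intro hL) auto
        also have "\<dots> \<le> e" unfolding e_def using ns that y0 L by (intro mult_left_mono) auto
        finally have "\<bar>(h y - h y0) \<bullet> b\<bar> \<le> e" if "b \<in> Basis" for b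
          using Basis_le_norm[OF that, of "h y - h y0"] by linarith
        then show ?thesis by (auto simp: mem_box inner_diff_left inner_add_left abs_le_iff algebra_simps)
      qed
      have dom: "P y \<in> fst d" "snd d (P y) = h y" if "y \<in> K \<inter> cbox u v" for y
      proof -
        have yb: "y \<in> ball x r" using that uv(1) by blast
        then have "\<phi> y \<in> ?W" using \<phi>r 2(3) by blast
        then obtain q where q: "q \<in> fst c" "q \<in> fst d" "\<phi> y = snd c q" by blast
        then show "P y \<in> fst d" using ch(5) by (simp add: P_def)
        show "snd d (P y) = h y" by (simp add: P_def h_def trans_map_def)
      qed
      have "emeasure \<nu> (cbox u v) = emeasure vol (P ` (K \<inter> cbox u v))" by (simp add: \<nu>)
      also have "\<dots> = (\<integral>\<^sup>+y\<in>snd d ` P ` (K \<inter> cbox u v). ennreal (sqrt (det (g d y))) \<partial>lborel)"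
        using vol d(1) PEb[of "cbox u v"] dom(1) unfolding riemannian_volume_def by (simp add: image_subset_iff)
      also have "\<dots> \<le> (\<integral>\<^sup>+y. ennreal M * indicator ?box y \<partial>lborel)"
      proof (rule nn_integral_mono)
        fix y
        show "ennreal (sqrt (det (g d y))) * indicator (snd d ` P ` (K \<inter> cbox u v)) y \<le> ennreal M * indicator ?box y"
        proof (cases "y \<in> snd d ` P ` (K \<inter> cbox u v)")
          case True
          then obtain z where z: "z \<in> K \<inter> cbox u v" "y = h z" using dom(2) by auto
          have "\<phi> z \<in> cball (\<phi> x) r2" using z(1) uv(1) \<phi>r(1) by blast
          then have "sqrt (det (g d y)) \<le> M" using M(2) z(2) by (simp add: h_def)
          then show ?thesis using True hbox[OF z(1)] z(2) by (simp add: ennreal_leI)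
        qed simp
      qed
      also have "\<dots> = ennreal M * emeasure lborel ?box" by (simp add: nn_integral_cmult_indicator)
      also have "emeasure lborel ?box = ennreal ((2 * e) ^ CARD('n))"
      proof -
        have "(\<Prod>b\<in>Basis. (h y0 + e *\<^sub>R One - (h y0 - e *\<^sub>R One)) \<bullet> b) = (\<Prod>b\<in>(Basis :: (real^'n) set). 2 * e)"
          by (intro prod.cong refl) (simp only: inner_diff_left inner_add_left inner_scaleR_left, simp)
        moreover have "emeasure lborel ?box = ennreal (\<Prod>b\<in>Basis. (h y0 + e *\<^sub>R One - (h y0 - e *\<^sub>R One)) \<bullet> b)"
          using e by (intro emeasure_lborel_cbox) (simp add: inner_diff_left inner_add_left)
        ultimately show ?thesis by (simp only: prod_constant) simp
      qed
      also have "ennreal M * ennreal ((2 * e) ^ CARD('n)) = ennreal C * ennreal (s ^ CARD('n))"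
        using e s L by (simp add: ennreal_mult[symmetric] C_def M_def e_def power_mult_distrib mult_ac)
      also have "ennreal (s ^ CARD('n)) = emeasure lborel (cbox u v)"
      proof -
        have "u \<bullet> b \<le> v \<bullet> b" if "b \<in> Basis" for b using uv(2) that s by force
        then have "emeasure lborel (cbox u v) = ennreal (\<Prod>b\<in>Basis. (v - u) \<bullet> b)" by simp
        also have "(\<Prod>b\<in>Basis. (v - u) \<bullet> b) = (\<Prod>b\<in>(Basis :: (real^'n) set). s)"
          using uv(2) by (intro prod.cong) (auto simp: inner_diff_left)
        finally show ?thesis by simp
      qed
      finally show ?thesis .
    qed
    then show ?thesis using r(1) C by blast
  qed
  then obtain rr CC where rC: "\<And>x. x \<in> K \<Longrightarrow> rr x > 0" "\<And>x. x \<in> K \<Longrightarrow> CC x \<ge> 0"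
    "\<And>x u v s. x \<in> K \<Longrightarrow> cbox u v \<subseteq> ball x (rr x) \<Longrightarrow> \<forall>i\<in>Basis. v \<bullet> i - u \<bullet> i = s \<Longrightarrow>
      emeasure \<nu> (cbox u v) \<le> ennreal (CC x) * emeasure lborel (cbox u v)"
    by metis
  \<comment> \<open>The local constants depend on the point; a finite subcover of K leaves finitely
    many, and their sum plus 1 is a positive common bound.\<close>
  have "K \<subseteq> (\<Union>x\<in>K. ball x (rr x))" using rC(1) by force
  then obtain X where X: "X \<subseteq> K" "finite X" "K \<subseteq> (\<Union>x\<in>X. ball x (rr x))"
    using compactE_image[OF K(1), of K "\<lambda>x. ball x (rr x)"] by blast
  define C where "C = (\<Sum>x\<in>X. CC x) + 1"
  have C: "C > 0" "\<And>x. x \<in> X \<Longrightarrow> CC x \<le> C"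
  proof -
    have nn: "\<And>x. x \<in> X \<Longrightarrow> 0 \<le> CC x" using rC(2) X(1) by blast
    show "C > 0" using sum_nonneg[of X CC, OF nn] by (simp add: C_def)
    fix x assume "x \<in> X"
    then have "CC x \<le> (\<Sum>x\<in>X. CC x)" using X(2) nn by (intro member_le_sum) auto
    then show "CC x \<le> C" by (simp add: C_def)
  qed
  show ?thesis
  proof (rule that[OF C(1)])
    fix E :: "(real^'n) set" assume E: "E \<in> sets borel" "E \<subseteq> K"
    have "emeasure \<nu> E \<le> ennreal C * emeasure lborel E"
    proof (rule emeasure_le_of_small_cubes)
      show "sets \<nu> = sets borel" by (simp add: \<nu>_def)
      show "bounded E" using E(2) K(1) compact_imp_bounded bounded_subset by blast
      fix y assume "y \<in> E"
      then obtain x where x: "x \<in> X" "y \<in> ball x (rr x)" using E(2) X(3) by blast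
      obtain r where r: "r > 0" "ball y r \<subseteq> ball x (rr x)" using x(2) open_ball open_contains_ball by blast
      have "emeasure \<nu> (cbox u v) \<le> ennreal C * emeasure lborel (cbox u v)"
        if "cbox u v \<subseteq> ball y r" "\<forall>i\<in>Basis. v \<bullet> i - u \<bullet> i = s" for u v s
      proof -
        have "emeasure \<nu> (cbox u v) \<le> ennreal (CC x) * emeasure lborel (cbox u v)"
          using that r(2) x(1) X(1) by (intro rC(3)) auto
        also have "\<dots> \<le> ennreal C * emeasure lborel (cbox u v)"
          using C(2)[OF x(1)] by (intro mult_right_mono ennreal_leI) auto
        finally show ?thesis .
      qed
      then show "\<exists>r>0. \<forall>u v s. y \<in> cbox u v \<longrightarrow> cbox u v \<subseteq> ball y r \<longrightarrow> (\<forall>i\<in>Basis. v \<bullet> i - u \<bullet> i = s) \<longrightarrow>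
        emeasure \<nu> (cbox u v) \<le> ennreal C * emeasure lborel (cbox u v)" using r(1) by blast
    qed (use E C(1) in auto)
    moreover have "K \<inter> E = E" using E(2) by blast
    ultimately show "(\<lambda>w. par c (\<phi> w)) ` E \<in> sets borel \<and>
        emeasure vol ((\<lambda>w. par c (\<phi> w)) ` E) \<le> ennreal C * emeasure lborel E"
      using \<nu>[OF E(1)] PEb[OF E(1)] by (simp add: P_def)
  qed
qed

end

section \<open>The walk in a single subunit cube\<close>

lemma finite_family_lower:
  fixes f :: "'a \<Rightarrow> real"
  assumes "finite I" "\<And>i. i \<in> I \<Longrightarrow> f i > 0"
  obtains m where "m > 0" "\<And>i. i \<in> I \<Longrightarrow> m \<le> f i"
proof -
  have "Min (insert 1 (f ` I)) > 0" using assms by (subst Min_gr_iff) auto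
  moreover have "Min (insert 1 (f ` I)) \<le> f i" if "i \<in> I" for i using assms that by (intro Min_le) auto
  ultimately show ?thesis by (rule that)
qed

lemma finite_family_upper:
  fixes f :: "'a \<Rightarrow> real"
  assumes "finite I"
  obtains M where "M > 0" "\<And>i. i \<in> I \<Longrightarrow> f i \<le> M"
proof -
  have "Max (insert 1 (f ` I)) \<ge> 1" using assms by (intro Max_ge) auto
  then have "Max (insert 1 (f ` I)) > 0" by linarith
  moreover have "f i \<le> Max (insert 1 (f ` I))" if "i \<in> I" for i using assms that by (intro Max_ge) auto
  ultimately show ?thesis by (rule that)
qed

lemma compact_closed_box: "compact {w::real^'n::finite. \<forall>j. \<bar>w $ j\<bar> \<le> R j}"
proof -
  have "{w::real^'n. \<forall>j. \<bar>w $ j\<bar> \<le> R j} = cbox (- (\<chi> j. R j)) (\<chi> j. R j)"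
    by (simp add: set_eq_iff mem_box_cart abs_le_iff minus_le_iff[of "x $ j" "R j" for x j] conj_commute)
  then show ?thesis using compact_cbox by metis
qed

definition half_width :: "('m, 'n::finite) cube \<Rightarrow> real \<Rightarrow> 'n \<Rightarrow> real" where
  "half_width K r j = cconst K j * r powr cexp K j"

lemma block_obox: "block K r = obox (half_width K r)"
  by (simp add: block_def obox_def half_width_def)

text \<open>The law of one step dominates density \<open>a\<close> along a segment in direction j.
  Test functions in place of sets, and a margin for the coordinate j alone, are what the induction
  over the coordinates consumes.\<close>

definition minorized ::
  "('m::topological_space, 'n::finite) cube \<Rightarrow> real \<Rightarrow> real \<Rightarrow> real \<Rightarrow> 'n \<Rightarrow> ('m \<Rightarrow> 'm measure) \<Rightarrow> bool"
where
  "minorized K \<rho> a r0 j L \<longleftrightarrow> (\<forall>w\<in>block K \<rho>. \<forall>r\<in>{0<..r0}. \<forall>F\<in>borel_measurable borel.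
     \<bar>w $ j\<bar> + r \<le> half_width K \<rho> j \<longrightarrow>
     ennreal a * (\<integral>\<^sup>+s. indicator {s. \<bar>s - w $ j\<bar> < r} s * F (Psi_inv K (upd j w s)) \<partial>lborel)
       \<le> (\<integral>\<^sup>+y. F y \<partial>L (Psi_inv K w)))"

locale subunit_cube =
  fixes K :: "('m::t2_space, 'n::finite) cube" and \<rho> cs :: real
    and \<gamma> :: "real^'n \<Rightarrow> real" and \<theta> :: "'n \<Rightarrow> real"
  assumes chart: "is_chart (cchart K)"
    and rho: "0 < \<rho>" and cs: "1 < cs"
    and cpos: "\<And>j. cconst K j > 0" "\<And>j. cexp K j > 0" "\<And>j. \<theta> j > 0"
    and Phi: "smooth_on (block K (cs * \<rho>)) (cPhi K)" "inj_on (cPhi K) (block K (cs * \<rho>))"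
      "open (cPhi K ` block K (cs * \<rho>))"
      "smooth_on (cPhi K ` block K (cs * \<rho>)) (inv_into (block K (cs * \<rho>)) (cPhi K))"
      "cPhi K ` block K (cs * \<rho>) \<subseteq> img (cchart K)"
    and \<gamma>: "continuous_on (block K (cs * \<rho>)) \<gamma>" "\<And>w. w \<in> block K (cs * \<rho>) \<Longrightarrow> \<gamma> w > 0"
begin

abbreviation R where "R \<equiv> half_width K \<rho>"
abbreviation Rs where "Rs \<equiv> half_width K (cs * \<rho>)"
definition \<kappa> where "\<kappa> j = \<theta> j * cconst K j * \<rho> powr cexp K j"

abbreviation Q where "Q \<equiv> block K (cs * \<rho>)"
abbreviation f where "f \<equiv> inv_into Q (cPhi K)"
abbreviation P where "P \<equiv> Psi_inv K"

lemma R_less: "0 < R j" "R j < Rs j"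
proof -
  show "0 < R j" using cpos rho by (simp add: half_width_def)
  have "\<rho> < cs * \<rho>" using cs rho by simp
  then have "\<rho> powr cexp K j < (cs * \<rho>) powr cexp K j"
    using rho cpos(2)[of j] by (intro powr_less_mono2) auto
  then show "R j < Rs j" using cpos(1)[of j] by (simp add: half_width_def)
qed

lemma kappa_pos: "\<kappa> j > 0"
  using cpos rho by (simp add: \<kappa>_def)

lemma block_subset: "block K \<rho> \<subseteq> Q"
  unfolding block_obox using R_less by (auto simp: obox_def intro: less_trans)

lemma open_Q: "open Q" "open (block K \<rho>)"
  by (simp_all add: block_obox open_obox)

lemmas ch = chart_facts[OF chart]

lemma f_Phi: "w \<in> Q \<Longrightarrow> f (cPhi K w) = w"
  by (rule inv_into_f_f[OF Phi(2)])

lemma snd_P: "w \<in> Q \<Longrightarrow> snd (cchart K) (P w) = cPhi K w" "w \<in> Q \<Longrightarrow> P w \<in> fst (cchart K)"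
  using ch(7,8)[of "cPhi K w"] Phi(5) by (auto simp: Psi_inv_def)

lemma Psi_P: "w \<in> Q \<Longrightarrow> Psi K (cs * \<rho>) (P w) = w"
  unfolding Psi_def by (simp add: snd_P f_Phi)

lemma P_inj: "inj_on P Q"
  by (rule inj_on_inverseI[of _ "Psi K (cs * \<rho>)"]) (rule Psi_P)

lemma continuous_P: "continuous_on Q P"
  unfolding Psi_inv_def[abs_def]
  by (rule continuous_on_compose2[OF ch(4) smooth_on_continuous[OF Phi(1)] Phi(5)])

lemma open_P_image:
  assumes V: "open V" "V \<subseteq> Q" shows "open (P ` V)"
proof -
  have "cPhi K ` V = cPhi K ` Q \<inter> f -` V" using f_Phi V(2) by force
  then have "open (cPhi K ` V)"
    using continuous_open_preimage[OF smooth_on_continuous[OF Phi(4)] Phi(3) V(1)] by simp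
  then have "open (par (cchart K) ` cPhi K ` V)"
    using V(2) Phi(5) by (intro open_par_image[OF chart]) auto
  then show ?thesis by (simp add: Psi_inv_def[abs_def] image_image)
qed

lemma continuous_Psi: "continuous_on (P ` Q) (Psi K (cs * \<rho>))"
  unfolding Psi_def[abs_def]
proof (rule continuous_on_compose2[OF smooth_on_continuous[OF Phi(4)]])
  show "continuous_on (P ` Q) (snd (cchart K))"
    using snd_P(2) by (intro continuous_on_subset[OF ch(3)]) auto
  show "snd (cchart K) ` P ` Q \<subseteq> cPhi K ` Q" using snd_P(1) by auto
qed

text \<open>Outside Q the values of \<open>Psi_inv\<close> are not controlled; a constant extension
  makes the map Borel on the whole space, as the iteration lemmas require.\<close>

definition P' where "P' w = (if w \<in> Q then P w else undefined)"

lemma P'_measurable: "P' \<in> borel \<rightarrow>\<^sub>M borel"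
  unfolding P'_def[abs_def]
  by (rule borel_measurable_continuous_on_if) (use continuous_P open_Q in auto)

text \<open>The default 0 lies in the block, so membership in the image of Q has to be tested
  separately in \<open>step\<close>.\<close>

definition psi where "psi x = (if x \<in> P ` Q then Psi K (cs * \<rho>) x else 0)"

lemma psi_measurable: "psi \<in> borel \<rightarrow>\<^sub>M borel"
  unfolding psi_def[abs_def]
  by (rule borel_measurable_continuous_on_if) (use continuous_Psi open_P_image open_Q in auto)

lemma psi_P: "w \<in> Q \<Longrightarrow> psi (P w) = w"
  by (simp add: psi_def Psi_P)

sublocale lf: line_flow Rs \<gamma> "\<kappa> j" j for j
  using \<gamma> kappa_pos by unfold_locales (auto simp: block_obox)

lemma Xfield_eq: "Xfield \<rho> K \<gamma> \<theta> j = lf.X j"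
  by (simp add: Xfield_def[abs_def] \<kappa>_def)

lemma exp_X_tau:
  assumes w: "w \<in> Q" and s: "\<bar>s\<bar> < Rs j"
  shows "exp_X cs \<rho> K \<gamma> \<theta> j (lf.tau j w s) (P w) = P (upd j w s)"
  using lf.flow_eq[of w s j] w s unfolding exp_X_def Xfield_eq Psi_P[OF w] by (simp add: block_obox)

lemma exp_X_defined_tau:
  assumes w: "w \<in> Q" and s: "\<bar>s\<bar> < Rs j"
  shows "exp_X_defined cs \<rho> K \<gamma> \<theta> j (lf.tau j w s) (P w)"
  unfolding exp_X_defined_def Psi_P[OF w] Xfield_eq
  using lf.flow_to_iff[of w j "lf.tau j w s"] w s by (auto simp: block_obox)

lemma QA_eq: "QA K \<rho> = P ` block K \<rho>"
  by (simp add: QA_def)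

lemma P_in_QA: "w \<in> Q \<Longrightarrow> P w \<in> QA K \<rho> \<longleftrightarrow> w \<in> block K \<rho>"
  unfolding QA_eq using inj_on_image_mem_iff[OF P_inj _ block_subset] by blast

text \<open>A half-width between the two blocks: the closed box it defines is compact inside Q,
  which bounds the density on it, and it leaves the flow room to cross the boundary of the small
  block.\<close>

definition R2 where "R2 j = (R j + Rs j) / 2"

lemma R2: "R j < R2 j" "R2 j < Rs j"
  using R_less[of j] by (auto simp: R2_def)

text \<open>The deterministic move whose average over \<open>t\<close> is \<open>S_op\<close>: it stays at \<open>x\<close>
  where \<open>chi\<close> vanishes, which produces the holding term.\<close>

definition step where
  "step j h t x = (if (t, psi x) \<in> {-h<..<h} \<times> block K \<rho> \<and> x \<in> P ` Q \<and> \<bar>lf.sig j t (psi x)\<bar> < R j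
     then P' (upd j (psi x) (lf.sig j t (psi x))) else x)"

text \<open>m and M are the extrema of the density over the closed box of half-widths
  \<open>R2\<close>. In every direction h0 is at most the lower bound of \<open>tau_surj\<close> for
  the time in which the coordinate passes from \<open>R j\<close> to \<open>R2 j\<close>.\<close>

lemma window_const:
  obtains m M h0 where "m > 0" "M > 0" "h0 > 0"
    "\<And>j w s. w \<in> block K \<rho> \<Longrightarrow> \<bar>s\<bar> \<le> R2 j \<Longrightarrow> m \<le> \<gamma> (upd j w s) \<and> \<gamma> (upd j w s) \<le> M"
    "\<And>j w t. w \<in> block K \<rho> \<Longrightarrow> \<bar>t\<bar> < h0 \<Longrightarrow> \<exists>s. \<bar>s\<bar> < R2 j \<and> lf.tau j w s = t"
proof -
  let ?B = "{w::real^'n. \<forall>j. \<bar>w $ j\<bar> \<le> R2 j}"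
  have BQ: "?B \<subseteq> Q" unfolding block_obox obox_def using R2(2) by (auto intro: le_less_trans)
  have ne: "?B \<noteq> {}"
  proof -
    have "0 \<in> ?B" using R_less(1) R2(1) by (auto intro: less_imp_le less_trans)
    then show ?thesis by blast
  qed
  have c\<gamma>: "continuous_on ?B \<gamma>" using \<gamma>(1) BQ continuous_on_subset by blast
  obtain a where a: "a \<in> ?B" "\<And>w. w \<in> ?B \<Longrightarrow> \<gamma> a \<le> \<gamma> w"
    using continuous_attains_inf[OF compact_closed_box ne c\<gamma>] by blast
  obtain b where b: "b \<in> ?B" "\<And>w. w \<in> ?B \<Longrightarrow> \<gamma> w \<le> \<gamma> b"
    using continuous_attains_sup[OF compact_closed_box ne c\<gamma>] by blast
  have pos: "\<gamma> a > 0" "\<gamma> b > 0" using a b \<gamma>(2) BQ by auto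
  have bd: "\<gamma> a \<le> \<gamma> (upd j w s) \<and> \<gamma> (upd j w s) \<le> \<gamma> b" if w: "w \<in> block K \<rho>" and s: "\<bar>s\<bar> \<le> R2 j" for j w s
  proof -
    have "upd j w s \<in> ?B"
      using s w R2(1) unfolding block_obox obox_def by (auto intro: less_imp_le less_trans)
    then show ?thesis using a(2) b(2) by blast
  qed
  have "\<gamma> a * (R2 j - R j) / \<kappa> j > 0" for j using pos R2(1)[of j] kappa_pos by simp
  then obtain h0 where h0: "h0 > 0" "\<And>j. h0 \<le> \<gamma> a * (R2 j - R j) / \<kappa> j"
    using finite_family_lower[of "UNIV :: 'n set" "\<lambda>j. \<gamma> a * (R2 j - R j) / \<kappa> j"] by auto
  have win: "\<exists>s. \<bar>s\<bar> < R2 j \<and> lf.tau j w s = t" if w: "w \<in> block K \<rho>" and t: "\<bar>t\<bar> < h0" for j w t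
  proof (rule lf.tau_surj[where m="\<gamma> a" and ?R1.0="R j"])
    show "w \<in> obox Rs" using w block_subset block_obox by blast
    show "\<bar>w $ j\<bar> \<le> R j" using w unfolding block_obox obox_def by (simp add: less_imp_le)
    show "\<bar>t\<bar> < \<gamma> a * (R2 j - R j) / \<kappa> j" using t h0(2)[of j] by linarith
  qed (use R2 bd w pos in auto)
  show ?thesis by (rule that[OF pos h0(1) bd win])
qed

text \<open>Joint measurability in the point and the time is what makes the laws of the move a
  kernel. As \<open>sig\<close> is controlled only where the time is attained, it is cut off to u
  before being composed with \<open>psi\<close>.\<close>

lemma step_measurable:
  assumes win: "\<And>j w t. w \<in> block K \<rho> \<Longrightarrow> \<bar>t\<bar> < h \<Longrightarrow> \<exists>s. \<bar>s\<bar> < R2 j \<and> lf.tau j w s = t"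
  shows "(\<lambda>(x, t). step j h t x) \<in> borel \<Otimes>\<^sub>M borel \<rightarrow>\<^sub>M borel"
proof -
  let ?A = "{-h<..<h} \<times> block K \<rho>"
  have A: "?A \<in> sets (borel \<Otimes>\<^sub>M borel)" by (intro pair_measureI) (auto simp: block_obox)
  define u where "u = (\<lambda>(t, w). if (t, w) \<in> ?A then lf.sig j t w else 0)"
  have u: "u \<in> borel_measurable (borel \<Otimes>\<^sub>M borel)"
    unfolding u_def
  proof (rule lf.sig_measurable[OF A])
    show "R2 j < Rs j" by (rule R2)
    fix t w assume "(t, w) \<in> ?A"
    then show "w \<in> obox Rs \<and> (\<exists>s. \<bar>s\<bar> < R2 j \<and> lf.tau j w s = t)"
      using win[of w t j] block_subset block_obox by auto
  qed
  note [measurable] = psi_measurable P'_measurable u A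
  have QP [measurable]: "P ` Q \<in> sets borel" using open_P_image open_Q by simp
  have tp [measurable]: "(\<lambda>p. (snd p, psi (fst p))) \<in> borel \<Otimes>\<^sub>M borel \<rightarrow>\<^sub>M borel \<Otimes>\<^sub>M borel"
    by measurable
  have up: "(\<lambda>p. u (snd p, psi (fst p))) \<in> borel_measurable (borel \<Otimes>\<^sub>M borel)"
    using measurable_compose[OF tp u] .
  have "(\<lambda>p. if (snd p, psi (fst p)) \<in> ?A \<and> fst p \<in> P ` Q \<and> \<bar>u (snd p, psi (fst p))\<bar> < R j
      then P' (upd j (psi (fst p)) (u (snd p, psi (fst p)))) else fst p) \<in> borel \<Otimes>\<^sub>M borel \<rightarrow>\<^sub>M borel"
  proof (rule measurable_If)
    have "(\<lambda>p. upd j (psi (fst p)) (u (snd p, psi (fst p)))) \<in> borel_measurable (borel \<Otimes>\<^sub>M borel)"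
      using up by measurable
    then show "(\<lambda>p. P' (upd j (psi (fst p)) (u (snd p, psi (fst p))))) \<in> borel \<Otimes>\<^sub>M borel \<rightarrow>\<^sub>M borel"
      using measurable_compose P'_measurable by blast
    have 1: "{p \<in> space (borel \<Otimes>\<^sub>M borel). (snd p, psi (fst p)) \<in> ?A} \<in> sets (borel \<Otimes>\<^sub>M borel)"
      using measurable_sets[OF tp A] by (simp add: vimage_def Int_def conj_commute)
    have 2: "{p \<in> space (borel \<Otimes>\<^sub>M (borel :: real measure)). fst p \<in> P ` Q} \<in> sets (borel \<Otimes>\<^sub>M borel)"
      using measurable_sets[OF measurable_fst QP] by (simp add: vimage_def Int_def conj_commute)
    have 3: "{p \<in> space (borel \<Otimes>\<^sub>M borel). \<bar>u (snd p, psi (fst p))\<bar> < R j} \<in> sets (borel \<Otimes>\<^sub>M borel)"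
      using up by measurable
    show "{p \<in> space (borel \<Otimes>\<^sub>M borel). (snd p, psi (fst p)) \<in> ?A \<and> fst p \<in> P ` Q \<and> \<bar>u (snd p, psi (fst p))\<bar> < R j} \<in> sets (borel \<Otimes>\<^sub>M borel)"
      by (intro sets.sets_Collect_conj 1 2 3)
  qed simp
  also have "(\<lambda>p. if (snd p, psi (fst p)) \<in> ?A \<and> fst p \<in> P ` Q \<and> \<bar>u (snd p, psi (fst p))\<bar> < R j
      then P' (upd j (psi (fst p)) (u (snd p, psi (fst p)))) else fst p) = (\<lambda>(x, t). step j h t x)"
    by (auto simp: fun_eq_iff step_def u_def)
  finally show ?thesis .
qed

text \<open>In cube coordinates the flow from w for time t ends at the point whose j-th coordinate
  is \<open>sig t w\<close>, so it ends in the cube exactly when this coordinate is below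
  \<open>R j\<close> in modulus.\<close>

lemma chi_eq:
  assumes win: "\<And>j w t. w \<in> block K \<rho> \<Longrightarrow> \<bar>t\<bar> < h \<Longrightarrow> \<exists>s. \<bar>s\<bar> < R2 j \<and> lf.tau j w s = t"
  shows "chi cs \<rho> K \<gamma> \<theta> j h t x =
      (if (t, psi x) \<in> {-h<..<h} \<times> block K \<rho> \<and> x \<in> P ` Q \<and> \<bar>lf.sig j t (psi x)\<bar> < R j then 1 else 0)"
    and step_eq: "step j h t x = (if chi cs \<rho> K \<gamma> \<theta> j h t x = 1 then exp_X cs \<rho> K \<gamma> \<theta> j t x else x)"
proof -
  have "chi cs \<rho> K \<gamma> \<theta> j h t x =
      (if (t, psi x) \<in> {-h<..<h} \<times> block K \<rho> \<and> x \<in> P ` Q \<and> \<bar>lf.sig j t (psi x)\<bar> < R j then 1 else 0) \<and>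
    step j h t x = (if chi cs \<rho> K \<gamma> \<theta> j h t x = 1 then exp_X cs \<rho> K \<gamma> \<theta> j t x else x)"
  proof (cases "\<bar>t\<bar> < h \<and> x \<in> QA K \<rho>")
    case True
    then obtain w where w: "w \<in> block K \<rho>" "x = P w" unfolding QA_eq by blast
    then have wQ: "w \<in> Q" using block_subset by blast
    obtain s where s: "\<bar>s\<bar> < R2 j" "lf.tau j w s = t" using win[OF w(1)] True by blast
    have sR: "\<bar>s\<bar> < Rs j" using s(1) R2(2)[of j] by linarith
    have e: "exp_X cs \<rho> K \<gamma> \<theta> j t x = P (upd j w s)" using exp_X_tau[OF wQ sR] s w by simp
    have uQ: "upd j w s \<in> Q" using wQ sR upd_in_obox[of w Rs j s] by (simp add: block_obox)
    have "P (upd j w s) \<in> QA K \<rho> \<longleftrightarrow> \<bar>s\<bar> < R j"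
      using P_in_QA[OF uQ] upd_in_obox[of w R j s] w(1) by (simp add: block_obox)
    moreover have "lf.sig j t w = s" using lf.sig_tau[of w s j] wQ sR s by (simp add: block_obox)
    moreover have "(t, w) \<in> {-h<..<h} \<times> block K \<rho>" using True w by (auto simp: abs_less_iff)
    ultimately show ?thesis
      using True w wQ uQ e by (auto simp: step_def chi_def psi_P P'_def)
  next
    case False
    have "\<not> ((t, psi x) \<in> {-h<..<h} \<times> block K \<rho> \<and> x \<in> P ` Q)"
    proof
      assume a: "(t, psi x) \<in> {-h<..<h} \<times> block K \<rho> \<and> x \<in> P ` Q"
      then obtain w where w: "w \<in> Q" "x = P w" by blast
      then have "x \<in> QA K \<rho>" using a psi_P P_in_QA by auto
      then show False using a False by (auto simp: abs_less_iff)
    qed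
    then show ?thesis using False by (auto simp: step_def chi_def)
  qed
  then show "chi cs \<rho> K \<gamma> \<theta> j h t x =
      (if (t, psi x) \<in> {-h<..<h} \<times> block K \<rho> \<and> x \<in> P ` Q \<and> \<bar>lf.sig j t (psi x)\<bar> < R j then 1 else 0)"
    and "step j h t x = (if chi cs \<rho> K \<gamma> \<theta> j h t x = 1 then exp_X cs \<rho> K \<gamma> \<theta> j t x else x)"
    by blast+
qed

section \<open>The Markov kernel of one cube and one direction\<close>

definition U :: "real \<Rightarrow> real measure" where
  "U h = density lborel (\<lambda>t. ennreal (indicator {-h..h} t / (2 * h)))"

lemma U: assumes "h > 0" shows "prob_space (U h)" "sets (U h) = sets borel"
proof -
  have "emeasure (U h) (space (U h)) = (\<integral>\<^sup>+t. ennreal (1 / (2 * h)) * indicator {-h..h} t \<partial>lborel)"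
    unfolding U_def by (subst emeasure_density) (auto intro!: nn_integral_cong simp: indicator_def)
  also have "\<dots> = 1"
    using assms by (simp add: nn_integral_cmult_indicator ennreal_mult[symmetric])
  finally show "prob_space (U h)" by (rule prob_spaceI)
qed (simp add: U_def)

definition kern :: "'n \<Rightarrow> real \<Rightarrow> 'm \<Rightarrow> 'm measure" where
  "kern j h x = distr (U h) borel (\<lambda>t. step j h t x)"

text \<open>Splitting according to the value of \<open>chi\<close> expresses the integrand of
  \<open>S_op\<close> through the move \<open>step\<close>, whose measurability is known; the
  holding term then cancels.\<close>

lemma rep_kernel_kern:
  assumes win: "\<And>j w t. w \<in> block K \<rho> \<Longrightarrow> \<bar>t\<bar> < h \<Longrightarrow> \<exists>s. \<bar>s\<bar> < R2 j \<and> lf.tau j w s = t" and h: "h > 0"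
  shows "rep_kernel (S_op cs \<rho> K \<gamma> \<theta> j h) (kern j h)"
  unfolding rep_kernel_def
proof (intro conjI ballI impI allI)
  note sm = step_measurable[OF win, where j=j]
  have stx: "(\<lambda>t. step j h t x) \<in> borel \<rightarrow>\<^sub>M borel" for x
    using measurable_compose[OF _ sm, of "\<lambda>t. (x, t)"] by simp
  have "(\<lambda>x. U h) \<in> borel \<rightarrow>\<^sub>M prob_algebra (borel :: real measure)"
    using U[OF h] by (intro measurable_const) (simp add: space_prob_algebra)
  then show "kern j h \<in> borel \<rightarrow>\<^sub>M prob_algebra borel"
    unfolding kern_def[abs_def] using sm by (rule measurable_distr_prob_space2)
  fix F :: "'m \<Rightarrow> real" and x assume F: "F \<in> borel_measurable borel" "bounded (range F)"
  obtain B where B: "\<And>y. \<bar>F y\<bar> \<le> B" using F(2) unfolding bounded_iff by auto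
  let ?\<chi> = "\<lambda>t. chi cs \<rho> K \<gamma> \<theta> j h t x" and ?e = "\<lambda>t. exp_X cs \<rho> K \<gamma> \<theta> j t x"
  let ?I = "\<lambda>t. indicator {-h..h} t :: real"
  have Fst [measurable]: "(\<lambda>t. F (step j h t x)) \<in> borel_measurable borel"
    using measurable_compose[OF stx F(1)] .
  have dens: "(\<integral>y. F y \<partial>kern j h x) = (\<integral>t. ?I t / (2 * h) * F (step j h t x) \<partial>lborel)"
  proof -
    have "(\<lambda>t. step j h t x) \<in> U h \<rightarrow>\<^sub>M borel" using stx U(2)[OF h] by (simp cong: measurable_cong_sets)
    then have "(\<integral>y. F y \<partial>kern j h x) = (\<integral>t. F (step j h t x) \<partial>U h)"
      unfolding kern_def using F(1) by (rule integral_distr)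
    also have "\<dots> = (\<integral>t. ?I t / (2 * h) * F (step j h t x) \<partial>lborel)"
      unfolding U_def using h by (subst integral_density) auto
    finally show ?thesis .
  qed
  \<comment> \<open>\<open>chi\<close> is the indicator of a set of times described by
    \<open>sig\<close>; it is measurable because the jointly measurable cut-off of
    \<open>sig\<close> has measurable sections.\<close>
  have \<chi>m: "?\<chi> \<in> borel_measurable borel"
  proof -
    let ?M = "{t. t \<in> {-h<..<h} \<and> x \<in> P ` Q \<and> psi x \<in> block K \<rho> \<and> \<bar>lf.sig j t (psi x)\<bar> < R j}"
    have eq: "?\<chi> = indicator ?M"
      using chi_eq[OF win, where j=j and x=x] by (auto simp: fun_eq_iff indicator_def)
    have "?M \<in> sets borel"
    proof (cases "x \<in> P ` Q \<and> psi x \<in> block K \<rho>")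
      case True
      let ?A = "{-h<..<h} \<times> block K \<rho>"
      have A: "?A \<in> sets (borel \<Otimes>\<^sub>M borel)" by (intro pair_measureI) (auto simp: block_obox)
      have u: "(\<lambda>(t, w). if (t, w) \<in> ?A then lf.sig j t w else 0) \<in> borel_measurable (borel \<Otimes>\<^sub>M borel)"
      proof (rule lf.sig_measurable[OF A])
        show "R2 j < Rs j" by (rule R2)
        fix t w assume "(t, w) \<in> ?A"
        then show "w \<in> obox Rs \<and> (\<exists>s. \<bar>s\<bar> < R2 j \<and> lf.tau j w s = t)"
          using win[of w t j] block_subset block_obox by auto
      qed
      define v where "v t = (if (t, psi x) \<in> ?A then lf.sig j t (psi x) else 0)" for t
      have "(\<lambda>t::real. (t, psi x)) \<in> borel \<rightarrow>\<^sub>M borel \<Otimes>\<^sub>M borel" by measurable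
      from measurable_compose[OF this u] have [measurable]: "v \<in> borel_measurable borel"
        unfolding v_def[abs_def] by (simp only: prod.case)
      have "{t \<in> space borel. t \<in> {-h<..<h} \<and> \<bar>v t\<bar> < R j} \<in> sets borel"
        by measurable
      also have "{t \<in> space borel. t \<in> {-h<..<h} \<and> \<bar>v t\<bar> < R j} = ?M"
        using True by (auto simp: v_def)
      finally show ?thesis .
    next
      case False
      then have "?M = {}" by blast
      then show ?thesis by (simp only: sets.empty_sets)
    qed
    then show ?thesis unfolding eq by (rule borel_measurable_indicator)
  qed
  note [measurable] = \<chi>m
  have i3: "integrable lborel (\<lambda>t. ?I t)" by (rule integrable_real_indicator) (simp_all add: emeasure_lborel_Icc_eq)
  have i1: "integrable lborel (\<lambda>t. ?I t * ?\<chi> t)"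
    by (rule Bochner_Integration.integrable_bound[OF i3]) (measurable, auto simp: indicator_def chi_def)
  have Fle: "\<bar>?I t * F (step j h t x)\<bar> \<le> \<bar>B * ?I t\<bar>" for t
    using B[of "step j h t x"] by (auto simp: indicator_def)
  have i2: "integrable lborel (\<lambda>t. ?I t * F (step j h t x))"
  proof (rule Bochner_Integration.integrable_bound[OF integrable_mult_right[OF i3, of B]])
    show "(\<lambda>t. ?I t * F (step j h t x)) \<in> borel_measurable lborel" by measurable
    show "AE t in lborel. norm (?I t * F (step j h t x)) \<le> norm (B * ?I t)"
      using Fle by (simp only: real_norm_def) simp
  qed
  \<comment> \<open>If \<open>chi\<close> is 1, the last two terms cancel and the move is the flow;
    if it is 0, the move stays at x and the first two terms cancel.\<close>
  have "?I t * (?\<chi> t * F (?e t)) = ?I t * F (step j h t x) - F x * ?I t + F x * (?I t * ?\<chi> t)" for t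
  proof -
    have se: "step j h t x = (if ?\<chi> t = 1 then ?e t else x)" using win by (rule step_eq)
    have "?\<chi> t = 1 \<or> ?\<chi> t = 0" by (simp add: chi_def)
    then show ?thesis
    proof
      assume 1: "?\<chi> t = 1"
      then have "step j h t x = ?e t" by (simp add: se)
      then show ?thesis by (simp add: 1)
    next
      assume 0: "?\<chi> t = 0"
      then have "step j h t x = x" by (simp add: se)
      then show ?thesis by (simp add: 0)
    qed
  qed
  then have "(LINT t:{-h..h}|lborel. ?\<chi> t * F (?e t))
     = (\<integral>t. ?I t * F (step j h t x) - F x * ?I t + F x * (?I t * ?\<chi> t) \<partial>lborel)"
    unfolding set_lebesgue_integral_def by simp
  also have "\<dots> = (\<integral>t. ?I t * F (step j h t x) \<partial>lborel) - F x * (2 * h) + F x * (\<integral>t. ?I t * ?\<chi> t \<partial>lborel)"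
    using i1 i2 i3 h by simp
  finally have eq1: "(LINT t:{-h..h}|lborel. ?\<chi> t * F (?e t)) = \<dots>" .
  have eq2: "(LINT t:{-h..h}|lborel. ?\<chi> t) = (\<integral>t. ?I t * ?\<chi> t \<partial>lborel)"
    by (simp add: set_lebesgue_integral_def)
  have eq3: "(\<integral>t. ?I t / (2 * h) * F (step j h t x) \<partial>lborel) = (\<integral>t. ?I t * F (step j h t x) \<partial>lborel) / (2 * h)"
    using integral_divide_zero[of lborel "\<lambda>t. ?I t * F (step j h t x)" "2 * h"] by simp
  show "S_op cs \<rho> K \<gamma> \<theta> j h F x = (\<integral>y. F y \<partial>kern j h x)"
    unfolding S_op_def eq1 eq2 dens eq3 using h by (simp add: field_simps)
qed

text \<open>On a window of radius r the travel times stay below h and the coordinate stays below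
  \<open>R j\<close>, so the move reaches every point of the window. The constant combines the
  uniform density 1 / (2 * h) with the Jacobian bound m / \<kappa> j.\<close>

lemma kern_lower:
  assumes win: "\<And>j w t. w \<in> block K \<rho> \<Longrightarrow> \<bar>t\<bar> < h \<Longrightarrow> \<exists>s. \<bar>s\<bar> < R2 j \<and> lf.tau j w s = t" and h: "h > 0"
    and bd: "\<And>j w s. w \<in> block K \<rho> \<Longrightarrow> \<bar>s\<bar> \<le> R2 j \<Longrightarrow> m \<le> \<gamma> (upd j w s) \<and> \<gamma> (upd j w s) \<le> M"
    and m: "m > 0" and w: "w \<in> block K \<rho>" and r: "0 < r" "\<bar>w $ j\<bar> + r \<le> R j" "M * r / \<kappa> j < h"
    and F: "F \<in> borel_measurable borel"
  shows "ennreal (m / (2 * \<kappa> j) / h) * (\<integral>\<^sup>+s. indicator {s. \<bar>s - w $ j\<bar> < r} s * F (P (upd j w s)) \<partial>lborel)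
    \<le> (\<integral>\<^sup>+y. F y \<partial>kern j h (P w))"
proof -
  have wQ: "w \<in> Q" using w block_subset by blast
  have stx [measurable]: "(\<lambda>t. step j h t (P w)) \<in> borel \<rightarrow>\<^sub>M borel"
  proof -
    have "(\<lambda>t::real. (P w, t)) \<in> borel \<rightarrow>\<^sub>M borel \<Otimes>\<^sub>M borel" by measurable
    from measurable_compose[OF this step_measurable[where j=j, OF win]] show ?thesis by simp
  qed
  have Fst [measurable]: "(\<lambda>t. F (step j h t (P w))) \<in> borel_measurable borel"
    using measurable_compose[OF stx F] .
  have in_R: "\<bar>s\<bar> \<le> R2 j" "\<bar>s\<bar> < Rs j" if "\<bar>s - w $ j\<bar> \<le> r" for s
    using that r R2[of j] by auto
  have tau_h: "\<bar>lf.tau j w s\<bar> < h" if s: "\<bar>s - w $ j\<bar> \<le> r" for s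
  proof -
    have wj: "\<bar>w $ j\<bar> < Rs j" using in_R(2)[of "w $ j"] r by simp
    have M0: "M \<ge> 0" using bd[OF w, of "w $ j" j] in_R(1)[of "w $ j"] r m by auto
    have "M * \<bar>s - w $ j\<bar> / \<kappa> j \<le> M * r / \<kappa> j"
      using s M0 kappa_pos[of j] by (intro divide_right_mono mult_left_mono) auto
    then have lt: "M * \<bar>s - w $ j\<bar> / \<kappa> j < h" using r(3) by linarith
    have bd': "m \<le> \<gamma> (upd j w x) \<and> \<gamma> (upd j w x) \<le> M" if "\<bar>x - w $ j\<bar> \<le> r" for x
      using in_R(1)[OF that] bd[OF w] by blast
    show ?thesis
    proof (cases "w $ j \<le> s")
      case True
      have "m * (s - w $ j) / \<kappa> j \<le> lf.tau j w s - lf.tau j w (w $ j)"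
        "lf.tau j w s - lf.tau j w (w $ j) \<le> M * (s - w $ j) / \<kappa> j"
        using lf.tau_bounds[OF wQ[unfolded block_obox] wj in_R(2)[OF s] True, where m=m and M=M] bd' s by auto
      moreover have "0 \<le> m * (s - w $ j) / \<kappa> j" using True m kappa_pos[of j] by simp
      ultimately show ?thesis using lt True lf.tau_self[of j w] by (simp add: abs_less_iff)
    next
      case False
      then have ws: "s \<le> w $ j" by simp
      have "m * (w $ j - s) / \<kappa> j \<le> lf.tau j w (w $ j) - lf.tau j w s"
        "lf.tau j w (w $ j) - lf.tau j w s \<le> M * (w $ j - s) / \<kappa> j"
        using lf.tau_bounds[OF wQ[unfolded block_obox] in_R(2)[OF s] wj ws, where m=m and M=M] bd' s by auto
      moreover have "0 \<le> m * (w $ j - s) / \<kappa> j" using ws m kappa_pos[of j] by simp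
      ultimately show ?thesis using lt ws lf.tau_self[of j w] by (simp add: abs_less_iff)
    qed
  qed
  have st: "step j h (lf.tau j w s) (P w) = P (upd j w s)" if s: "\<bar>s - w $ j\<bar> < r" for s
  proof -
    have s': "\<bar>s - w $ j\<bar> \<le> r" using s by simp
    have "\<bar>s\<bar> < R j" using s r(2) by linarith
    moreover have "lf.sig j (lf.tau j w s) w = s"
      using lf.sig_tau[of w s j] wQ in_R(2)[OF s'] by (simp add: block_obox)
    moreover have "upd j w s \<in> Q" using wQ in_R(2)[OF s'] upd_in_obox[of w Rs j s] by (simp add: block_obox)
    ultimately show ?thesis
      using tau_h[OF s'] w wQ by (auto simp: step_def psi_P P'_def abs_less_iff)
  qed
  have sub: "ennreal (m / \<kappa> j) * (\<integral>\<^sup>+s. indicator {s. \<bar>s - w $ j\<bar> < r} s * F (step j h (lf.tau j w s) (P w)) \<partial>lborel)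
      \<le> (\<integral>\<^sup>+t. indicator {-h<..<h} t * F (step j h t (P w)) \<partial>lborel)"
  proof (rule lf.substitution_lower[where M=M])
    show "w \<in> obox Rs" using wQ by (simp add: block_obox)
    show "\<bar>w $ j\<bar> + r < Rs j" using r(2) R_less(2)[of j] by linarith
    show "m \<le> \<gamma> (upd j w s) \<and> \<gamma> (upd j w s) \<le> M" if "\<bar>s - w $ j\<bar> \<le> r" for s
      using in_R(1)[OF that] bd[OF w] by blast
  qed (use r m Fst in auto)
  have "(\<integral>\<^sup>+y. F y \<partial>kern j h (P w)) = (\<integral>\<^sup>+t. F (step j h t (P w)) \<partial>U h)"
  proof -
    have "(\<lambda>t. step j h t (P w)) \<in> U h \<rightarrow>\<^sub>M borel" using stx U(2)[OF h] by (simp cong: measurable_cong_sets)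
    then show ?thesis unfolding kern_def using F by (intro nn_integral_distr) auto
  qed
  also have "\<dots> = (\<integral>\<^sup>+t. ennreal (indicator {-h..h} t / (2 * h)) * F (step j h t (P w)) \<partial>lborel)"
    unfolding U_def by (intro nn_integral_density) auto
  also have "\<dots> \<ge> (\<integral>\<^sup>+t. ennreal (1 / (2 * h)) * (indicator {-h<..<h} t * F (step j h t (P w))) \<partial>lborel)"
    by (intro nn_integral_mono) (auto simp: indicator_def)
  also have "(\<integral>\<^sup>+t. ennreal (1 / (2 * h)) * (indicator {-h<..<h} t * F (step j h t (P w))) \<partial>lborel)
      = ennreal (1 / (2 * h)) * (\<integral>\<^sup>+t. indicator {-h<..<h} t * F (step j h t (P w)) \<partial>lborel)"
    by (intro nn_integral_cmult) auto
  finally have "ennreal (1 / (2 * h)) * (\<integral>\<^sup>+t. indicator {-h<..<h} t * F (step j h t (P w)) \<partial>lborel) \<le> (\<integral>\<^sup>+y. F y \<partial>kern j h (P w))" .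
  then have "ennreal (1 / (2 * h)) * (ennreal (m / \<kappa> j) * (\<integral>\<^sup>+s. indicator {s. \<bar>s - w $ j\<bar> < r} s * F (step j h (lf.tau j w s) (P w)) \<partial>lborel))
     \<le> (\<integral>\<^sup>+y. F y \<partial>kern j h (P w))"
    using mult_left_mono[OF sub, of "ennreal (1 / (2 * h))"] by (meson order_trans zero_le)
  moreover have "ennreal (1 / (2 * h)) * ennreal (m / \<kappa> j) = ennreal (m / (2 * \<kappa> j) / h)"
    using h m kappa_pos[of j] by (simp add: ennreal_mult[symmetric] field_simps)
  moreover have "(\<integral>\<^sup>+s. indicator {s. \<bar>s - w $ j\<bar> < r} s * F (step j h (lf.tau j w s) (P w)) \<partial>lborel)
     = (\<integral>\<^sup>+s. indicator {s. \<bar>s - w $ j\<bar> < r} s * F (P (upd j w s)) \<partial>lborel)"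
    using st by (intro nn_integral_cong) (auto simp: indicator_def)
  ultimately show ?thesis by (simp add: mult.assoc[symmetric])
qed

text \<open>Collects the constants of one cube in a predicate, so that outside the locale they can
  be chosen cube by cube and then made uniform over finitely many cubes.\<close>

definition admissible where
  "admissible h0 \<alpha> \<beta> \<longleftrightarrow> h0 > 0 \<and> \<alpha> > 0 \<and> \<beta> > 0 \<and>
    (\<forall>j. \<forall>x\<in>QA K \<rho>. \<forall>t. \<bar>t\<bar> < h0 \<longrightarrow> exp_X_defined cs \<rho> K \<gamma> \<theta> j t x) \<and>
    (\<forall>j. \<forall>h\<in>{0<..h0}. rep_kernel (S_op cs \<rho> K \<gamma> \<theta> j h) (kern j h) \<and>
       minorized K \<rho> (\<alpha> / h) (\<beta> * h) j (kern j h))"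

lemma admissible_exists: "\<exists>h0 \<alpha> \<beta>. admissible h0 \<alpha> \<beta>"
proof -
  obtain m M h0 where c: "m > 0" "M > 0" "h0 > 0"
    "\<And>j w s. w \<in> block K \<rho> \<Longrightarrow> \<bar>s\<bar> \<le> R2 j \<Longrightarrow> m \<le> \<gamma> (upd j w s) \<and> \<gamma> (upd j w s) \<le> M"
    "\<And>j w t. w \<in> block K \<rho> \<Longrightarrow> \<bar>t\<bar> < h0 \<Longrightarrow> \<exists>s. \<bar>s\<bar> < R2 j \<and> lf.tau j w s = t"
    using window_const by metis
  have win: "\<exists>s. \<bar>s\<bar> < R2 j \<and> lf.tau j w s = t" if "h \<le> h0" "w \<in> block K \<rho>" "\<bar>t\<bar> < h" for h j w t
    using c(5) that by simp
  \<comment> \<open>The constants for one direction, minimised over the directions next. The 2 in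
    \<kappa> j / (2 * M) turns r \<le> \<beta> * h into the strict inequality M * r / \<kappa> j < h
    of \<open>kern_lower\<close>.\<close>
  have "m / (2 * \<kappa> j) > 0" "\<kappa> j / (2 * M) > 0" for j using c kappa_pos[of j] by auto
  then obtain \<alpha> \<beta> where \<alpha>: "\<alpha> > 0" "\<And>j. \<alpha> \<le> m / (2 * \<kappa> j)" and \<beta>: "\<beta> > 0" "\<And>j. \<beta> \<le> \<kappa> j / (2 * M)"
    using finite_family_lower[of "UNIV :: 'n set" "\<lambda>j. m / (2 * \<kappa> j)"]
      finite_family_lower[of "UNIV :: 'n set" "\<lambda>j. \<kappa> j / (2 * M)"] by (metis UNIV_I finite)
  have "admissible h0 \<alpha> \<beta>"
    unfolding admissible_def
  proof (intro conjI[OF c(3)] conjI[OF \<alpha>(1)] conjI[OF \<beta>(1)] conjI allI ballI impI)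
    fix j x t assume x: "x \<in> QA K \<rho>" and t: "\<bar>t\<bar> < h0"
    obtain w where w: "w \<in> block K \<rho>" "x = P w" using x unfolding QA_eq by blast
    obtain s where s: "\<bar>s\<bar> < R2 j" "lf.tau j w s = t" using c(5)[OF w(1) t] by blast
    have "\<bar>s\<bar> < Rs j" "w \<in> Q" using s(1) R2(2)[of j] w(1) block_subset by auto
    then show "exp_X_defined cs \<rho> K \<gamma> \<theta> j t x" using exp_X_defined_tau s w by blast
  next
    fix j h assume "h \<in> {0<..h0}"
    then show "rep_kernel (S_op cs \<rho> K \<gamma> \<theta> j h) (kern j h)" using win by (intro rep_kernel_kern) auto
  next
    fix j h assume h': "h \<in> {0<..h0}"
    then have h: "0 < h" "h \<le> h0" by auto
    show "minorized K \<rho> (\<alpha> / h) (\<beta> * h) j (kern j h)"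
      unfolding minorized_def
    proof (intro ballI impI)
      fix w r and F :: "'m \<Rightarrow> ennreal"
      assume w: "w \<in> block K \<rho>" and "r \<in> {0<..\<beta> * h}" and F: "F \<in> borel_measurable borel"
        and "\<bar>w $ j\<bar> + r \<le> R j"
      then have r: "0 < r" "r \<le> \<beta> * h" "\<bar>w $ j\<bar> + r \<le> R j" by auto
      have "\<beta> * h \<le> \<kappa> j / (2 * M) * h" using \<beta>(2)[of j] h(1) by (intro mult_right_mono) auto
      then have "r \<le> \<kappa> j / (2 * M) * h" using r(2) by linarith
      then have "M * r \<le> M * (\<kappa> j / (2 * M) * h)" using c(2) by (intro mult_left_mono) auto
      then have "M * r \<le> \<kappa> j * h / 2" using c(2) by simp
      also have "\<dots> < h * \<kappa> j" using h kappa_pos[of j] by simp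
      finally have Mr: "M * r / \<kappa> j < h" using kappa_pos[of j] by (simp add: pos_divide_less_eq)
      have "ennreal (\<alpha> / h) \<le> ennreal (m / (2 * \<kappa> j) / h)"
        using \<alpha>(2)[of j] h by (intro ennreal_leI divide_right_mono) auto
      then have "ennreal (\<alpha> / h) * (\<integral>\<^sup>+s. indicator {s. \<bar>s - w $ j\<bar> < r} s * F (P (upd j w s)) \<partial>lborel)
         \<le> ennreal (m / (2 * \<kappa> j) / h) * (\<integral>\<^sup>+s. indicator {s. \<bar>s - w $ j\<bar> < r} s * F (P (upd j w s)) \<partial>lborel)"
        by (intro mult_right_mono) auto
      also have "\<dots> \<le> (\<integral>\<^sup>+y. F y \<partial>kern j h (P w))"
        by (rule kern_lower[OF win[OF h(2)] h(1) c(4,1) w r(1,3) Mr F])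
      finally show "ennreal (\<alpha> / h) * (\<integral>\<^sup>+s. indicator {s. \<bar>s - w $ j\<bar> < r} s * F (P (upd j w s)) \<partial>lborel) \<le> (\<integral>\<^sup>+y. F y \<partial>kern j h (P w))" .
    qed
  qed
  then show ?thesis by blast
qed

end

section \<open>Assembling the cubes\<close>

context subunit_walk
begin

abbreviation cub :: "real \<Rightarrow> nat \<Rightarrow> ('m, 'n) cube" where "cub \<rho> i \<equiv> D \<rho> (pts \<rho> i)"

lemma cchart_max:
  assumes "0 < \<rho>" "\<rho> \<le> \<rho>0"
  shows "cchart (D \<rho> x) \<in> max_atlas atl"
  using cube_ball[OF assms] balls_normal unfolding normal_chart_def by blast

lemma subunit_cube_K:
  assumes \<rho>: "0 < \<rho>" "\<rho> \<le> \<rho>0" and i: "i < N \<rho>"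
  shows "subunit_cube (cub \<rho> i) \<rho> cs (\<gamma> \<rho> i) (\<theta> \<rho> i)"
proof
  show "is_chart (cchart (cub \<rho> i))" using cchart_max[OF \<rho>] by (simp add: max_atlas_def)
  show "0 < \<rho>" "1 < cs" by (rule \<rho>, rule cs)
  show "cconst (cub \<rho> i) j > 0" for j using cube_const[OF \<rho>] by blast
  show "\<theta> \<rho> i j > 0" for j using theta[OF \<rho> i] .
  \<comment> \<open>The first exponent is 1, so monotonicity makes all of them positive.\<close>
  have "cexp (cub \<rho> i) (Min UNIV) \<le> cexp (cub \<rho> i) j" for j
    using cube_exp[OF \<rho>] by (intro monoD[of "cexp (cub \<rho> i)"]) auto
  then show "cexp (cub \<rho> i) j > 0" for j using cube_exp[OF \<rho>, of "pts \<rho> i"] by (smt (verit))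
  note Phi = Phi_diffeo[OF \<rho>, of "pts \<rho> i", unfolded Let_def]
  show "smooth_on (block (cub \<rho> i) (cs * \<rho>)) (cPhi (cub \<rho> i))"
    "inj_on (cPhi (cub \<rho> i)) (block (cub \<rho> i) (cs * \<rho>))"
    "open (cPhi (cub \<rho> i) ` block (cub \<rho> i) (cs * \<rho>))"
    "smooth_on (cPhi (cub \<rho> i) ` block (cub \<rho> i) (cs * \<rho>)) (inv_into (block (cub \<rho> i) (cs * \<rho>)) (cPhi (cub \<rho> i)))"
    using Phi by blast+
  show "cPhi (cub \<rho> i) ` block (cub \<rho> i) (cs * \<rho>) \<subseteq> img (cchart (cub \<rho> i))"
    using Phi unfolding img_def geodesic_ball_def by blast
  note dens = density[OF \<rho> i, unfolded Let_def]
  show "continuous_on (block (cub \<rho> i) (cs * \<rho>)) (\<gamma> \<rho> i)" using dens smooth_on_continuous by blast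
  show "\<gamma> \<rho> i w > 0" if "w \<in> block (cub \<rho> i) (cs * \<rho>)" for w using dens that by blast
qed

lemma N_pos: assumes "0 < \<rho>" "\<rho> \<le> \<rho>0" shows "N \<rho> > 0"
  using cover[OF assms] by (cases "N \<rho> = 0") auto

text \<open>Each point of an open cube has some margin, so the cubes shrunk by 1 / (m + 1), over all
  m, form an open cover of the manifold. By compactness finitely many m suffice, and the largest of
  them gives a common margin.\<close>

lemma cover_margin:
  assumes \<rho>: "0 < \<rho>" "\<rho> \<le> \<rho>0"
  obtains \<eta> where "\<eta> > 0" "\<And>x. \<exists>i<N \<rho>. \<exists>w. x = Psi_inv (cub \<rho> i) w \<and> (\<forall>j. \<bar>w $ j\<bar> + \<eta> \<le> half_width (cub \<rho> i) \<rho> j)"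
proof -
  let ?R = "\<lambda>i. half_width (cub \<rho> i) \<rho>"
  let ?B = "\<lambda>i m. obox (\<lambda>j. ?R i j - 1 / real (Suc m))"
  let ?V = "\<lambda>m. \<Union>i<N \<rho>. Psi_inv (cub \<rho> i) ` ?B i m"
  have op: "open (?V m)" for m
  proof (intro open_UN ballI)
    fix i assume "i \<in> {..<N \<rho>}"
    then interpret C: subunit_cube "cub \<rho> i" \<rho> cs "\<gamma> \<rho> i" "\<theta> \<rho> i" by (intro subunit_cube_K[OF \<rho>]) simp
    have "?B i m \<subseteq> block (cub \<rho> i) \<rho>"
      unfolding block_obox
    proof
      fix w assume "w \<in> ?B i m"
      then have "\<bar>w $ j\<bar> < ?R i j - 1 / real (Suc m)" for j by (simp add: obox_def)
      moreover have "1 / real (Suc m) > 0" by simp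
      ultimately have "\<bar>w $ j\<bar> < ?R i j" for j by (smt (verit))
      then show "w \<in> obox (half_width (cub \<rho> i) \<rho>)" by (simp add: obox_def)
    qed
    then show "open (Psi_inv (cub \<rho> i) ` ?B i m)"
      using C.block_subset by (intro C.open_P_image open_obox) blast
  qed
  have cov: "UNIV \<subseteq> (\<Union>m\<in>UNIV. ?V m)"
  proof
    fix x :: 'm
    have "x \<in> (\<Union>i<N \<rho>. QA (cub \<rho> i) \<rho>)" using cover[OF \<rho>] by simp
    then obtain i where i: "i < N \<rho>" "x \<in> QA (cub \<rho> i) \<rho>" by blast
    interpret C: subunit_cube "cub \<rho> i" \<rho> cs "\<gamma> \<rho> i" "\<theta> \<rho> i" by (rule subunit_cube_K[OF \<rho> i(1)])
    obtain w where w: "w \<in> obox (half_width (cub \<rho> i) \<rho>)" "x = Psi_inv (cub \<rho> i) w"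
      using i(2) unfolding C.QA_eq block_obox by blast
    have "half_width (cub \<rho> i) \<rho> j - \<bar>w $ j\<bar> > 0" for j using w(1) by (simp add: obox_def)
    then obtain e where e: "e > 0" "\<And>j. e \<le> half_width (cub \<rho> i) \<rho> j - \<bar>w $ j\<bar>"
      using finite_family_lower[of "UNIV :: 'n set" "\<lambda>j. half_width (cub \<rho> i) \<rho> j - \<bar>w $ j\<bar>"] by auto
    obtain m where m: "1 / real (Suc m) < e" using e(1) nat_approx_posE by metis
    have "\<bar>w $ j\<bar> < half_width (cub \<rho> i) \<rho> j - 1 / real (Suc m)" for j using e(2)[of j] m by linarith
    then have "w \<in> ?B i m" unfolding obox_def by blast
    then show "x \<in> (\<Union>m\<in>UNIV. ?V m)" using w(2) i(1) by blast
  qed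
  obtain X where X: "finite X" "UNIV \<subseteq> (\<Union>m\<in>X. ?V m)"
    by (rule compactE_image[OF compact_M op cov])
  define M where "M = Max (insert 0 X)"
  have M: "m \<le> M" if "m \<in> X" for m using X(1) that by (simp add: M_def)
  show ?thesis
  proof (rule that[of "1 / real (Suc M)"])
    show "1 / real (Suc M) > 0" by simp
    fix x :: 'm
    obtain m where m: "m \<in> X" "x \<in> ?V m" using X(2) by blast
    then obtain i w where i: "i < N \<rho>" "x = Psi_inv (cub \<rho> i) w" "w \<in> ?B i m" by blast
    have "1 / real (Suc M) \<le> 1 / real (Suc m)" using M[OF m(1)] by (intro divide_left_mono) auto
    moreover have "\<bar>w $ j\<bar> < ?R i j - 1 / real (Suc m)" for j using i(3) by (simp add: obox_def)
    ultimately have "\<bar>w $ j\<bar> + 1 / real (Suc M) \<le> ?R i j" for j by (smt (verit))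
    then show "\<exists>i<N \<rho>. \<exists>w. x = Psi_inv (cub \<rho> i) w \<and> (\<forall>j. \<bar>w $ j\<bar> + 1 / real (Suc M) \<le> ?R i j)"
      using i by blast
  qed
qed

section \<open>Cube coordinates compared with Riemannian distance and volume\<close>

definition comparable where
  "comparable \<rho> i \<Lambda> V \<longleftrightarrow> \<Lambda> > 0 \<and> V > 0 \<and>
    (\<forall>w. \<forall>r>0. \<forall>y. (\<forall>j. \<bar>w $ j\<bar> + r \<le> half_width (cub \<rho> i) \<rho> j) \<longrightarrow>
      riem_dist atl g (Psi_inv (cub \<rho> i) w) y < r / \<Lambda> \<longrightarrow>
      (\<exists>z. (\<forall>j. \<bar>z $ j - w $ j\<bar> < r) \<and> y = Psi_inv (cub \<rho> i) z)) \<and>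
    (\<forall>E\<in>sets borel. E \<subseteq> block (cub \<rho> i) \<rho> \<longrightarrow> Psi_inv (cub \<rho> i) ` E \<in> sets borel \<and>
      emeasure vol (Psi_inv (cub \<rho> i) ` E) \<le> ennreal V * emeasure lborel E)"

text \<open>The closed block is a compact subset of the dilated block, in which the coordinates and
  their inverse are smooth, so \<open>dist_lower\<close> and \<open>volume_bounded\<close> apply to
  it.\<close>

lemma comparable_exists:
  assumes \<rho>: "0 < \<rho>" "\<rho> \<le> \<rho>0" and i: "i < N \<rho>"
  shows "\<exists>\<Lambda> V. comparable \<rho> i \<Lambda> V"
proof -
  interpret C: subunit_cube "cub \<rho> i" \<rho> cs "\<gamma> \<rho> i" "\<theta> \<rho> i" by (rule subunit_cube_K[OF \<rho> i])
  interpret riemannian atl g by unfold_locales (rule atlas, rule metric)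
  let ?c = "cchart (cub \<rho> i)" and ?B = "{w::'n rvec. \<forall>j. \<bar>w $ j\<bar> \<le> half_width (cub \<rho> i) \<rho> j}"
  have P: "Psi_inv (cub \<rho> i) = (\<lambda>w. par ?c (cPhi (cub \<rho> i) w))" by (simp add: Psi_inv_def[abs_def])
  have BQ: "?B \<subseteq> C.Q"
    unfolding block_obox obox_def using C.R_less(2) by (auto intro: le_less_trans)
  have bB: "block (cub \<rho> i) \<rho> \<subseteq> ?B" unfolding block_obox obox_def by (auto intro: less_imp_le)
  obtain \<Lambda> where \<Lambda>: "\<Lambda> > 0" "\<And>w r y. r > 0 \<Longrightarrow> {z. \<forall>j. \<bar>z $ j - w $ j\<bar> \<le> r} \<subseteq> ?B \<Longrightarrow>
      riem_dist atl g (par ?c (cPhi (cub \<rho> i) w)) y < r / \<Lambda> \<Longrightarrow>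
      \<exists>z. (\<forall>j. \<bar>z $ j - w $ j\<bar> < r) \<and> y = par ?c (cPhi (cub \<rho> i) z)"
    by (rule dist_lower[OF connected_M cchart_max[OF \<rho>] smooth_on_continuous[OF C.Phi(1)] C.Phi(5,3,4) C.f_Phi compact_closed_box BQ])
      (assumption, rule that)
  obtain V where V: "V > 0" "\<And>E. E \<in> sets borel \<Longrightarrow> E \<subseteq> ?B \<Longrightarrow>
      (\<lambda>w. par ?c (cPhi (cub \<rho> i) w)) ` E \<in> sets borel \<and>
      emeasure vol ((\<lambda>w. par ?c (cPhi (cub \<rho> i) w)) ` E) \<le> ennreal V * emeasure lborel E"
    by (rule volume_bounded[OF volume cchart_max[OF \<rho>] C.open_Q(1) C.Phi(1,5,3) smooth_on_continuous[OF C.Phi(4)] C.f_Phi compact_closed_box BQ])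
      (assumption, rule that)
  have "comparable \<rho> i \<Lambda> V"
    unfolding comparable_def
  proof (intro conjI[OF \<Lambda>(1)] conjI[OF V(1)] conjI allI ballI impI)
    fix w :: "'n rvec" and r y assume r: "r > 0" and w: "\<forall>j. \<bar>w $ j\<bar> + r \<le> half_width (cub \<rho> i) \<rho> j"
      and dd: "riem_dist atl g (Psi_inv (cub \<rho> i) w) y < r / \<Lambda>"
    have "{z. \<forall>j. \<bar>z $ j - w $ j\<bar> \<le> r} \<subseteq> ?B"
    proof clarify
      fix z j assume "\<forall>j. \<bar>z $ j - w $ j\<bar> \<le> r"
      then have "\<bar>z $ j - w $ j\<bar> \<le> r" by blast
      then show "\<bar>z $ j\<bar> \<le> half_width (cub \<rho> i) \<rho> j" using spec[OF w, of j] by linarith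
    qed
    from \<Lambda>(2)[OF r this] dd show "\<exists>z. (\<forall>j. \<bar>z $ j - w $ j\<bar> < r) \<and> y = Psi_inv (cub \<rho> i) z"
      by (simp add: P)
  next
    fix E :: "'n rvec set" assume "E \<in> sets borel" "E \<subseteq> block (cub \<rho> i) \<rho>"
    then show "Psi_inv (cub \<rho> i) ` E \<in> sets borel" "emeasure vol (Psi_inv (cub \<rho> i) ` E) \<le> ennreal V * emeasure lborel E"
      using V(2)[of E] bB unfolding P by auto
  qed
  then show ?thesis by blast
qed

section \<open>The kernel of the averaged walk\<close>

lemma S_total_eq:
  fixes K :: "nat \<Rightarrow> ('m, 'n) cube"
  shows "S_total cs \<rho> n K \<gamma>' \<theta>' h f x =
    1 / real (card ({..<n} \<times> (UNIV :: 'n set))) * (\<Sum>p\<in>{..<n} \<times> UNIV. S_op cs \<rho> (K (fst p)) (\<gamma>' (fst p)) (\<theta>' (fst p)) (snd p) h f x)"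
  unfolding S_total_def by (simp add: sum.cartesian_product card_cartesian_product split_def mult.commute)

text \<open>The constants are minimised over the cubes, and the weight of each pair of cube and
  direction in the average is absorbed into the density constant.\<close>

lemma averaged_kernel:
  assumes \<rho>: "0 < \<rho>" "\<rho> \<le> \<rho>0"
  obtains h0 \<alpha> \<beta> where "h0 > 0" "\<alpha> > 0" "\<beta> > 0"
    "\<And>i j x t. i < N \<rho> \<Longrightarrow> x \<in> QA (cub \<rho> i) \<rho> \<Longrightarrow> \<bar>t\<bar> < h0 \<Longrightarrow>
      exp_X_defined cs \<rho> (cub \<rho> i) (\<gamma> \<rho> i) (\<theta> \<rho> i) j t x"
    "\<And>h. 0 < h \<Longrightarrow> h \<le> h0 \<Longrightarrow> \<exists>L. rep_kernel (S_total cs \<rho> (N \<rho>) (cub \<rho>) (\<gamma> \<rho>) (\<theta> \<rho>) h) L \<and>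
      (\<forall>i<N \<rho>. \<forall>j. minorized (cub \<rho> i) \<rho> (\<alpha> / h) (\<beta> * h) j L)"
proof -
  let ?kern = "\<lambda>i. subunit_cube.kern (cub \<rho> i) \<rho> cs (\<gamma> \<rho> i) (\<theta> \<rho> i)"
  let ?adm = "\<lambda>i. subunit_cube.admissible (cub \<rho> i) \<rho> cs (\<gamma> \<rho> i) (\<theta> \<rho> i)"
  note adm_def = subunit_cube.admissible_def[OF subunit_cube_K[OF \<rho>]]
  obtain hh aa bb where adm: "\<And>i. i < N \<rho> \<Longrightarrow> ?adm i (hh i) (aa i) (bb i)"
    using subunit_cube.admissible_exists[OF subunit_cube_K[OF \<rho>]] by metis
  have pos: "hh i > 0" "aa i > 0" "bb i > 0" if "i \<in> {..<N \<rho>}" for i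
    using adm[of i] adm_def[of i] that by auto
  have defd: "exp_X_defined cs \<rho> (cub \<rho> i) (\<gamma> \<rho> i) (\<theta> \<rho> i) j t x"
    if "i < N \<rho>" "x \<in> QA (cub \<rho> i) \<rho>" "\<bar>t\<bar> < hh i" for i j x t
    using adm[OF that(1)] adm_def[OF that(1)] that(2,3) by blast
  have kern: "rep_kernel (S_op cs \<rho> (cub \<rho> i) (\<gamma> \<rho> i) (\<theta> \<rho> i) j h) (?kern i j h)"
    "minorized (cub \<rho> i) \<rho> (aa i / h) (bb i * h) j (?kern i j h)" if "i < N \<rho>" "h \<in> {0<..hh i}" for i j h
    using adm[OF that(1)] adm_def[OF that(1)] that(2) by blast+
  obtain h0 where h0: "h0 > 0" "\<And>i. i \<in> {..<N \<rho>} \<Longrightarrow> h0 \<le> hh i"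
    by (rule finite_family_lower[of "{..<N \<rho>}" hh, OF finite_lessThan pos(1)]) (assumption, rule that)
  obtain \<alpha> where \<alpha>: "\<alpha> > 0" "\<And>i. i \<in> {..<N \<rho>} \<Longrightarrow> \<alpha> \<le> aa i"
    by (rule finite_family_lower[of "{..<N \<rho>}" aa, OF finite_lessThan pos(2)]) (assumption, rule that)
  obtain \<beta> where \<beta>: "\<beta> > 0" "\<And>i. i \<in> {..<N \<rho>} \<Longrightarrow> \<beta> \<le> bb i"
    by (rule finite_family_lower[of "{..<N \<rho>}" bb, OF finite_lessThan pos(3)]) (assumption, rule that)
  let ?J = "{..<N \<rho>} \<times> (UNIV :: 'n set)"
  have J: "finite ?J" "?J \<noteq> {}" using N_pos[OF \<rho>] by auto
  then have "card ?J > 0" by (intro card_gt_0_iff[THEN iffD2] conjI)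
  then have cJ: "real (card ?J) > 0" by (simp only: of_nat_0_less_iff)
  define \<alpha>' where "\<alpha>' = 1 / real (card ?J) * \<alpha>"
  have \<alpha>': "\<alpha>' > 0" using cJ \<alpha> by (simp add: \<alpha>'_def)
  show ?thesis
  proof (rule that[OF h0(1) \<alpha>' \<beta>(1)])
    fix i j x t assume "i < N \<rho>" "x \<in> QA (cub \<rho> i) \<rho>" "\<bar>t\<bar> < h0"
    then show "exp_X_defined cs \<rho> (cub \<rho> i) (\<gamma> \<rho> i) (\<theta> \<rho> i) j t x"
      using defd h0(2)[of i] by (meson lessThan_iff less_le_trans)
  next
    fix h :: real assume h: "0 < h" "h \<le> h0"
    let ?S = "S_total cs \<rho> (N \<rho>) (cub \<rho>) (\<gamma> \<rho>) (\<theta> \<rho>) h"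
    have rep: "rep_kernel (S_op cs \<rho> (cub \<rho> (fst p)) (\<gamma> \<rho> (fst p)) (\<theta> \<rho> (fst p)) (snd p) h) (?kern (fst p) (snd p) h)"
      if "p \<in> ?J" for p
      using h0(2)[of "fst p"] h that by (intro kern(1)) auto
    obtain L where L: "rep_kernel ?S L"
      "\<And>F x p. p \<in> ?J \<Longrightarrow> F \<in> borel_measurable borel \<Longrightarrow>
        ennreal (1 / real (card ?J)) * (\<integral>\<^sup>+y. F y \<partial>?kern (fst p) (snd p) h x) \<le> (\<integral>\<^sup>+y. F y \<partial>L x)"
      by (rule rep_kernel_average[OF J rep S_total_eq]) (assumption, rule that)
    have "minorized (cub \<rho> i) \<rho> (\<alpha>' / h) (\<beta> * h) j L" if i: "i < N \<rho>" for i j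
      unfolding minorized_def
    proof (intro ballI impI)
      fix w r and F :: "'m \<Rightarrow> ennreal" assume w: "w \<in> block (cub \<rho> i) \<rho>" and r: "r \<in> {0<..\<beta> * h}"
        and F: "F \<in> borel_measurable borel" and wr: "\<bar>w $ j\<bar> + r \<le> half_width (cub \<rho> i) \<rho> j"
      let ?X = "\<integral>\<^sup>+s. indicator {s. \<bar>s - w $ j\<bar> < r} s * F (Psi_inv (cub \<rho> i) (upd j w s)) \<partial>lborel"
      have hi: "h \<le> hh i" "\<alpha> \<le> aa i" "\<beta> \<le> bb i" using h0(2)[of i] \<alpha>(2)[of i] \<beta>(2)[of i] h i by auto
      have "\<beta> * h \<le> bb i * h" using hi(3) h(1) by (intro mult_right_mono) auto
      then have ri: "r \<in> {0<..bb i * h}" using r by auto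
      have k: "ennreal (aa i / h) * ?X \<le> (\<integral>\<^sup>+y. F y \<partial>?kern i j h (Psi_inv (cub \<rho> i) w))"
        using kern(2)[OF i, of h j] h(1) hi(1) w ri wr F unfolding minorized_def by auto
      have "ennreal (\<alpha>' / h) * ?X = ennreal (1 / real (card ?J)) * (ennreal (\<alpha> / h) * ?X)"
        using \<alpha>(1) h(1) unfolding \<alpha>'_def by (simp add: ennreal_mult[symmetric] mult.assoc[symmetric])
      also have "\<dots> \<le> ennreal (1 / real (card ?J)) * (ennreal (aa i / h) * ?X)"
        using hi(2) h(1) by (intro mult_left_mono mult_right_mono ennreal_leI divide_right_mono) auto
      also have "\<dots> \<le> ennreal (1 / real (card ?J)) * (\<integral>\<^sup>+y. F y \<partial>?kern i j h (Psi_inv (cub \<rho> i) w))"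
        by (rule mult_left_mono[OF k]) simp
      also have "\<dots> \<le> (\<integral>\<^sup>+y. F y \<partial>L (Psi_inv (cub \<rho> i) w))"
        using L(2)[of "(i, j)" F "Psi_inv (cub \<rho> i) w"] i F by simp
      finally show "ennreal (\<alpha>' / h) * ?X \<le> (\<integral>\<^sup>+y. F y \<partial>L (Psi_inv (cub \<rho> i) w))" .
    qed
    then show "\<exists>L. rep_kernel ?S L \<and> (\<forall>i<N \<rho>. \<forall>j. minorized (cub \<rho> i) \<rho> (\<alpha>' / h) (\<beta> * h) j L)"
      using L(1) by blast
  qed
qed

text \<open>One step per direction, all within the cube of index i, makes the iterated kernel
  dominate a multiple of Lebesgue measure on the box about w. E is the part of this box that is
  mapped into B.\<close>

lemma kernel_lower_bound:
  assumes \<rho>: "0 < \<rho>" "\<rho> \<le> \<rho>0" and i: "i < N \<rho>"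
    and L: "L \<in> borel \<rightarrow>\<^sub>M prob_algebra borel"
    and step: "\<And>j. minorized (cub \<rho> i) \<rho> a0 r j L"
    and r: "0 < r" and w: "\<And>j. \<bar>w $ j\<bar> + r \<le> half_width (cub \<rho> i) \<rho> j"
    and B: "B \<in> sets borel"
  obtains E where "E \<in> sets borel" "E \<subseteq> block (cub \<rho> i) \<rho>"
    "\<And>z. (\<forall>j. \<bar>z $ j - w $ j\<bar> < r) \<Longrightarrow> Psi_inv (cub \<rho> i) z \<in> B \<Longrightarrow> z \<in> E"
    "ennreal a0 ^ CARD('n) * emeasure lborel E \<le> emeasure (kernel_pow L CARD('n) (Psi_inv (cub \<rho> i) w)) B"
proof -
  interpret C: subunit_cube "cub \<rho> i" \<rho> cs "\<gamma> \<rho> i" "\<theta> \<rho> i" by (rule subunit_cube_K[OF \<rho> i])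
  let ?P = "Psi_inv (cub \<rho> i)" and ?Rv = "\<chi> j. half_width (cub \<rho> i) \<rho> j"
  let ?O = "{z. \<forall>b\<in>Basis. \<bar>z \<bullet> b - w \<bullet> b\<bar> < r}"
  define E where "E = ?O \<inter> C.P' -` B"
  \<comment> \<open>The basis vectors are the axes, which translates the minorization for a general
    Euclidean space into components.\<close>
  have Basis: "b \<in> Basis \<longleftrightarrow> (\<exists>j. b = axis j 1)" for b :: "'n rvec"
    by (auto simp: Basis_vec_def)
  have ax: "z \<bullet> axis j 1 = z $ j" for z :: "'n rvec" and j by (simp add: inner_axis)
  have axB: "axis j 1 \<in> (Basis :: 'n rvec set)" for j unfolding Basis by blast
  have ball_Basis: "(\<forall>b\<in>Basis. p b) \<longleftrightarrow> (\<forall>j. p (axis j 1))" for p :: "'n rvec \<Rightarrow> bool"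
    unfolding Ball_def Basis by blast
  have O_iff: "z \<in> ?O \<longleftrightarrow> (\<forall>j. \<bar>z $ j - w $ j\<bar> < r)" for z
    by (simp add: ball_Basis ax)
  have O_block: "?O \<subseteq> block (cub \<rho> i) \<rho>"
  proof
    fix z assume "z \<in> ?O"
    then have "\<bar>z $ j - w $ j\<bar> < r" for j using O_iff by blast
    then have "\<bar>z $ j\<bar> < half_width (cub \<rho> i) \<rho> j" for j using w[of j] by (smt (verit))
    then show "z \<in> block (cub \<rho> i) \<rho>" by (simp add: block_obox obox_def)
  qed
  have P'P: "C.P' z = ?P z" if "z \<in> block (cub \<rho> i) \<rho>" for z
    using that C.block_subset by (auto simp: C.P'_def)
  have oO: "open ?O"
    unfolding Collect_ball_eq by (intro open_INT ballI open_Collect_less continuous_intros) auto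
  have Eb: "E \<in> sets borel"
    unfolding E_def using oO measurable_sets[OF C.P'_measurable B] by (intro sets.Int) auto
  have w_block: "w \<in> block (cub \<rho> i) \<rho>" using O_block O_iff[of w] r by auto
  have min: "ennreal a0 ^ DIM('n rvec) * (\<integral>\<^sup>+z. indicator ?O z * indicator B (C.P' z) \<partial>lborel)
    \<le> (\<integral>\<^sup>+y. indicator B y \<partial>kernel_pow L DIM('n rvec) (C.P' w))"
  proof (rule kernel_minorization_lborel[OF L C.P'_measurable r, where R="\<lambda>b. ?Rv \<bullet> b"])
    show "\<bar>w \<bullet> b\<bar> + r \<le> ?Rv \<bullet> b" if "b \<in> Basis" for b using that w by (auto simp: Basis ax)
    fix w' b :: "'n rvec" and F :: "'m \<Rightarrow> ennreal"
    assume a1: "\<And>b. b \<in> Basis \<Longrightarrow> \<bar>w' \<bullet> b\<bar> < ?Rv \<bullet> b" and b: "b \<in> Basis" "\<bar>w' \<bullet> b\<bar> + r \<le> ?Rv \<bullet> b"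
      and F: "F \<in> borel_measurable borel"
    obtain j where j: "b = axis j 1" using b(1) Basis by blast
    have "\<bar>w' $ k\<bar> < half_width (cub \<rho> i) \<rho> k" for k using a1[OF axB[of k]] by (simp add: ax)
    then have w': "w' \<in> block (cub \<rho> i) \<rho>" by (simp add: block_obox obox_def)
    have wj: "\<bar>w' $ j\<bar> + r \<le> half_width (cub \<rho> i) \<rho> j" using b(2) by (simp add: j ax)
    have "(\<integral>\<^sup>+s. indicator {s. \<bar>s - w' \<bullet> b\<bar> < r} s * F (C.P' (w' + (s - w' \<bullet> b) *\<^sub>R b)) \<partial>lborel)
      = (\<integral>\<^sup>+s. indicator {s. \<bar>s - w' $ j\<bar> < r} s * F (?P (upd j w' s)) \<partial>lborel)"
    proof (rule nn_integral_cong)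
      fix s :: real
      show "indicator {s. \<bar>s - w' \<bullet> b\<bar> < r} s * F (C.P' (w' + (s - w' \<bullet> b) *\<^sub>R b))
        = indicator {s. \<bar>s - w' $ j\<bar> < r} s * F (?P (upd j w' s))"
      proof (cases "\<bar>s - w' $ j\<bar> < r")
        case True
        then have "\<bar>s\<bar> < half_width (cub \<rho> i) \<rho> j" using wj by linarith
        then have "upd j w' s \<in> block (cub \<rho> i) \<rho>" using w' by (simp add: block_obox upd_in_obox)
        then have "C.P' (upd j w' s) = ?P (upd j w' s)" by (rule P'P)
        then show ?thesis by (simp add: j ax upd_def)
      qed (simp add: j ax)
    qed
    then show "ennreal a0 * (\<integral>\<^sup>+s. indicator {s. \<bar>s - w' \<bullet> b\<bar> < r} s * F (C.P' (w' + (s - w' \<bullet> b) *\<^sub>R b)) \<partial>lborel)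
      \<le> (\<integral>\<^sup>+y. F y \<partial>L (C.P' w'))"
      using step[of j] w' wj F r unfolding minorized_def by (simp only: P'P[OF w']) simp
  qed (use B in simp)
  show ?thesis
  proof (rule that[OF Eb])
    show "E \<subseteq> block (cub \<rho> i) \<rho>" using O_block by (auto simp: E_def)
    fix z assume z: "\<forall>j. \<bar>z $ j - w $ j\<bar> < r" "?P z \<in> B"
    have zO: "z \<in> ?O" using z(1) O_iff by blast
    have "C.P' z \<in> B" using P'P[OF subsetD[OF O_block zO]] z(2) by simp
    then show "z \<in> E" using zO unfolding E_def by (intro IntI vimageI2)
  next
    have "(\<integral>\<^sup>+z. indicator ?O z * indicator B (C.P' z) \<partial>lborel) = (\<integral>\<^sup>+z. indicator E z \<partial>lborel)"
      unfolding E_def by (intro nn_integral_cong) (auto simp: indicator_def)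
    also have "\<dots> = emeasure lborel E" using Eb by simp
    finally have e1: "(\<integral>\<^sup>+z. indicator ?O z * indicator B (C.P' z) \<partial>lborel) = emeasure lborel E" .
    have "B \<in> sets (kernel_pow L CARD('n) (?P w))"
      using B prob_kernelD(2)[OF kernel_pow_measurable[OF L]] by blast
    then have e2: "(\<integral>\<^sup>+y. indicator B y \<partial>kernel_pow L CARD('n) (?P w)) = emeasure (kernel_pow L CARD('n) (?P w)) B"
      by (rule nn_integral_indicator)
    show "ennreal a0 ^ CARD('n) * emeasure lborel E \<le> emeasure (kernel_pow L CARD('n) (?P w)) B"
      using min e2 by (simp add: e1 P'P[OF w_block])
  qed
qed

text \<open>The scaled volume on the ball is dominated by the iterated kernel on every Borel set and
  both are finite measures, so their difference is a measure: the remainder.\<close>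

lemma kernel_decomposition:
  assumes \<rho>: "\<rho> \<in> {0<..\<rho>0}"
  shows "\<exists>h0 c \<delta>. 0 < h0 \<and> 0 < c \<and> 0 < \<delta> \<and>
    (\<forall>i<N \<rho>. \<forall>j. \<forall>x\<in>QA (D \<rho> (pts \<rho> i)) \<rho>. \<forall>t. \<bar>t\<bar> < h0 \<longrightarrow>
       exp_X_defined cs \<rho> (D \<rho> (pts \<rho> i)) (\<gamma> \<rho> i) (\<theta> \<rho> i) j t x) \<and>
    (\<forall>x. \<forall>h\<in>{0<..h0}. \<exists>r :: 'm measure. sets r = sets borel \<and>
       (\<forall>B\<in>sets borel.
          emeasure (markov_kernel
            (S_total cs \<rho> (N \<rho>) (\<lambda>i. D \<rho> (pts \<rho> i)) (\<gamma> \<rho>) (\<theta> \<rho>) h) CARD('n) x) B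
          = emeasure r B +
            (\<integral>\<^sup>+y\<in>B. (ennreal (c / h ^ CARD('n)) *
               indicator {y. riem_dist atl g x y < \<delta> * h} y) \<partial>vol)))"
proof -
  have \<rho>': "0 < \<rho>" "\<rho> \<le> \<rho>0" using \<rho> by auto
  interpret rm: riemannian atl g by unfold_locales (rule atlas, rule metric)
  let ?S = "S_total cs \<rho> (N \<rho>) (cub \<rho>) (\<gamma> \<rho>) (\<theta> \<rho>)"
  obtain h1 \<alpha> \<beta> where h1: "h1 > 0" and \<alpha>: "\<alpha> > 0" and \<beta>: "\<beta> > 0"
    and def: "\<And>i j x t. i < N \<rho> \<Longrightarrow> x \<in> QA (cub \<rho> i) \<rho> \<Longrightarrow> \<bar>t\<bar> < h1 \<Longrightarrow>
      exp_X_defined cs \<rho> (cub \<rho> i) (\<gamma> \<rho> i) (\<theta> \<rho> i) j t x"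
    and ker: "\<And>h. 0 < h \<Longrightarrow> h \<le> h1 \<Longrightarrow> \<exists>L. rep_kernel (?S h) L \<and>
      (\<forall>i<N \<rho>. \<forall>j. minorized (cub \<rho> i) \<rho> (\<alpha> / h) (\<beta> * h) j L)"
    by (rule averaged_kernel[OF \<rho>']) (rule that)
  obtain \<eta> where \<eta>: "\<eta> > 0" "\<And>x. \<exists>i<N \<rho>. \<exists>w. x = Psi_inv (cub \<rho> i) w \<and> (\<forall>j. \<bar>w $ j\<bar> + \<eta> \<le> half_width (cub \<rho> i) \<rho> j)"
    using cover_margin[OF \<rho>'] by metis
  obtain LL CC where geo: "\<And>i. i < N \<rho> \<Longrightarrow> comparable \<rho> i (LL i) (CC i)"
    using comparable_exists[OF \<rho>'] by metis
  obtain \<Lambda> where \<Lambda>: "\<Lambda> > 0" "\<And>i. i \<in> {..<N \<rho>} \<Longrightarrow> LL i \<le> \<Lambda>"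
    by (rule finite_family_upper[of "{..<N \<rho>}" LL, OF finite_lessThan]) (rule that)
  obtain C where C: "C > 0" "\<And>i. i \<in> {..<N \<rho>} \<Longrightarrow> CC i \<le> C"
    by (rule finite_family_upper[of "{..<N \<rho>}" CC, OF finite_lessThan]) (rule that)
  \<comment> \<open>h0 keeps the half-width \<beta> * h of the box within the margin \<eta>; c sets
    the n factors \<alpha> / h against the volume constant C; \<delta> makes the ball of radius
    \<delta> * h fit into the image of this box.\<close>
  define h0 where "h0 = min h1 (\<eta> / \<beta>)"
  define c where "c = \<alpha> ^ CARD('n) / C"
  define \<delta> where "\<delta> = \<beta> / \<Lambda>"
  have pos: "0 < h0" "0 < c" "0 < \<delta>"
    using h1 \<alpha> \<beta> \<eta>(1) C(1) \<Lambda>(1) by (auto simp: h0_def c_def \<delta>_def)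
  have "\<exists>r :: 'm measure. sets r = sets borel \<and> (\<forall>B\<in>sets borel.
          emeasure (markov_kernel (?S h) CARD('n) x) B = emeasure r B +
            (\<integral>\<^sup>+y\<in>B. (ennreal (c / h ^ CARD('n)) * indicator {y. riem_dist atl g x y < \<delta> * h} y) \<partial>vol))"
    if h: "h \<in> {0<..h0}" for x h
  proof -
    have hp: "0 < h" "h \<le> h1" "\<beta> * h \<le> \<eta>"
    proof -
      show "0 < h" "h \<le> h1" using h by (auto simp: h0_def)
      have "h \<le> \<eta> / \<beta>" using h by (simp add: h0_def)
      then show "\<beta> * h \<le> \<eta>" using \<beta> by (simp add: pos_le_divide_eq mult.commute)
    qed
    obtain L where rep: "rep_kernel (?S h) L" and
      Lstep: "\<And>i j. i < N \<rho> \<Longrightarrow> minorized (cub \<rho> i) \<rho> (\<alpha> / h) (\<beta> * h) j L"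
      using ker[OF hp(1,2)] by blast
    have L: "L \<in> borel \<rightarrow>\<^sub>M prob_algebra borel" using rep by (simp add: rep_kernel_def)
    let ?M = "kernel_pow L CARD('n) x"
    have mk: "markov_kernel (?S h) CARD('n) x = ?M" by (rule markov_kernel_eq[OF rep])
    interpret M: prob_space ?M by (rule prob_kernelD(1)[OF kernel_pow_measurable[OF L]])
    have sM: "sets ?M = sets borel" by (rule prob_kernelD(2)[OF kernel_pow_measurable[OF L]])
    have sv: "sets vol = sets borel" using volume by (simp add: riemannian_volume_def)
    let ?ball = "{y. riem_dist atl g x y < \<delta> * h}"
    have ob: "?ball \<in> sets borel" using rm.open_riem_ball[OF connected_M] by simp
    let ?q = "\<lambda>y. ennreal (c / h ^ CARD('n)) * indicator ?ball y"
    let ?V = "density vol ?q"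
    have q: "?q \<in> borel_measurable vol"
      using ob by (intro borel_measurable_times_ennreal borel_measurable_indicator borel_measurable_const) (simp add: sv)
    have VB: "emeasure ?V B = (\<integral>\<^sup>+y\<in>B. ?q y \<partial>vol)" if "B \<in> sets borel" for B
      using that by (intro emeasure_density q) (simp add: sv)
    have le: "emeasure ?V B \<le> emeasure ?M B" if B: "B \<in> sets borel" for B
    proof -
      obtain i w where i: "i < N \<rho>" "x = Psi_inv (cub \<rho> i) w" "\<And>j. \<bar>w $ j\<bar> + \<eta> \<le> half_width (cub \<rho> i) \<rho> j"
        using \<eta>(2)[of x] by blast
      let ?r = "\<beta> * h"
      have r: "0 < ?r" using \<beta> hp by simp
      have wr: "\<bar>w $ j\<bar> + ?r \<le> half_width (cub \<rho> i) \<rho> j" for j using i(3)[of j] hp(3) by linarith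
      obtain E where E: "E \<in> sets borel" "E \<subseteq> block (cub \<rho> i) \<rho>"
        "\<And>z. (\<forall>j. \<bar>z $ j - w $ j\<bar> < ?r) \<Longrightarrow> Psi_inv (cub \<rho> i) z \<in> B \<Longrightarrow> z \<in> E"
        "ennreal (\<alpha> / h) ^ CARD('n) * emeasure lborel E \<le> emeasure (kernel_pow L CARD('n) (Psi_inv (cub \<rho> i) w)) B"
        by (rule kernel_lower_bound[OF \<rho>' i(1) L Lstep[OF i(1)] r wr B]) (rule that)
      have gi: "LL i > 0" "LL i \<le> \<Lambda>" "CC i \<le> C" using geo[OF i(1)] \<Lambda>(2)[of i] C(2)[of i] i(1) by (auto simp: comparable_def)
      have "?r / \<Lambda> \<le> ?r / LL i" using gi r by (intro divide_left_mono) auto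
      then have dl: "\<delta> * h \<le> ?r / LL i" by (simp add: \<delta>_def)
      have sub: "B \<inter> ?ball \<subseteq> Psi_inv (cub \<rho> i) ` E"
      proof
        fix y assume y: "y \<in> B \<inter> ?ball"
        then have "riem_dist atl g (Psi_inv (cub \<rho> i) w) y < ?r / LL i" using dl i(2) by auto
        then obtain z where z: "\<forall>j. \<bar>z $ j - w $ j\<bar> < ?r" "y = Psi_inv (cub \<rho> i) z"
          using geo[OF i(1)] r wr unfolding comparable_def by blast
        then have "z \<in> E" using E(3) y by blast
        then show "y \<in> Psi_inv (cub \<rho> i) ` E" using z(2) by blast
      qed
      have PE: "Psi_inv (cub \<rho> i) ` E \<in> sets borel" "emeasure vol (Psi_inv (cub \<rho> i) ` E) \<le> ennreal (CC i) * emeasure lborel E"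
        using geo[OF i(1)] E(1,2) unfolding comparable_def by blast+
      have "emeasure ?V B = (\<integral>\<^sup>+y. ennreal (c / h ^ CARD('n)) * indicator (B \<inter> ?ball) y \<partial>vol)"
        unfolding VB[OF B] by (intro nn_integral_cong) (auto simp: indicator_def)
      also have "\<dots> = ennreal (c / h ^ CARD('n)) * emeasure vol (B \<inter> ?ball)"
        using B ob by (intro nn_integral_cmult_indicator) (simp add: sv sets.Int)
      also have "\<dots> \<le> ennreal (c / h ^ CARD('n)) * (ennreal C * emeasure lborel E)"
      proof (rule mult_left_mono)
        have "emeasure vol (B \<inter> ?ball) \<le> emeasure vol (Psi_inv (cub \<rho> i) ` E)"
          using sub PE(1) by (intro emeasure_mono) (simp_all add: sv)
        also note PE(2)
        also have "ennreal (CC i) * emeasure lborel E \<le> ennreal C * emeasure lborel E"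
          using gi(3) by (intro mult_right_mono ennreal_leI) auto
        finally show "emeasure vol (B \<inter> ?ball) \<le> ennreal C * emeasure lborel E" .
      qed simp
      also have "\<dots> = ennreal (\<alpha> / h) ^ CARD('n) * emeasure lborel E"
      proof -
        have "ennreal (c / h ^ CARD('n)) * ennreal C = ennreal ((\<alpha> / h) ^ CARD('n))"
          using pos(2) C(1) hp(1) \<alpha> by (simp add: ennreal_mult[symmetric] c_def power_divide)
        also have "\<dots> = ennreal (\<alpha> / h) ^ CARD('n)" using \<alpha> hp(1) by (simp add: ennreal_power)
        finally show ?thesis by (simp add: mult.assoc[symmetric])
      qed
      also have "\<dots> \<le> emeasure ?M B" using E(4) i(2) by simp
      finally show ?thesis .
    qed
    have sV: "space ?V = UNIV" using sv by (metis sets_eq_imp_space_eq space_borel space_density)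
    \<comment> \<open>Domination on the whole space passes the finiteness of the probability kernel
      on to the scaled volume, as subtraction of measures demands.\<close>
    have "emeasure ?V UNIV \<le> emeasure ?M UNIV" by (rule le) simp
    also have "\<dots> < \<infinity>" using M.emeasure_finite by (simp add: less_top[symmetric])
    finally have V1: "emeasure ?V UNIV \<noteq> \<infinity>" by (rule less_imp_neq)
    have "finite_measure ?V" by (rule finite_measureI) (rule V1[folded sV])
    moreover have "finite_measure ?M" by unfold_locales
    ultimately have dm: "emeasure (diff_measure ?M ?V) B = emeasure ?M B - emeasure ?V B" if "B \<in> sets borel" for B
      using le that sM sv by (intro emeasure_diff_measure) auto
    show ?thesis
    proof (intro exI[of _ "diff_measure ?M ?V"] conjI ballI)
      show "sets (diff_measure ?M ?V) = sets borel" by (simp add: sM)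
      fix B :: "'m set" assume B: "B \<in> sets borel"
      show "emeasure (markov_kernel (?S h) CARD('n) x) B = emeasure (diff_measure ?M ?V) B + (\<integral>\<^sup>+y\<in>B. ?q y \<partial>vol)"
        unfolding mk dm[OF B] VB[OF B, symmetric] using le[OF B] by (simp add: diff_add_cancel_ennreal)
    qed
  qed
  moreover have "\<forall>i<N \<rho>. \<forall>j. \<forall>x\<in>QA (D \<rho> (pts \<rho> i)) \<rho>. \<forall>t. \<bar>t\<bar> < h0 \<longrightarrow>
       exp_X_defined cs \<rho> (D \<rho> (pts \<rho> i)) (\<gamma> \<rho> i) (\<theta> \<rho> i) j t x"
    using def by (auto simp: h0_def)
  ultimately show ?thesis using pos by blast
qed

end

text \<open>Choice turns the constants found for each \<rho> into functions of \<rho>.\<close>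

lemma bchoice3:
  assumes "\<And>x. x \<in> A \<Longrightarrow> \<exists>a b c. Q x a b c"
  shows "\<exists>f g h. \<forall>x\<in>A. Q x (f x) (g x) (h x)"
  using assms by metis

theorem theorem4p1:
  fixes atl :: "('m::t2_space, 'n::{finite,linorder}) chart set"
    and g :: "('m, 'n) chart \<Rightarrow> 'n rvec \<Rightarrow> 'n rmat"
    and vol :: "'m measure"
    and A :: "('m \<Rightarrow> real) \<Rightarrow> 'm \<Rightarrow> real"
    and a :: "('m, 'n) chart \<Rightarrow> 'n rvec \<Rightarrow> 'n rmat"
    and b :: "('m, 'n) chart \<Rightarrow> 'n rvec \<Rightarrow> 'n rvec"
    and d :: "('m, 'n) chart \<Rightarrow> 'n rvec \<Rightarrow> real"
    and \<epsilon> \<rho>0 cs :: real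
    and balls :: "(('m, 'n) chart \<times> real) set"
    and D :: "real \<Rightarrow> 'm \<Rightarrow> ('m, 'n) cube"
    and N :: "real \<Rightarrow> nat"
    and pts :: "real \<Rightarrow> nat \<Rightarrow> 'm"
    and \<psi> :: "real \<Rightarrow> nat \<Rightarrow> 'm \<Rightarrow> real"
    and \<gamma> :: "real \<Rightarrow> nat \<Rightarrow> 'n rvec \<Rightarrow> real"
    and \<theta> :: "real \<Rightarrow> nat \<Rightarrow> 'n \<Rightarrow> real"
  assumes "subunit_walk atl g vol A a b d \<epsilon> balls \<rho>0 cs D N pts \<psi> \<gamma> \<theta>"
  shows "\<exists>h0 c \<delta> :: real \<Rightarrow> real. \<forall>\<rho>\<in>{0<..\<rho>0}.
    0 < h0 \<rho> \<and> 0 < c \<rho> \<and> 0 < \<delta> \<rho> \<and>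
    (\<forall>i<N \<rho>. \<forall>j. \<forall>x\<in>QA (D \<rho> (pts \<rho> i)) \<rho>. \<forall>t. \<bar>t\<bar> < h0 \<rho> \<longrightarrow>
       exp_X_defined cs \<rho> (D \<rho> (pts \<rho> i)) (\<gamma> \<rho> i) (\<theta> \<rho> i) j t x) \<and>
    (\<forall>x. \<forall>h\<in>{0<..h0 \<rho>}. \<exists>r :: 'm measure. sets r = sets borel \<and>
       (\<forall>B\<in>sets borel.
          emeasure (markov_kernel
            (S_total cs \<rho> (N \<rho>) (\<lambda>i. D \<rho> (pts \<rho> i)) (\<gamma> \<rho>) (\<theta> \<rho>) h) CARD('n) x) B
          = emeasure r B +
            (\<integral>\<^sup>+y\<in>B. (ennreal (c \<rho> / h ^ CARD('n)) *
               indicator {y. riem_dist atl g x y < \<delta> \<rho> * h} y) \<partial>vol)))"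
  by (rule bchoice3[OF subunit_walk.kernel_decomposition[OF assms]])

end
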